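(* Let $k$ be a field and let $f \in k[x_1, \ldots, x_n]$ be a homogeneous polynomial of degree $d > 2$. If $\operatorname{codim}(\operatorname{Sing}(f)) > 4$, then $$\operatorname{dc}(f) \ge \operatorname{codim}(\operatorname{Sing}(f)) + 1.$$
   Context: For a positive integer $m$, $\det_m$ denotes the determinant polynomial of an $m\times m$ matrix of indeterminates. For $f \in k[x_1,\ldots,x_n]$, a determinantal expression of size $m$ for $f$ is an affine linear map $L\colon k^n \to k^{m\times m}$ with $f(x) = \det_m(L(x))$; the determinantal complexity $\operatorname{dc}(f)$ is the smallest $m$ for which such an expression exists. $\operatorname{Sing}(f)$ denotes the singular locus of the affine hypersurface $\mathrm{V}(f) \subseteq k^n$ (the common zero locus of $f$ and all its partial derivatives $\partial f/\partial x_i$), and $\operatorname{codim}$ is its codimension in affine $n$-space. *)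

theory Defs
  imports
    "HOL-Library.Poly_Mapping"
    "HOL-Library.Extended_Nat"
    "HOL-Algebra.Ideal"
    "HOL-Algebra.Algebraic_Closure_Type"
    "Jordan_Normal_Form.Determinant"
begin

text \<open>
  Polynomials over \<open>'k\<close> with one indeterminate for each element of the index type \<open>'n\<close>:
  finitely supported maps from exponent vectors to coefficients, with convolution product.
  For finite \<open>'n\<close> this is the ring \<open>k[x\<^sub>1,\<dots>,x\<^sub>n]\<close> with \<open>n = CARD('n)\<close>.
\<close>

type_synonym ('n, 'k) mpol = "('n \<Rightarrow>\<^sub>0 nat) \<Rightarrow>\<^sub>0 'k"

definition Const :: "'k::zero \<Rightarrow> ('n, 'k) mpol" where
  "Const a = Poly_Mapping.single 0 a"

definition Var :: "'n \<Rightarrow> ('n, 'k::zero_neq_one) mpol" where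
  "Var v = Poly_Mapping.single (Poly_Mapping.single v 1) 1"

text \<open>The zero polynomial counts as homogeneous of every degree.\<close>

definition homogeneous_of_degree :: "nat \<Rightarrow> ('n::finite, 'k::zero) mpol \<Rightarrow> bool" where
  "homogeneous_of_degree d f \<longleftrightarrow>
     (\<forall>e \<in> Poly_Mapping.keys f. (\<Sum>v\<in>UNIV. Poly_Mapping.lookup e v) = d)"

text \<open>
  Formal partial derivative. If \<open>e\<close> has \<open>v\<close>-exponent 0, the exponent subtraction truncates,
  but the coefficient of that term is 0.
\<close>

definition partial_deriv :: "'n \<Rightarrow> ('n, 'k::comm_ring_1) mpol \<Rightarrow> ('n, 'k) mpol" where
  "partial_deriv v f =
     (\<Sum>e \<in> Poly_Mapping.keys f.
        Poly_Mapping.single (e - Poly_Mapping.single v 1)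
          (of_nat (Poly_Mapping.lookup e v) * Poly_Mapping.lookup f e))"

text \<open>
  The affine linear map \<open>x \<mapsto> A + (\<Sum>v. x\<^sub>v B\<^sub>v)\<close> into \<open>m \<times> m\<close> matrices, as a matrix of
  polynomials. The equation \<open>f = det (L(x))\<close> is an identity of polynomials, which over a finite
  field says more than equality of functions.
\<close>

definition affine_matrix ::
  "nat \<Rightarrow> 'k mat \<Rightarrow> ('n \<Rightarrow> 'k mat) \<Rightarrow> ('n::finite, 'k::comm_ring_1) mpol mat" where
  "affine_matrix m A B =
     mat m m (\<lambda>(i, j). Const (A $$ (i, j)) + (\<Sum>v\<in>UNIV. Const (B v $$ (i, j)) * Var v))"

definition has_determinantal_expression :: "nat \<Rightarrow> ('n::finite, 'k::comm_ring_1) mpol \<Rightarrow> bool" where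
  "has_determinantal_expression m f \<longleftrightarrow>
     (\<exists>A B. A \<in> carrier_mat m m \<and> (\<forall>v. B v \<in> carrier_mat m m) \<and> f = det (affine_matrix m A B))"

text \<open>
  The infimum in \<open>enat\<close> is the least element of the set of sizes (it would be \<open>\<infinity>\<close> for an empty
  set, but every polynomial has a determinantal expression).
\<close>

definition dc :: "('n::finite, 'k::comm_ring_1) mpol \<Rightarrow> enat" where
  "dc f = (INF m \<in> {m. m > 0 \<and> has_determinantal_expression m f}. enat m)"

text \<open>
  Affine space over an arbitrary field \<open>k\<close> is taken to be the prime spectrum of the polynomial
  ring, and \<open>f\<close> vanishes at the point \<open>P\<close> iff \<open>f \<in> P\<close>. For algebraically closed \<open>k\<close> this gives the
  same codimensions as working with \<open>k\<close>-points; for other fields the set of \<open>k\<close>-points can be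
  too small (over a finite field it is always finite).
\<close>

definition prime_spectrum :: "'r::comm_ring_1 set set" where
  "prime_spectrum = {P. primeideal P (ring_of_type_algebra :: 'r ring)}"

definition Sing :: "('n, 'k::comm_ring_1) mpol \<Rightarrow> ('n, 'k) mpol set set" where
  "Sing f = {P \<in> prime_spectrum. f \<in> P \<and> (\<forall>v. partial_deriv v f \<in> P)}"

definition height :: "'r::comm_ring_1 set \<Rightarrow> enat" where
  "height P = Sup {enat h | h. \<exists>C :: nat \<Rightarrow> 'r set.
     (\<forall>i\<le>h. C i \<in> prime_spectrum) \<and> (\<forall>i<h. C i \<subset> C (Suc i)) \<and> C h = P}"

text \<open>
  Codimension of a closed subset of the spectrum. The irreducible closed subsets are the closures
  of points \<open>P\<close>, of codimension \<open>height P\<close>; a closed set has the least codimension of an irreducible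
  closed set contained in it (and codimension \<open>\<infinity>\<close> if it is empty).
\<close>

definition codim :: "'r::comm_ring_1 set set \<Rightarrow> enat" where
  "codim Z = (INF P \<in> Z. height P)"

end

theory Submission
  imports Defs
begin

text \<open>
  Write \<open>f = det (A + B(x))\<close> with an \<open>m \<times> m\<close> matrix. Since \<open>f\<close> is homogeneous of positive degree,
  \<open>det A = 0\<close>, and constant row and column operations make \<open>A\<close> diagonal with entries 0 and 1.

  If \<open>A\<close> has corank at least 2, the locus where \<open>A + B(x)\<close> has rank at most \<open>m - 2\<close> passes
  through the origin. It is cut out of the product of affine space with the variety of matrices
  of rank at most \<open>m - 2\<close>, which has codimension 4, by the \<open>m\<^sup>2\<close> equations \<open>T = A + B(x)\<close>, so it has
  codimension at most 4. It lies in the singular locus of \<open>f\<close>, a contradiction.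

  Hence \<open>A = diag(0, 1, \<dots>, 1)\<close>. The linear and the quadratic part of \<open>f\<close> vanish because \<open>d > 2\<close>. So
  the upper left entry is 0 and the linear forms in the first row and column satisfy
  \<open>\<Sum>\<^sub>i b\<^sub>i c\<^sub>i = 0\<close>: their coefficient vectors span a totally isotropic subspace of the hyperbolic space
  of dimension \<open>2 (m - 1)\<close>, and \<open>m - 1\<close> linear forms generate all of them. Where they vanish, \<open>f\<close> is
  singular, so the codimension is at most \<open>m - 1\<close>.

  Codimensions are bounded through growth of dimension filtrations. An ideal of \<open>k[x]\<close> that meets
  \<open>k[x\<^sub>S]\<close> nontrivially for every set \<open>S\<close> of \<open>s\<close> variables has a quotient of growth less than \<open>s\<close>,
  as one sees from leading terms; otherwise it lies in a prime that meets some \<open>k[x\<^sub>S]\<close> trivially, and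
  such a prime has height at most \<open>n - s\<close>. Dividing by an element of positive weight lowers the growth
  by at most one.
\<close>

section \<open>Weights on polynomial rings\<close>

text \<open>Counting equations bounds a codimension only where the common zero locus is nonempty, so
  the argument has to be local at the origin. Weights express this without localisation: the
  equations \<open>h l\<close> have positive weight, hence are nilpotent modulo high weight, and
  dividing by them keeps the expected growth. The variety of matrices of small rank enters through a
  parametrisation rather than through its equations. The price is that the relevant ring is a
  subalgebra \<open>R\<close> of a polynomial ring, and that the \<open>h l\<close> generate an
  ideal \<open>J\<close> of \<open>R\<close> alone. As \<open>R\<close> is the image of k[x] plus
  \<open>J\<close>, its quotient by \<open>J\<close> is also the quotient of k[x] by the preimage
  \<open>I\<close> of \<open>J\<close>, and the growth on the two sides can be compared. This one
  comparison serves both coranks. Growth is measured by cardinalities of finite spanning sets, which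
  is why all estimates carry explicit constants.\<close>

lemma Const_0 [simp]: "Const 0 = 0"
  by (simp add: Const_def)

lemma Const_1 [simp]: "Const 1 = 1"
  by (simp add: Const_def)

lemma Const_add: "Const (a + b) = Const a + Const b"
  by (simp add: Const_def single_add)

lemma Const_mult: "Const (a * b) = Const a * Const b"
  by (simp add: Const_def mult_single)

lemma Const_uminus: "Const (- a) = - Const a"
  by (simp add: Const_def single_uminus)

lemma Const_sum: "Const (sum f A) = (\<Sum>x\<in>A. Const (f x))"
  by (induction A rule: infinite_finite_induct) (simp_all add: Const_add)

interpretation mp: vector_space "\<lambda>c (p::('x, 'k::field) mpol). Const c * p"
  by unfold_locales (auto simp: Const_add Const_mult algebra_simps)

text \<open>Pigeonhole for dimensions modulo \<open>J\<close>: each element \<open>v\<close> of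
  \<open>V\<close> is eliminated by subtracting multiples of one \<open>b z\<close> that really
  involves it, which uses up at most one index per element of \<open>V\<close>.\<close>

lemma nontrivial_relation:
  fixes b :: "'i \<Rightarrow> ('x, 'k::field) mpol"
  assumes "finite V" "finite Y" "card V < card Y" "mp.subspace J"
    and "\<And>i. i \<in> Y \<Longrightarrow> b i \<in> mp.span (V \<union> J)"
  shows "\<exists>c. (\<exists>i\<in>Y. c i \<noteq> 0) \<and> (\<Sum>i\<in>Y. Const (c i) * b i) \<in> J"
  using assms(1,2,3,5)
proof (induction V arbitrary: Y b rule: finite_induct)
  case empty
  then obtain i where i: "i \<in> Y" by fastforce
  have "b i \<in> J" using empty.prems(3)[OF i] assms(4) by (simp add: mp.span_eq_iff[THEN iffD2])
  moreover have "(\<Sum>j\<in>Y. Const (if j = i then 1 else 0) * b j) = (\<Sum>j\<in>Y. if j = i then b j else 0)"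
    by (intro sum.cong) auto
  ultimately have "(\<Sum>j\<in>Y. Const (if j = i then 1 else 0) * b j) \<in> J"
    using i empty.prems(1) by simp
  then show ?case using i by (intro exI[of _ "\<lambda>j. if j = i then 1 else 0"]) auto
next
  case (insert v V)
  have "\<forall>i\<in>Y. \<exists>k. b i - Const k * v \<in> mp.span (V \<union> J)"
    using insert.prems(3) by (metis Un_insert_left mp.span_breakdown_eq)
  then obtain \<beta> where \<beta>: "\<And>i. i \<in> Y \<Longrightarrow> b i - Const (\<beta> i) * v \<in> mp.span (V \<union> J)"
    by metis
  show ?case
  proof (cases "\<forall>i\<in>Y. \<beta> i = 0")
    case True
    then have "\<And>i. i \<in> Y \<Longrightarrow> b i \<in> mp.span (V \<union> J)" using \<beta> by fastforce
    then show ?thesis using insert.IH[of Y b] insert by simp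
  next
    case False
    then obtain z where z: "z \<in> Y" "\<beta> z \<noteq> 0" by auto
    define b' where "b' i = b i - Const (\<beta> i / \<beta> z) * b z" for i
    have "b' i \<in> mp.span (V \<union> J)" if "i \<in> Y - {z}" for i
    proof -
      have "b' i = (b i - Const (\<beta> i) * v) - Const (\<beta> i / \<beta> z) * (b z - Const (\<beta> z) * v)"
        proof -
        have "Const (\<beta> i / \<beta> z) * Const (\<beta> z) = (Const (\<beta> i) :: ('x, 'k) mpol)" using z by (simp flip: Const_mult)
        then show ?thesis by (simp add: b'_def right_diff_distrib flip: mult.assoc)
      qed
      then show ?thesis using \<beta>[of i] \<beta>[OF z(1)] that
        by (metis DiffD1 mp.span_diff mp.span_scale)
    qed
    moreover have "card V < card (Y - {z})" using insert z by simp
    ultimately obtain c where c: "\<exists>i\<in>Y - {z}. c i \<noteq> 0" "(\<Sum>i\<in>Y - {z}. Const (c i) * b' i) \<in> J"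
      using insert.IH[of "Y - {z}" b'] insert.prems by auto
    define c' where "c' i = (if i = z then - (\<Sum>j\<in>Y - {z}. c j * (\<beta> j / \<beta> z)) else c i)" for i
    have "(\<Sum>i\<in>Y. Const (c' i) * b i) = Const (c' z) * b z + (\<Sum>i\<in>Y - {z}. Const (c' i) * b i)"
      using insert.prems(1) z(1) by (simp add: sum.remove)
    also have "(\<Sum>i\<in>Y - {z}. Const (c' i) * b i) = (\<Sum>i\<in>Y - {z}. Const (c i) * b i)"
      by (intro sum.cong) (auto simp: c'_def)
    also have "Const (c' z) * b z = - (\<Sum>i\<in>Y - {z}. Const (c i) * (Const (\<beta> i / \<beta> z) * b z))"
      by (simp add: c'_def Const_uminus Const_sum Const_mult sum_distrib_right mult.assoc)
    also have "\<dots> + (\<Sum>i\<in>Y - {z}. Const (c i) * b i) = (\<Sum>i\<in>Y - {z}. Const (c i) * b' i)"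
      by (simp add: b'_def algebra_simps sum_subtractf)
    finally have "(\<Sum>i\<in>Y. Const (c' i) * b i) \<in> J" using c(2) by simp
    moreover have "\<exists>i\<in>Y. c' i \<noteq> 0" using c(1) by (auto simp: c'_def)
    ultimately show ?thesis by blast
  qed
qed

section \<open>Weights of exponent vectors and the filtration by weight\<close>

definition wt :: "('x \<Rightarrow> nat) \<Rightarrow> ('x \<Rightarrow>\<^sub>0 nat) \<Rightarrow> nat" where
  "wt w e = (\<Sum>v\<in>Poly_Mapping.keys e. w v * Poly_Mapping.lookup e v)"

lemma wt_superset:
  assumes "finite A" "Poly_Mapping.keys e \<subseteq> A"
  shows "wt w e = (\<Sum>v\<in>A. w v * Poly_Mapping.lookup e v)"
  unfolding wt_def by (rule sum.mono_neutral_left) (use assms in \<open>auto simp: in_keys_iff\<close>)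

lemma wt_0 [simp]: "wt w 0 = 0"
  by (simp add: wt_def)

lemma wt_single [simp]: "wt w (Poly_Mapping.single v k) = w v * k"
  by (simp add: wt_def)

lemma wt_add: "wt w (e + e') = wt w e + wt w e'"
proof -
  let ?A = "Poly_Mapping.keys e \<union> Poly_Mapping.keys e'"
  have "Poly_Mapping.keys (e + e') \<subseteq> ?A" by (rule keys_add)
  then show ?thesis
    by (simp add: wt_superset[of ?A] lookup_add algebra_simps sum.distrib)
qed

lemma wt_sum: "wt w (sum f A) = (\<Sum>x\<in>A. wt w (f x))"
  by (induction A rule: infinite_finite_induct) (simp_all add: wt_add)

lemma lookup_le_wt:
  assumes "\<And>v. w v > 0"
  shows "Poly_Mapping.lookup e v \<le> wt w e"
proof (cases "v \<in> Poly_Mapping.keys e")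
  case True
  have "Poly_Mapping.lookup e v \<le> w v * Poly_Mapping.lookup e v" using assms[of v] by simp
  also have "\<dots> \<le> wt w e" unfolding wt_def by (rule member_le_sum) (use True in auto)
  finally show ?thesis .
qed (simp add: in_keys_iff)

text \<open>For unit weights this is the \<open>t\<close>-th power of the maximal ideal at the
  origin. Weight 0 is allowed for some variables.\<close>

definition wfilt :: "('x \<Rightarrow> nat) \<Rightarrow> nat \<Rightarrow> ('x, 'k::zero) mpol set" where
  "wfilt w t = {p. \<forall>e\<in>Poly_Mapping.keys p. t \<le> wt w e}"

lemma wfilt_antimono: "s \<le> t \<Longrightarrow> wfilt w t \<subseteq> wfilt w s"
  by (auto simp: wfilt_def)

lemma wfilt_0 [simp]: "wfilt w 0 = UNIV"
  by (auto simp: wfilt_def)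

lemma zero_in_wfilt [simp]: "0 \<in> wfilt w t"
  by (simp add: wfilt_def)

lemma wfilt_add: "p \<in> wfilt w t \<Longrightarrow> q \<in> wfilt w t \<Longrightarrow> p + q \<in> wfilt w t"
  using keys_add by (fastforce simp: wfilt_def)

lemma wfilt_uminus [simp]: "- p \<in> wfilt w t \<longleftrightarrow> (p :: ('x, 'k::comm_ring_1) mpol) \<in> wfilt w t"
  by (auto simp: wfilt_def in_keys_iff)

lemma wfilt_diff: "p \<in> wfilt w t \<Longrightarrow> q \<in> wfilt w t \<Longrightarrow> p - q \<in> wfilt w t"
  for p q :: "('x, 'k::comm_ring_1) mpol"
  using wfilt_add[of p w t "- q"] by simp

lemma wfilt_sum: "(\<And>x. x \<in> A \<Longrightarrow> f x \<in> wfilt w t) \<Longrightarrow> sum f A \<in> wfilt w t"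
  by (induction A rule: infinite_finite_induct) (simp_all add: wfilt_add)

lemma wfilt_mult:
  fixes p q :: "('x, 'k::comm_ring_1) mpol"
  assumes "p \<in> wfilt w s" "q \<in> wfilt w t"
  shows "p * q \<in> wfilt w (s + t)"
proof -
  have "s + t \<le> wt w e" if e: "e \<in> Poly_Mapping.keys (p * q)" for e
  proof -
    obtain a b where "a \<in> Poly_Mapping.keys p" "b \<in> Poly_Mapping.keys q" "e = a + b"
      using keys_mult[of p q] e by blast
    then show ?thesis using assms by (auto simp: wfilt_def wt_add intro: add_mono)
  qed
  then show ?thesis by (simp add: wfilt_def)
qed

lemma wfilt_mult_left: "q \<in> wfilt w t \<Longrightarrow> p * q \<in> wfilt w t"
  for p q :: "('x, 'k::comm_ring_1) mpol"
  using wfilt_mult[of p w 0 q t] by simp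

lemma wfilt_power:
  fixes p :: "('x, 'k::comm_ring_1) mpol"
  shows "p \<in> wfilt w t \<Longrightarrow> p ^ k \<in> wfilt w (t * k)"
  by (induction k) (auto intro: wfilt_mult)

lemma single_in_wfilt: "t \<le> wt w e \<Longrightarrow> Poly_Mapping.single e c \<in> wfilt w t"
  by (simp add: wfilt_def)

lemma keys_mpol_sum: "Poly_Mapping.keys (sum f A) \<subseteq> (\<Union>x\<in>A. Poly_Mapping.keys (f x))"
proof (induction A rule: infinite_finite_induct)
  case (insert x A)
  then show ?case using keys_add[of "f x" "sum f A"] by auto
qed auto

lemma mpol_eq_sum: "p = (\<Sum>e\<in>Poly_Mapping.keys p. Poly_Mapping.single e (Poly_Mapping.lookup p e))"
  by (rule poly_mapping_eqI)
    (simp add: lookup_sum lookup_single when_def in_keys_iff)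

lemma lookup_Const_mult: "Poly_Mapping.lookup (Const c * p) e = c * Poly_Mapping.lookup p e"
  for p :: "('x, 'k::comm_ring_1) mpol"
proof -
  have "Const c * p = Poly_Mapping.map ((*) c) p"
    by (simp add: Const_def mult_map_scale_conv_mult)
  then show ?thesis by (auto simp: map.rep_eq when_def)
qed

lemma single_eq_Const_mult: "Poly_Mapping.single e c = Const c * Poly_Mapping.single e (1::'k::comm_ring_1)"
  by (simp add: Const_def mult_single)

lemma subspace_wfilt: "mp.subspace (wfilt w t :: ('x, 'k::field) mpol set)"
  by (auto simp: mp.subspace_def wfilt_add wfilt_mult_left)

section \<open>Prime ideals of polynomial rings\<close>

definition is_ideal :: "'r::comm_ring_1 set \<Rightarrow> bool" where
  "is_ideal I \<longleftrightarrow> 0 \<in> I \<and> (\<forall>a\<in>I. \<forall>b\<in>I. a + b \<in> I) \<and> (\<forall>a. \<forall>b\<in>I. a * b \<in> I)"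

lemma is_idealD:
  assumes "is_ideal I"
  shows "0 \<in> I" "a \<in> I \<Longrightarrow> b \<in> I \<Longrightarrow> a + b \<in> I" "b \<in> I \<Longrightarrow> a * b \<in> I" "b \<in> I \<Longrightarrow> b * a \<in> I"
    "b \<in> I \<Longrightarrow> - b \<in> I" "a \<in> I \<Longrightarrow> b \<in> I \<Longrightarrow> a - b \<in> I"
proof -
  show 0: "0 \<in> I" "\<And>a b. a \<in> I \<Longrightarrow> b \<in> I \<Longrightarrow> a + b \<in> I" "\<And>a b. b \<in> I \<Longrightarrow> a * b \<in> I"
    "\<And>a b. b \<in> I \<Longrightarrow> b * a \<in> I"
    using assms by (auto simp: is_ideal_def mult.commute)
  show 1: "- b \<in> I" if "b \<in> I" for b
    using 0(3)[OF that, of "-1"] by simp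
  show "a - b \<in> I" if "a \<in> I" "b \<in> I" for a b
    using 0(2)[OF that(1) 1[OF that(2)]] by simp
qed

lemma is_ideal_sum: "is_ideal I \<Longrightarrow> (\<And>x. x \<in> A \<Longrightarrow> f x \<in> I) \<Longrightarrow> sum f A \<in> I"
  by (induction A rule: infinite_finite_induct) (auto simp: is_idealD)

lemma subspace_ideal: "is_ideal I \<Longrightarrow> mp.subspace (I :: ('x, 'k::field) mpol set)"
  by (auto simp: mp.subspace_def is_idealD)

lemma ideal_iff_is_ideal: "ideal I (ring_of_type_algebra :: 'r ring) \<longleftrightarrow> is_ideal (I :: 'r::comm_ring_1 set)"
proof
  assume "ideal I (ring_of_type_algebra :: 'r ring)"
  then interpret ideal I "ring_of_type_algebra :: 'r ring" .
  show "is_ideal I"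
    using additive_subgroup.zero_closed[OF is_additive_subgroup]
      additive_subgroup.a_closed[OF is_additive_subgroup] I_l_closed
    by (auto simp: is_ideal_def ring_of_type_algebra_def)
next
  assume I: "is_ideal I"
  interpret ring "ring_of_type_algebra :: 'r ring" by rule
  have inv: "a_inv ring_of_type_algebra a = - a" for a :: 'r
    by (rule minus_equality) (auto simp: ring_of_type_algebra_def)
  have "subgroup I (add_monoid (ring_of_type_algebra :: 'r ring))"
    by (rule add.subgroupI)
      (use is_idealD[OF I] inv in \<open>auto simp: ring_of_type_algebra_def\<close>)
  then show "ideal I (ring_of_type_algebra :: 'r ring)"
    by (rule idealI[OF ring_axioms]) (use is_idealD[OF I] in \<open>auto simp: ring_of_type_algebra_def\<close>)
qed

lemma prime_spectrum_iff:
  "P \<in> prime_spectrum \<longleftrightarrow>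
     is_ideal P \<and> 1 \<notin> P \<and> (\<forall>a b. a * b \<in> P \<longrightarrow> a \<in> P \<or> b \<in> P)"
  for P :: "'r::comm_ring_1 set"
proof
  assume "P \<in> prime_spectrum"
  then interpret primeideal P "ring_of_type_algebra :: 'r ring" by (simp add: prime_spectrum_def)
  have P: "is_ideal P" using ideal_iff_is_ideal ideal_axioms by blast
  moreover have "1 \<notin> P"
    using is_idealD(3)[OF P, of 1] I_notcarr by (auto simp: ring_of_type_algebra_def)
  moreover have "a \<in> P \<or> b \<in> P" if "a * b \<in> P" for a b
    using I_prime[of a b] that by (auto simp: ring_of_type_algebra_def)
  ultimately show "is_ideal P \<and> 1 \<notin> P \<and> (\<forall>a b. a * b \<in> P \<longrightarrow> a \<in> P \<or> b \<in> P)" by blast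
next
  assume P: "is_ideal P \<and> 1 \<notin> P \<and> (\<forall>a b. a * b \<in> P \<longrightarrow> a \<in> P \<or> b \<in> P)"
  then have "primeideal P (ring_of_type_algebra :: 'r ring)"
    by (intro primeidealI cring_from_type_algebra)
      (simp_all add: ideal_iff_is_ideal, auto simp: ring_of_type_algebra_def)
  then show "P \<in> prime_spectrum" by (simp add: prime_spectrum_def)
qed

text \<open>An ideal maximal among those that contain \<open>I\<close> and avoid the multiplicative
  set \<open>M\<close> is prime: adjoining any outside element makes it meet \<open>M\<close>, and
  the product of two such meetings falls back into \<open>P\<close> as soon as \<open>a * b\<close>
  does.\<close>

lemma prime_avoiding:
  fixes I :: "'r::comm_ring_1 set"
  assumes I: "is_ideal I" and disj: "I \<inter> M = {}"
    and M: "1 \<in> M" "\<And>a b. a \<in> M \<Longrightarrow> b \<in> M \<Longrightarrow> a * b \<in> M"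
  shows "\<exists>P\<in>prime_spectrum. I \<subseteq> P \<and> P \<inter> M = {}"
proof -
  let ?A = "{J. is_ideal J \<and> I \<subseteq> J \<and> J \<inter> M = {}}"
  have "\<exists>P\<in>?A. \<forall>Y\<in>?A. P \<subseteq> Y \<longrightarrow> Y = P"
  proof (rule subset_Zorn_nonempty)
    show "?A \<noteq> {}" using I disj by blast
  next
    fix C assume C: "C \<noteq> {}" "subset.chain ?A C"
    then have mem: "\<And>J. J \<in> C \<Longrightarrow> is_ideal J \<and> I \<subseteq> J \<and> J \<inter> M = {}"
      by (auto simp: subset.chain_def)
    have "a + b \<in> \<Union>C" if "a \<in> \<Union>C" "b \<in> \<Union>C" for a b
    proof -
      from that obtain J K where JK: "J \<in> C" "a \<in> J" "K \<in> C" "b \<in> K" by blast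
      then have "J \<subseteq> K \<or> K \<subseteq> J" using C(2) unfolding subset.chain_def by blast
      then consider "J \<subseteq> K" | "K \<subseteq> J" by blast
      then show ?thesis using JK mem by cases (meson UnionI is_idealD(2) subsetD)+
    qed
    moreover have "0 \<in> \<Union>C" using C(1) mem is_idealD(1) by blast
    moreover have "a * b \<in> \<Union>C" if "b \<in> \<Union>C" for a b using that mem is_idealD(3) by blast
    ultimately have "is_ideal (\<Union>C)" by (simp add: is_ideal_def)
    then show "\<Union>C \<in> ?A" using mem C(1) by blast
  qed
  then obtain P where P: "is_ideal P" "I \<subseteq> P" "P \<inter> M = {}"
    and max: "\<And>Y. is_ideal Y \<Longrightarrow> P \<subseteq> Y \<Longrightarrow> Y \<inter> M = {} \<Longrightarrow> Y = P"
    by (smt (verit) mem_Collect_eq subset_trans)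
  have *: "\<exists>p\<in>P. \<exists>r. p + r * a \<in> M" if "a \<notin> P" for a
  proof -
    let ?Y = "{p + r * a | p r. p \<in> P}"
    have "is_ideal ?Y"
      unfolding is_ideal_def
    proof (intro conjI ballI allI)
      show "0 \<in> ?Y" using is_idealD(1)[OF P(1)] by (auto intro!: exI[of _ 0])
    next
      fix x y assume "x \<in> ?Y" "y \<in> ?Y"
      then obtain p r q s where "x = p + r * a" "y = q + s * a" "p \<in> P" "q \<in> P" by blast
      then have "x + y = (p + q) + (r + s) * a" "p + q \<in> P"
        using is_idealD(2)[OF P(1)] by (auto simp: algebra_simps)
      then show "x + y \<in> ?Y" by blast
    next
      fix x y assume "y \<in> ?Y"
      then obtain p r where "y = p + r * a" "p \<in> P" by blast
      then have "x * y = x * p + (x * r) * a" "x * p \<in> P"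
        using is_idealD(3)[OF P(1)] by (auto simp: algebra_simps)
      then show "x * y \<in> ?Y" by blast
    qed
    moreover have "P \<subseteq> ?Y"
    proof
      fix p assume "p \<in> P"
      then have "p = p + 0 * a \<and> p \<in> P" by simp
      then show "p \<in> ?Y" by blast
    qed
    moreover have "a \<in> ?Y"
    proof -
      have "a = 0 + 1 * a \<and> 0 \<in> P" using is_idealD(1)[OF P(1)] by simp
      then show ?thesis by blast
    qed
    ultimately have "?Y \<inter> M \<noteq> {}" using max that by blast
    then show ?thesis by blast
  qed
  have "a \<in> P \<or> b \<in> P" if ab: "a * b \<in> P" for a b
  proof (rule ccontr)
    assume "\<not> (a \<in> P \<or> b \<in> P)"
    then obtain p r q s where "p \<in> P" "p + r * a \<in> M" "q \<in> P" "q + s * b \<in> M" using * by meson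
    then have "(p + r * a) * (q + s * b) \<in> M" using M by blast
    moreover have "(p + r * a) * (q + s * b) = (q + s * b) * p + (r * a) * q + (r * s) * (a * b)"
      by (simp add: algebra_simps)
    then have "(p + r * a) * (q + s * b) \<in> P"
      using \<open>p \<in> P\<close> \<open>q \<in> P\<close> ab is_idealD(2,3)[OF P(1)] by metis
    ultimately show False using P(3) by blast
  qed
  moreover have "1 \<notin> P" using P(3) M(1) by blast
  ultimately show ?thesis using P by (auto simp: prime_spectrum_iff)
qed

section \<open>Coordinate subrings and lowest terms\<close>

definition polys_in :: "'x set \<Rightarrow> ('x, 'k::zero) mpol set" where
  "polys_in S = {p. \<forall>e\<in>Poly_Mapping.keys p. Poly_Mapping.keys e \<subseteq> S}"

text \<open>An initial term without ties: \<open>\<mu>\<close> is the only monomial of weight at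
  most \<open>wt w \<mu>\<close>. This uniqueness makes lowest terms multiplicative over a domain of
  coefficients.\<close>

definition has_lowest :: "('x \<Rightarrow> nat) \<Rightarrow> ('x \<Rightarrow>\<^sub>0 nat) \<Rightarrow> ('x, 'k::comm_ring_1) mpol \<Rightarrow> bool" where
  "has_lowest w \<mu> p \<longleftrightarrow> (\<exists>c. c \<noteq> 0 \<and> p - Poly_Mapping.single \<mu> c \<in> wfilt w (Suc (wt w \<mu>)))"

lemma has_lowestI: "c \<noteq> 0 \<Longrightarrow> p - Poly_Mapping.single \<mu> c \<in> wfilt w (Suc (wt w \<mu>)) \<Longrightarrow> has_lowest w \<mu> p"
  by (auto simp: has_lowest_def)

lemma has_lowest_in_wfilt:
  assumes "has_lowest w \<mu> p"
  shows "p \<in> wfilt w (wt w \<mu>)"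
proof -
  obtain c where c: "p - Poly_Mapping.single \<mu> c \<in> wfilt w (Suc (wt w \<mu>))"
    using assms by (auto simp: has_lowest_def)
  then have "p - Poly_Mapping.single \<mu> c \<in> wfilt w (wt w \<mu>)"
    using wfilt_antimono[of "wt w \<mu>" "Suc (wt w \<mu>)" w] by auto
  moreover have "Poly_Mapping.single \<mu> c \<in> wfilt w (wt w \<mu>)" by (simp add: single_in_wfilt)
  ultimately show ?thesis using wfilt_add by fastforce
qed

lemma has_lowest_1 [simp]: "has_lowest w 0 1"
  by (rule has_lowestI[of 1]) auto

lemma has_lowest_mult:
  fixes p q :: "('x, 'k::idom) mpol"
  assumes "has_lowest w \<mu> p" "has_lowest w \<nu> q"
  shows "has_lowest w (\<mu> + \<nu>) (p * q)"
proof -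
  obtain c d where c: "c \<noteq> 0" "p - Poly_Mapping.single \<mu> c \<in> wfilt w (Suc (wt w \<mu>))"
    and d: "d \<noteq> 0" "q - Poly_Mapping.single \<nu> d \<in> wfilt w (Suc (wt w \<nu>))"
    using assms by (auto simp: has_lowest_def)
  have "p * q - Poly_Mapping.single (\<mu> + \<nu>) (c * d) =
     (p - Poly_Mapping.single \<mu> c) * q + Poly_Mapping.single \<mu> c * (q - Poly_Mapping.single \<nu> d)"
    by (simp add: algebra_simps mult_single)
  moreover have "(p - Poly_Mapping.single \<mu> c) * q \<in> wfilt w (Suc (wt w \<mu>) + wt w \<nu>)"
    using c has_lowest_in_wfilt[OF assms(2)] by (intro wfilt_mult)
  moreover have "Poly_Mapping.single \<mu> c * (q - Poly_Mapping.single \<nu> d) \<in> wfilt w (wt w \<mu> + Suc (wt w \<nu>))"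
    using d by (intro wfilt_mult single_in_wfilt) auto
  ultimately show ?thesis
    using c(1) d(1) by (intro has_lowestI[of "c * d"]) (auto simp: wt_add intro: wfilt_add)
qed

lemma has_lowest_power:
  fixes p :: "('x, 'k::idom) mpol"
  assumes "has_lowest w \<mu> p"
  shows "has_lowest w (\<Sum>i<k. \<mu>) (p ^ k)"
proof (induction k)
  case (Suc k)
  then show ?case using has_lowest_mult[OF assms Suc] by (simp add: add.commute)
qed simp

lemma has_lowest_prod:
  fixes f :: "'i \<Rightarrow> ('x, 'k::idom) mpol"
  assumes "\<And>i. i \<in> A \<Longrightarrow> has_lowest w (m i) (f i)"
  shows "has_lowest w (\<Sum>i\<in>A. m i) (\<Prod>i\<in>A. f i)"
  using assms by (induction A rule: infinite_finite_induct) (auto intro: has_lowest_mult)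

lemma has_lowest_lookup:
  assumes "has_lowest w \<mu> p"
  shows "Poly_Mapping.lookup p \<mu> \<noteq> 0"
    and "wt w e \<le> wt w \<mu> \<Longrightarrow> e \<noteq> \<mu> \<Longrightarrow> Poly_Mapping.lookup p e = 0"
proof -
  obtain c where c: "c \<noteq> 0" "p - Poly_Mapping.single \<mu> c \<in> wfilt w (Suc (wt w \<mu>))"
    using assms by (auto simp: has_lowest_def)
  then have *: "Poly_Mapping.lookup (p - Poly_Mapping.single \<mu> c) e = 0" if "wt w e \<le> wt w \<mu>" for e
    using that by (force simp: wfilt_def in_keys_iff)
  show "Poly_Mapping.lookup p \<mu> \<noteq> 0" using *[of \<mu>] c(1) by (simp add: lookup_minus)
  show "Poly_Mapping.lookup p e = 0" if "wt w e \<le> wt w \<mu>" "e \<noteq> \<mu>"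
    using *[of e] that by (simp add: lookup_minus lookup_single)
qed

lemma has_lowest_nonzero: "has_lowest w \<mu> p \<Longrightarrow> p \<noteq> 0"
  using has_lowest_lookup(1) by fastforce

lemma has_lowest_exists:
  assumes "inj_on (wt w) (Poly_Mapping.keys p)" "p \<noteq> 0"
  shows "\<exists>\<mu>. has_lowest w \<mu> p"
proof -
  let ?K = "Poly_Mapping.keys p"
  have K: "?K \<noteq> {}" using assms(2)
    by (metis ex_in_conv in_keys_iff lookup_zero poly_mapping_eqI)
  define \<mu> where "\<mu> = arg_min_on (wt w) ?K"
  have \<mu>: "\<mu> \<in> ?K" "\<And>e. e \<in> ?K \<Longrightarrow> wt w \<mu> \<le> wt w e"
    using arg_min_if_finite[OF finite_keys K, of "wt w"] unfolding \<mu>_def by (auto simp: not_less)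
  have "Suc (wt w \<mu>) \<le> wt w e" if e: "e \<in> Poly_Mapping.keys (p - Poly_Mapping.single \<mu> (Poly_Mapping.lookup p \<mu>))" for e
  proof -
    have "e \<noteq> \<mu>" "e \<in> ?K"
      using e by (auto simp: in_keys_iff lookup_minus lookup_single when_def split: if_splits)
    then show ?thesis using \<mu> assms(1) by (metis Suc_leI inj_onD le_neq_implies_less)
  qed
  then have "has_lowest w \<mu> p"
    using \<mu>(1) by (intro has_lowestI[of "Poly_Mapping.lookup p \<mu>"]) (auto simp: wfilt_def in_keys_iff)
  then show ?thesis by blast
qed

text \<open>Kronecker substitution: with \<open>w v = N ^ idx v\<close>, two distinct exponent
  vectors of equal weight make \<open>N\<close> a root of the nonzero polynomial
  \<open>Q e e'\<close>, so all but finitely many \<open>N\<close> separate a finite set.\<close>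

lemma separating_weights:
  fixes E :: "('n::finite \<Rightarrow>\<^sub>0 nat) set"
  assumes "finite E"
  shows "\<exists>w. (\<forall>v. w v > 0) \<and> inj_on (wt w) E"
proof -
  obtain idx :: "'n \<Rightarrow> nat" where idx: "inj idx"
    using finite_imp_inj_to_nat_seg[of "UNIV :: 'n set"] by auto
  define Q where "Q e e' = (\<Sum>v\<in>UNIV. Polynomial.monom
    (int (Poly_Mapping.lookup e v) - int (Poly_Mapping.lookup e' v)) (idx v))" for e e' :: "'n \<Rightarrow>\<^sub>0 nat"
  have coeff_Q: "poly.coeff (Q e e') (idx u) = int (Poly_Mapping.lookup e u) - int (Poly_Mapping.lookup e' u)" for e e' u
    by (simp add: Q_def coeff_sum inj_eq[OF idx])
  have Q0: "Q e e' \<noteq> 0" if ne: "e \<noteq> e'" for e e'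
  proof -
    obtain u where "Poly_Mapping.lookup e u \<noteq> Poly_Mapping.lookup e' u"
      using ne by (metis poly_mapping_eqI)
    then have "poly.coeff (Q e e') (idx u) \<noteq> 0" by (simp add: coeff_Q)
    then show ?thesis by auto
  qed
  let ?bad = "\<Union>e\<in>E. \<Union>e'\<in>E - {e}. {x. poly (Q e e') x = 0}"
  have "finite ?bad"
    using assms by (intro finite_UN_I poly_roots_finite Q0) auto
  moreover have "infinite (int ` {0<..})"
    by (simp add: finite_image_iff infinite_Ioi)
  ultimately have "int ` {0<..} - ?bad \<noteq> {}"
    using Diff_infinite_finite infinite_imp_nonempty by blast
  then obtain N where N: "N > 0" "int N \<notin> ?bad" by blast
  define w where "w v = N ^ idx v" for v
  have "int (wt w e) - int (wt w e') = poly (Q e e') (int N)" for e e'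
    by (simp add: Q_def poly_sum Polynomial.poly_monom w_def wt_superset[of UNIV] algebra_simps sum_subtractf)
  then have "int N \<in> {x. poly (Q e e') x = 0}" if "wt w e = wt w e'" for e e'
    using that by (metis diff_self mem_Collect_eq)
  then have "inj_on (wt w) E"
    using N(2) by (intro inj_onI) blast
  then show ?thesis using N(1) by (intro exI[of _ w]) (auto simp: w_def)
qed

text \<open>Weights that separate the monomials within each factor provide lowest terms, and these
  multiply.\<close>

lemma mpol_mult_nonzero:
  fixes p q :: "('n::finite, 'k::field) mpol"
  assumes "p \<noteq> 0" "q \<noteq> 0"
  shows "p * q \<noteq> 0"
proof -
  obtain w where "inj_on (wt w) (Poly_Mapping.keys p \<union> Poly_Mapping.keys q)"
    using separating_weights[of "Poly_Mapping.keys p \<union> Poly_Mapping.keys q"] by auto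
  then obtain \<mu> \<nu> where "has_lowest w \<mu> p" "has_lowest w \<nu> q"
    using assms has_lowest_exists by (metis inj_on_Un)
  then show ?thesis using has_lowest_mult has_lowest_nonzero by blast
qed

lemma polys_in_mult:
  fixes p q :: "('x, 'k::comm_ring_1) mpol"
  assumes "p \<in> polys_in S" "q \<in> polys_in S"
  shows "p * q \<in> polys_in S"
proof -
  have "Poly_Mapping.keys e \<subseteq> S" if e: "e \<in> Poly_Mapping.keys (p * q)" for e
  proof -
    obtain a b where "a \<in> Poly_Mapping.keys p" "b \<in> Poly_Mapping.keys q" "e = a + b"
      using keys_mult[of p q] e by blast
    then show ?thesis using assms keys_add[of a b] by (fastforce simp: polys_in_def)
  qed
  then show ?thesis by (simp add: polys_in_def)
qed

text \<open>The nonzero elements of \<open>polys_in S\<close> form a multiplicative set.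
  Geometrically, some irreducible closed subset of the zero locus of \<open>I\<close> still projects
  dominantly to the coordinate space of \<open>S\<close>.\<close>

lemma prime_disjoint_polys_in:
  fixes I :: "('n::finite, 'k::field) mpol set"
  assumes "is_ideal I" "I \<inter> polys_in S = {0}"
  shows "\<exists>P\<in>prime_spectrum. I \<subseteq> P \<and> P \<inter> polys_in S = {0}"
proof -
  have "\<exists>P\<in>prime_spectrum. I \<subseteq> P \<and> P \<inter> (polys_in S - {0}) = {}"
  proof (rule prime_avoiding)
    show "1 \<in> polys_in S - {0 :: ('n, 'k) mpol}" by (simp add: polys_in_def)
    show "a * b \<in> polys_in S - {0}" if "a \<in> polys_in S - {0}" "b \<in> polys_in S - {0}" for a b :: "('n, 'k) mpol"
      using that mpol_mult_nonzero polys_in_mult by blast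
  qed (use assms in auto)
  then obtain P where P: "P \<in> prime_spectrum" "I \<subseteq> P" "P \<inter> (polys_in S - {0}) = {}" by blast
  then have "0 \<in> P \<inter> polys_in S" using is_idealD(1) by (auto simp: prime_spectrum_iff polys_in_def)
  then show ?thesis using P by (intro bexI[of _ P]) auto
qed

section \<open>Growth and heights\<close>

text \<open>Sort the vectors by the set \<open>T\<close> of large coordinates: small coordinates
  have at most \<open>N\<close> values each, and fewer than \<open>s\<close> coordinates range over
  \<open>t + 1\<close> values. The factor \<open>t + 1\<close> on the left stands for an exponent
  \<open>s - 1\<close> on the right, so that \<open>s = 0\<close> is no exception.\<close>

lemma card_bounded_exponents:
  fixes B :: "('n::finite \<Rightarrow>\<^sub>0 nat) set"
  assumes B: "\<And>u v. u \<in> B \<Longrightarrow> Poly_Mapping.lookup u v \<le> t"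
    and few: "\<And>u. u \<in> B \<Longrightarrow> card {v. N \<le> Poly_Mapping.lookup u v} < s"
    and N: "N > 0"
  shows "finite B" "card B * (t + 1) \<le> 2 ^ card (UNIV :: 'n set) * N ^ card (UNIV :: 'n set) * (t + 1) ^ s"
proof -
  define G where "G T = PiE (UNIV :: 'n set) (\<lambda>v. if v \<in> T then {..t} else {..<N})" for T
  let ?U = "\<Union>T\<in>{T :: 'n set. card T < s}. (G :: 'n set \<Rightarrow> ('n \<Rightarrow> nat) set) T"
  have fin: "finite (G T)" for T unfolding G_def by (intro finite_PiE) auto
  have sub: "Poly_Mapping.lookup ` B \<subseteq> ?U"
  proof
    fix g assume "g \<in> Poly_Mapping.lookup ` B"
    then obtain u where u: "u \<in> B" "g = Poly_Mapping.lookup u" by blast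
    then have "g \<in> G {v. N \<le> Poly_Mapping.lookup u v}"
      using B[of u] by (auto simp: G_def)
    then show "g \<in> ?U" using few[OF u(1)] by blast
  qed
  have inj: "inj_on Poly_Mapping.lookup B" by (auto intro!: inj_onI poly_mapping_eqI)
  have finU: "finite ?U" using fin by auto
  show "finite B" using finite_imageD[OF finite_subset[OF sub finU] inj] .
  have cG: "card (G T) * (t + 1) \<le> N ^ card (UNIV :: 'n set) * (t + 1) ^ s" if "card T < s" for T
  proof -
    have "card (G T) = (\<Prod>v\<in>UNIV. if v \<in> T then t + 1 else N)"
      unfolding G_def by (subst card_PiE) (auto intro!: prod.cong)
    also have "\<dots> = (t + 1) ^ card T * N ^ card (- T)"
      by (simp add: prod.If_cases)
    also have "\<dots> \<le> (t + 1) ^ card T * N ^ card (UNIV :: 'n set)"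
      using N by (intro mult_left_mono power_increasing card_mono) auto
    finally have "card (G T) * (t + 1) \<le> (t + 1) ^ card T * N ^ card (UNIV :: 'n set) * (t + 1)"
      by (rule mult_right_mono) simp
    also have "\<dots> = N ^ card (UNIV :: 'n set) * (t + 1) ^ Suc (card T)" by (simp only: power_Suc mult_ac)
    also have "\<dots> \<le> N ^ card (UNIV :: 'n set) * (t + 1) ^ s"
      using that by (intro mult_left_mono power_increasing) auto
    finally show ?thesis .
  qed
  have "card B = card (Poly_Mapping.lookup ` B)" by (simp add: card_image[OF inj])
  also have "\<dots> \<le> card ?U" by (rule card_mono[OF finU sub])
  also have "\<dots> \<le> (\<Sum>T\<in>{T :: 'n set. card T < s}. card (G T))" by (rule card_UN_le) auto
  finally have "card B * (t + 1) \<le> (\<Sum>T\<in>{T :: 'n set. card T < s}. card (G T)) * (t + 1)"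
    by (intro mult_right_mono) auto
  also have "\<dots> = (\<Sum>T\<in>{T :: 'n set. card T < s}. card (G T) * (t + 1))"
    by (rule sum_distrib_right)
  also have "\<dots> \<le> (\<Sum>T\<in>{T :: 'n set. card T < s}. N ^ card (UNIV :: 'n set) * (t + 1) ^ s)"
    by (intro sum_mono cG) auto
  also have "\<dots> = card {T :: 'n set. card T < s} * (N ^ card (UNIV :: 'n set) * (t + 1) ^ s)" by simp
  also have "\<dots> \<le> card (UNIV :: 'n set set) * (N ^ card (UNIV :: 'n set) * (t + 1) ^ s)"
    by (intro mult_right_mono card_mono) auto
  also have "card (UNIV :: 'n set set) = 2 ^ card (UNIV :: 'n set)"
    using card_Pow[of "UNIV :: 'n set"] by simp
  finally show "card B * (t + 1) \<le> 2 ^ card (UNIV :: 'n set) * N ^ card (UNIV :: 'n set) * (t + 1) ^ s"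
    by (simp add: mult.assoc)
qed

lemma has_highest_exists:
  fixes p :: "('x, 'k::zero) mpol"
  assumes "inj_on (wt w) (Poly_Mapping.keys p)" "p \<noteq> 0"
  shows "\<exists>\<mu>\<in>Poly_Mapping.keys p. \<forall>e\<in>Poly_Mapping.keys p - {\<mu>}. wt w e < wt w \<mu>"
proof -
  let ?K = "Poly_Mapping.keys p"
  have K: "?K \<noteq> {}" using assms(2)
    by (metis ex_in_conv in_keys_iff lookup_zero poly_mapping_eqI)
  have "Max (wt w ` ?K) \<in> wt w ` ?K" using K by (intro Max_in) auto
  then obtain \<mu> where \<mu>: "\<mu> \<in> ?K" "wt w \<mu> = Max (wt w ` ?K)" by auto
  have "wt w e < wt w \<mu>" if "e \<in> ?K - {\<mu>}" for e
  proof -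
    have "wt w e \<le> wt w \<mu>" using that by (auto simp: \<mu>(2))
    moreover have "wt w e \<noteq> wt w \<mu>" using that \<mu>(1) assms(1) by (auto dest: inj_onD)
    ultimately show ?thesis by simp
  qed
  then show ?thesis using \<mu>(1) by blast
qed

text \<open>For each \<open>S\<close> take the highest monomial \<open>lm S\<close> of a nonzero
  element of \<open>I\<close> in the variables of \<open>S\<close>. Monomials divisible by no
  \<open>lm S\<close> span modulo \<open>I\<close> and have fewer than \<open>s\<close> large
  exponents. The bound expresses growth of order at most \<open>s - 1\<close>; for
  \<open>s = 0\<close> it forces \<open>V\<close> to be empty once \<open>t \<ge> C\<close>.\<close>

lemma ideal_colength_bound:
  fixes I :: "('n::finite, 'k::field) mpol set"
  assumes I: "is_ideal I" and meet: "\<forall>S. card S = s \<longrightarrow> I \<inter> polys_in S \<noteq> {0}"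
  shows "\<exists>w C. (\<forall>v. w v > 0) \<and> (\<forall>t. \<exists>V. finite V \<and> card V * (t + 1) \<le> C * (t + 1) ^ s \<and>
           (\<forall>p. (\<forall>e\<in>Poly_Mapping.keys p. wt w e \<le> t) \<longrightarrow> p \<in> mp.span (V \<union> I)))"
proof -
  have "\<exists>g\<in>I. g \<noteq> 0 \<and> g \<in> polys_in S" if "card S = s" for S
  proof -
    have "0 \<in> I \<inter> polys_in S" using is_idealD(1)[OF I] by (simp add: polys_in_def)
    then show ?thesis using meet that by blast
  qed
  then obtain g where g: "\<And>S. card S = s \<Longrightarrow> g S \<in> I \<and> g S \<noteq> 0 \<and> g S \<in> polys_in S" by metis
  let ?\<S> = "{S :: 'n set. card S = s}"
  have "finite (\<Union>S\<in>?\<S>. Poly_Mapping.keys (g S))" by auto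
  then obtain w where w: "\<And>v. w v > 0" "inj_on (wt w) (\<Union>S\<in>?\<S>. Poly_Mapping.keys (g S))"
    using separating_weights by blast
  have "\<exists>\<mu>\<in>Poly_Mapping.keys (g S). \<forall>e\<in>Poly_Mapping.keys (g S) - {\<mu>}. wt w e < wt w \<mu>"
    if "card S = s" for S
    using that g by (intro has_highest_exists inj_on_subset[OF w(2)]) auto
  then obtain lm where lm: "\<And>S. card S = s \<Longrightarrow> lm S \<in> Poly_Mapping.keys (g S) \<and>
      (\<forall>e\<in>Poly_Mapping.keys (g S) - {lm S}. wt w e < wt w (lm S))" by metis
  \<comment> \<open>A common bound for the exponents of all \<open>lm S\<close>. A monomial with
    exponents at least \<open>N\<close> on \<open>S\<close> is divisible by \<open>lm S\<close>,
    because \<open>lm S\<close> involves only variables of \<open>S\<close>.\<close>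
  define N where "N = Suc (\<Sum>S\<in>?\<S>. \<Sum>v\<in>UNIV. Poly_Mapping.lookup (lm S) v)"
  have N: "Poly_Mapping.lookup (lm S) v \<le> N" if "card S = s" for S v
  proof -
    have "Poly_Mapping.lookup (lm S) v \<le> (\<Sum>v\<in>UNIV. Poly_Mapping.lookup (lm S) v)"
      by (rule member_le_sum) auto
    also have "\<dots> \<le> (\<Sum>S\<in>?\<S>. \<Sum>v\<in>UNIV. Poly_Mapping.lookup (lm S) v)"
      using that by (intro member_le_sum[of S ?\<S>]) auto
    finally show ?thesis by (simp add: N_def)
  qed
  define B where "B t = {u. wt w u \<le> t \<and> (\<forall>S\<in>?\<S>. \<exists>v. Poly_Mapping.lookup u v < Poly_Mapping.lookup (lm S) v)}" for t
  have few: "card {v. N \<le> Poly_Mapping.lookup u v} < s" if u: "u \<in> B t" for u t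
  proof (rule ccontr)
    assume "\<not> card {v. N \<le> Poly_Mapping.lookup u v} < s"
    then obtain S where S: "S \<subseteq> {v. N \<le> Poly_Mapping.lookup u v}" "card S = s"
      by (meson not_less obtain_subset_with_card_n)
    obtain v where v: "Poly_Mapping.lookup u v < Poly_Mapping.lookup (lm S) v"
      using u S(2) by (auto simp: B_def)
    then have "v \<in> Poly_Mapping.keys (lm S)" by (auto simp: in_keys_iff)
    moreover have "Poly_Mapping.keys (lm S) \<subseteq> S" using lm[OF S(2)] g[OF S(2)] by (auto simp: polys_in_def)
    ultimately have "N \<le> Poly_Mapping.lookup u v" using S(1) by blast
    then show False using v N[OF S(2), of v] by simp
  qed
  have B_le: "Poly_Mapping.lookup u v \<le> t" if "u \<in> B t" for u v t
    using that lookup_le_wt[of w u v] w(1) by (fastforce simp: B_def)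
  have N0: "N > 0" by (simp add: N_def)
  note cB = card_bounded_exponents[OF B_le few N0]
  let ?V = "\<lambda>t. (\<lambda>u. Poly_Mapping.single u (1 :: 'k)) ` B t"
  \<comment> \<open>Rewriting a multiple of \<open>lm S\<close> by the other terms of
    \<open>g S\<close> strictly lowers the weight; so it terminates and never leaves weight at most
    \<open>t\<close>.\<close>
  have mono: "Poly_Mapping.single u 1 \<in> mp.span (?V t \<union> I)" if "wt w u \<le> t" for u t
    using that
  proof (induction "wt w u" arbitrary: u rule: less_induct)
    case less
    show ?case
    proof (cases "u \<in> B t")
      case True
      then show ?thesis by (intro mp.span_base) auto
    next
      case False
      then obtain S where S: "card S = s" "\<And>v. Poly_Mapping.lookup (lm S) v \<le> Poly_Mapping.lookup u v"
        using less.prems by (auto simp: B_def not_less)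
      define d where "d = u - lm S"
      have u: "u = d + lm S"
        by (rule poly_mapping_eqI) (simp add: d_def lookup_add lookup_minus S(2))
      let ?K = "Poly_Mapping.keys (g S)"
      let ?c = "Poly_Mapping.lookup (g S)"
      have c0: "?c (lm S) \<noteq> 0" using lm[OF S(1)] by (simp add: in_keys_iff)
      have "Poly_Mapping.single d 1 * g S = Poly_Mapping.single d 1 * (\<Sum>e\<in>?K. Poly_Mapping.single e (?c e))"
        by (simp flip: mpol_eq_sum)
      also have "\<dots> = (\<Sum>e\<in>?K. Const (?c e) * Poly_Mapping.single (d + e) 1)"
        by (simp add: sum_distrib_left mult_single Const_def)
      also have "\<dots> = Const (?c (lm S)) * Poly_Mapping.single u 1 +
          (\<Sum>e\<in>?K - {lm S}. Const (?c e) * Poly_Mapping.single (d + e) 1)"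
        using lm[OF S(1)] by (subst sum.remove[of _ "lm S"]) (auto simp: u)
      finally have *: "Const (?c (lm S)) * Poly_Mapping.single u 1 = Poly_Mapping.single d 1 * g S -
          (\<Sum>e\<in>?K - {lm S}. Const (?c e) * Poly_Mapping.single (d + e) 1)" by simp
      have "Poly_Mapping.single (d + e) 1 \<in> mp.span (?V t \<union> I)" if "e \<in> ?K - {lm S}" for e
      proof -
        have "wt w (d + e) < wt w u" using lm[OF S(1)] that by (auto simp: u wt_add)
        then show ?thesis using less by simp
      qed
      moreover have "Poly_Mapping.single d 1 * g S \<in> mp.span (?V t \<union> I)"
        using is_idealD(3)[OF I] g[OF S(1)] by (intro mp.span_base) auto
      ultimately have "Const (?c (lm S)) * Poly_Mapping.single u 1 \<in> mp.span (?V t \<union> I)"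
        unfolding * by (intro mp.span_diff mp.span_sum mp.span_scale)
      from mp.span_scale[OF this, of "1 / ?c (lm S)"] show ?thesis
        using c0 by (simp flip: mult.assoc Const_mult)
    qed
  qed
  have "p \<in> mp.span (?V t \<union> I)" if "\<forall>e\<in>Poly_Mapping.keys p. wt w e \<le> t" for p t
  proof -
    have "p = (\<Sum>e\<in>Poly_Mapping.keys p. Const (Poly_Mapping.lookup p e) * Poly_Mapping.single e 1)"
      by (subst mpol_eq_sum) (simp flip: single_eq_Const_mult)
    moreover have "\<dots> \<in> mp.span (?V t \<union> I)"
      using that by (intro mp.span_sum mp.span_scale mono) auto
    ultimately show ?thesis by (rule ssubst)
  qed
  moreover have "finite (?V t)" "card (?V t) * (t + 1) \<le> 2 ^ card (UNIV :: 'n set) * N ^ card (UNIV :: 'n set) * (t + 1) ^ s" for t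
  proof -
    have fin: "finite (B t)" by (rule cB(1))
    show "finite (?V t)" using fin by (rule finite_imageI)
    have "card (?V t) \<le> card (B t)" using fin by (rule card_image_le)
    then have "card (?V t) * (t + 1) \<le> card (B t) * (t + 1)" by (rule mult_right_mono) simp
    then show "card (?V t) * (t + 1) \<le> 2 ^ card (UNIV :: 'n set) * N ^ card (UNIV :: 'n set) * (t + 1) ^ s"
      using cB(2) by (rule order_trans)
  qed
  ultimately show ?thesis using w(1)
    by (intro exI[of _ w] exI[of _ "2 ^ card (UNIV :: 'n set) * N ^ card (UNIV :: 'n set)"] conjI allI exI[of _ "?V _"]) blast+
qed

definition weight_le :: "('x \<Rightarrow> nat) \<Rightarrow> nat \<Rightarrow> ('x, 'k::zero) mpol set" where
  "weight_le w t = {p. \<forall>e\<in>Poly_Mapping.keys p. wt w e \<le> t}"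

lemma weight_le_mult:
  fixes p q :: "('x, 'k::comm_ring_1) mpol"
  assumes "p \<in> weight_le w s" "q \<in> weight_le w t"
  shows "p * q \<in> weight_le w (s + t)"
proof -
  have "wt w e \<le> s + t" if e: "e \<in> Poly_Mapping.keys (p * q)" for e
  proof -
    obtain a b where "a \<in> Poly_Mapping.keys p" "b \<in> Poly_Mapping.keys q" "e = a + b"
      using keys_mult[of p q] e by blast
    then show ?thesis using assms by (auto simp: weight_le_def wt_add intro: add_mono)
  qed
  then show ?thesis by (simp add: weight_le_def)
qed

lemma weight_le_power:
  fixes p :: "('x, 'k::comm_ring_1) mpol"
  shows "p \<in> weight_le w t \<Longrightarrow> p ^ j \<in> weight_le w (j * t)"
proof (induction j)
  case (Suc j)
  then show ?case using weight_le_mult[of p w t "p ^ j" "j * t"] by simp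
qed (simp add: weight_le_def)

lemma weight_le_mono: "s \<le> t \<Longrightarrow> weight_le w s \<subseteq> weight_le w t"
  by (auto simp: weight_le_def)

section \<open>Independent elements along chains of prime ideals\<close>

definition exponent :: "'x set \<Rightarrow> ('x \<Rightarrow> nat) \<Rightarrow> 'x \<Rightarrow>\<^sub>0 nat" where
  "exponent S u = (\<Sum>v\<in>S. Poly_Mapping.single v (u v))"

lemma lookup_exponent: "finite S \<Longrightarrow> Poly_Mapping.lookup (exponent S u) v = (if v \<in> S then u v else 0)"
  by (simp add: exponent_def lookup_sum lookup_single when_def sum.delta')

lemma wt_exponent: "finite S \<Longrightarrow> wt w (exponent S u) = (\<Sum>v\<in>S. w v * u v)"
  by (simp add: exponent_def wt_sum)

lemma inj_exponent: "finite S \<Longrightarrow> inj_on (exponent S) (PiE S A)"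
proof (rule inj_onI)
  fix f g assume S: "finite S" and fg: "f \<in> PiE S A" "g \<in> PiE S A" "exponent S f = exponent S g"
  have "f v = g v" if "v \<in> S" for v
    using lookup_exponent[OF S, of f v] lookup_exponent[OF S, of g v] fg(3) that by simp
  then show "f = g" using fg(1,2) by (meson PiE_ext)
qed

text \<open>An element of \<open>Q\<close> outside \<open>P\<close> is transcendental over
  \<open>polys_in S\<close> modulo \<open>P\<close>: the constant coefficient of a relation lies in
  \<open>Q\<close>, hence is 0, and primality of \<open>P\<close> then cancels one factor
  \<open>a\<close>.\<close>

lemma polys_in_relation:
  fixes P Q :: "('x, 'k::field) mpol set"
  assumes P: "P \<in> prime_spectrum" and Q: "Q \<in> prime_spectrum" and "P \<subseteq> Q" "Q \<inter> polys_in S = {0}"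
    and a: "a \<in> Q" "a \<notin> P"
  shows "(\<And>j. j < m \<Longrightarrow> p j \<in> polys_in S) \<Longrightarrow> (\<Sum>j<m. a ^ j * p j) \<in> P \<Longrightarrow> j < m \<Longrightarrow> p j = 0"
proof (induction m arbitrary: p j)
  case (Suc m)
  have PI: "is_ideal P" and QI: "is_ideal Q" and prime: "\<And>x y. x * y \<in> P \<Longrightarrow> x \<in> P \<or> y \<in> P"
    using P Q by (auto simp: prime_spectrum_iff)
  let ?r = "\<Sum>j<m. a ^ j * p (Suc j)"
  have eq: "(\<Sum>j<Suc m. a ^ j * p j) = p 0 + a * ?r"
    unfolding sum.lessThan_Suc_shift by (simp add: sum_distrib_left mult.assoc)
  then have "p 0 + a * ?r \<in> Q" using Suc.prems(2) \<open>P \<subseteq> Q\<close> by auto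
  then have "(p 0 + a * ?r) - a * ?r \<in> Q" by (intro is_idealD(6)[OF QI] is_idealD(4)[OF QI] a(1))
  then have p0: "p 0 = 0" using Suc.prems(1)[of 0] assms(4) by auto
  then have "?r \<in> P" using prime[of a ?r] a(2) Suc.prems(2) eq by auto
  then have "p (Suc i) = 0" if "i < m" for i
    using Suc.IH[of "\<lambda>j. p (Suc j)" i] Suc.prems(1) that by auto
  then show ?case using p0 Suc.prems(3) by (cases j) auto
qed simp

text \<open>Transcendence degree in disguise: a strictly smaller prime admits one more independent
  variable. Otherwise the quotient by \<open>P\<close> grows with order at most
  \<open>card S\<close>, while the variables of \<open>S\<close> together with \<open>a\<close>
  supply \<open>card S + 1\<close> independent elements.\<close>

lemma prime_chain_step:
  fixes P Q :: "('n::finite, 'k::field) mpol set"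
  assumes P: "P \<in> prime_spectrum" and Q: "Q \<in> prime_spectrum" and PQ: "P \<subset> Q"
    and QS: "Q \<inter> polys_in S = {0}"
  shows "\<exists>S'. card S' = Suc (card S) \<and> P \<inter> polys_in S' = {0}"
proof (rule ccontr)
  assume "\<not> ?thesis"
  then have meet: "\<forall>S'. card S' = Suc (card S) \<longrightarrow> P \<inter> polys_in S' \<noteq> {0}" by blast
  have PI: "is_ideal P" using P by (simp add: prime_spectrum_iff)
  obtain w C where V: "\<forall>t. \<exists>V. finite V \<and> card V * (t + 1) \<le> C * (t + 1) ^ Suc (card S) \<and>
           (\<forall>p. (\<forall>e\<in>Poly_Mapping.keys p. wt w e \<le> t) \<longrightarrow> p \<in> mp.span (V \<union> P))"
    using ideal_colength_bound[OF PI meet] by (elim exE conjE) (rule that)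
  obtain a where a: "a \<in> Q" "a \<notin> P" using PQ by blast
  \<comment> \<open>\<open>\<alpha>\<close> bounds the weight of \<open>a\<close>. Products of
    powers of \<open>a\<close> and of the variables in \<open>S\<close>, all exponents below
    \<open>\<tau>\<close>, have weight at most \<open>t\<close>, and
    \<open>t + 1 \<le> \<kappa> * \<tau>\<close>. Since \<open>\<tau>\<close> exceeds
    \<open>C * \<kappa> ^ card S\<close>, their number \<open>\<tau> ^ Suc (card S)\<close> beats
    the size of the spanning set.\<close>
  define \<alpha> where "\<alpha> = (\<Sum>e\<in>Poly_Mapping.keys a. wt w e)"
  define \<kappa> where "\<kappa> = Suc (\<alpha> + (\<Sum>v\<in>S. w v))"
  define \<tau> where "\<tau> = Suc (C * \<kappa> ^ card S)"
  define t where "t = \<tau> * (\<alpha> + (\<Sum>v\<in>S. w v))"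
  define U where "U = PiE S (\<lambda>_. {..<\<tau>})"
  define b where "b = (\<lambda>(j, u). a ^ j * Poly_Mapping.single (exponent S u) (1 :: 'k))"
  have finU: "finite U" unfolding U_def by (intro finite_PiE) auto
  obtain V where V: "finite V" "card V * (t + 1) \<le> C * (t + 1) ^ Suc (card S)"
    "\<And>p. p \<in> weight_le w t \<Longrightarrow> p \<in> mp.span (V \<union> P)"
    using spec[OF V, of t] by (auto simp: weight_le_def)
  have "a \<in> weight_le w \<alpha>"
    unfolding weight_le_def \<alpha>_def by (auto intro!: member_le_sum)
  have "b y \<in> weight_le w t" if y: "y \<in> {..<\<tau>} \<times> U" for y
  proof -
    obtain j u where ju: "y = (j, u)" "j < \<tau>" "u \<in> U" using y by auto
    have "a ^ j \<in> weight_le w (j * \<alpha>)" using \<open>a \<in> weight_le w \<alpha>\<close> by (rule weight_le_power)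
    moreover have "wt w (exponent S u) \<le> \<tau> * (\<Sum>v\<in>S. w v)"
      unfolding wt_exponent[OF finite] sum_distrib_left
      using ju(3) by (intro sum_mono) (auto simp: U_def mult.commute intro!: mult_right_mono less_imp_le)
    then have "Poly_Mapping.single (exponent S u) (1 :: 'k) \<in> weight_le w (\<tau> * (\<Sum>v\<in>S. w v))"
      by (simp add: weight_le_def)
    ultimately have "b y \<in> weight_le w (j * \<alpha> + \<tau> * (\<Sum>v\<in>S. w v))"
      unfolding b_def ju(1) by (simp add: weight_le_mult)
    moreover have "j * \<alpha> + \<tau> * (\<Sum>v\<in>S. w v) \<le> t"
      using ju(2) by (simp add: t_def distrib_left)
    ultimately show ?thesis using weight_le_mono by blast
  qed
  then have span: "b y \<in> mp.span (V \<union> P)" if "y \<in> {..<\<tau>} \<times> U" for y using that V(3) by blast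
  have "card V * (t + 1) \<le> (C * (t + 1) ^ card S) * (t + 1)"
    using V(2) by (simp add: mult_ac)
  then have "card V \<le> C * (t + 1) ^ card S" by (metis Suc_eq_plus1 mult_le_cancel2 zero_less_Suc)
  also have "\<dots> \<le> C * (\<kappa> * \<tau>) ^ card S"
    by (intro mult_left_mono power_mono) (auto simp: t_def \<kappa>_def \<tau>_def)
  also have "\<dots> = (C * \<kappa> ^ card S) * \<tau> ^ card S" by (simp add: power_mult_distrib)
  also have "\<dots> < \<tau> * \<tau> ^ card S"
    by (intro mult_strict_right_mono) (auto simp: \<tau>_def)
  also have "\<tau> * \<tau> ^ card S = card ({..<\<tau>} \<times> U)"
    by (simp add: U_def card_PiE card_cartesian_product)
  finally have less: "card V < card ({..<\<tau>} \<times> U)" .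
  have "\<exists>c. (\<exists>y\<in>{..<\<tau>} \<times> U. c y \<noteq> 0) \<and> (\<Sum>y\<in>{..<\<tau>} \<times> U. Const (c y) * b y) \<in> P"
    by (rule nontrivial_relation[OF V(1) _ less subspace_ideal[OF PI] span]) (use finU in auto)
  then obtain c where c: "\<exists>y\<in>{..<\<tau>} \<times> U. c y \<noteq> 0" "(\<Sum>y\<in>{..<\<tau>} \<times> U. Const (c y) * b y) \<in> P"
    by (elim exE conjE) (rule that)
  \<comment> \<open>Grouping the relation by powers of \<open>a\<close> gives coefficients in
    \<open>polys_in S\<close>, so that transcendence of \<open>a\<close> applies.\<close>
  define p where "p j = (\<Sum>u\<in>U. Poly_Mapping.single (exponent S u) (c (j, u)))" for j
  have p_in: "p j \<in> polys_in S" for j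
  proof -
    have "Poly_Mapping.keys (p j) \<subseteq> exponent S ` U"
      unfolding p_def using keys_mpol_sum[of "\<lambda>u. Poly_Mapping.single (exponent S u) (c (j, u))" U]
      by (auto split: if_splits)
    then show ?thesis
      by (auto simp: polys_in_def in_keys_iff lookup_exponent split: if_splits)
  qed
  have "(\<Sum>y\<in>{..<\<tau>} \<times> U. Const (c y) * b y) = (\<Sum>j<\<tau>. \<Sum>u\<in>U. Const (c (j, u)) * b (j, u))"
    by (simp add: sum.cartesian_product)
  also have "\<dots> = (\<Sum>j<\<tau>. a ^ j * p j)"
    by (intro sum.cong refl)
      (simp add: p_def b_def sum_distrib_left mult.left_commute flip: single_eq_Const_mult)
  finally have "(\<Sum>j<\<tau>. a ^ j * p j) \<in> P" using c(2) by simp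
  then have p0: "p j = 0" if "j < \<tau>" for j
    using polys_in_relation[OF P Q _ QS a, of \<tau> p] p_in PQ that by blast
  have lookup_p: "Poly_Mapping.lookup (p j) (exponent S u) = c (j, u)" if "u \<in> U" for j u
  proof -
    have "Poly_Mapping.lookup (p j) (exponent S u) = (\<Sum>u'\<in>U. if u' = u then c (j, u') else 0)"
      unfolding p_def lookup_sum using inj_onD[OF inj_exponent[OF finite], of S _ _ "\<lambda>_. {..<\<tau>}"] that
      by (intro sum.cong) (auto simp: lookup_single when_def U_def)
    then show ?thesis using that finU by simp
  qed
  obtain j u where ju: "j < \<tau>" "u \<in> U" "c (j, u) \<noteq> 0" using c(1) by auto
  then show False using lookup_p[of u j] p0[of j] by simp
qed

text \<open>Each step down a chain ending in \<open>P\<close> adds one variable to a coordinate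
  subring that the prime meets trivially, and the number of variables is finite.\<close>

lemma height_le:
  fixes P :: "('n::finite, 'k::field) mpol set"
  assumes S: "P \<inter> polys_in S = {0}"
  shows "height P \<le> enat (card (UNIV :: 'n set) - card S)"
  unfolding height_def
proof (rule Sup_least, clarify)
  fix h C assume C: "\<forall>i\<le>h. C i \<in> prime_spectrum" "\<forall>i<h. C i \<subset> C (Suc i)" "P = C h"
  have "\<exists>S'. card S' = card S + i \<and> C (h - i) \<inter> polys_in S' = {0}" if "i \<le> h" for i
    using that
  proof (induction i)
    case 0
    then show ?case using S C(3) by auto
  next
    case (Suc i)
    then obtain S' where S': "card S' = card S + i" "C (h - i) \<inter> polys_in S' = {0}" by auto
    have "C (h - Suc i) \<subset> C (h - i)"
      using C(2)[rule_format, of "h - Suc i"] Suc.prems by (simp add: Suc_diff_Suc)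
    then show ?case
      using prime_chain_step[of "C (h - Suc i)" "C (h - i)" S'] S' C(1) by auto
  qed
  then obtain S' :: "'n set" where "card S' = card S + h" by blast
  then have "card S + h \<le> card (UNIV :: 'n set)" by (metis card_mono finite subset_UNIV)
  then show "enat h \<le> enat (card (UNIV :: 'n set) - card S)" by simp
qed

section \<open>A weak form of Krull's height theorem\<close>

definition mon_subst :: "('n::finite \<Rightarrow> ('y, 'k::comm_ring_1) mpol) \<Rightarrow> ('n \<Rightarrow>\<^sub>0 nat) \<Rightarrow> ('y, 'k) mpol" where
  "mon_subst g e = (\<Prod>v\<in>UNIV. g v ^ Poly_Mapping.lookup e v)"

definition msubst :: "('n::finite \<Rightarrow> ('y, 'k::comm_ring_1) mpol) \<Rightarrow> ('n, 'k) mpol \<Rightarrow> ('y, 'k) mpol" where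
  "msubst g p = (\<Sum>e\<in>Poly_Mapping.keys p. Const (Poly_Mapping.lookup p e) * mon_subst g e)"

lemma mon_subst_0 [simp]: "mon_subst g 0 = 1"
  by (simp add: mon_subst_def)

lemma mon_subst_add: "mon_subst g (e + e') = mon_subst g e * mon_subst g e'"
  by (simp add: mon_subst_def lookup_add power_add prod.distrib)

lemma mon_subst_single: "mon_subst g (Poly_Mapping.single v k) = g v ^ k"
proof -
  have "mon_subst g (Poly_Mapping.single v k) = (\<Prod>u\<in>UNIV. if u = v then g v ^ k else 1)"
    unfolding mon_subst_def by (intro prod.cong) (auto simp: lookup_single)
  then show ?thesis by simp
qed

lemma msubst_superset:
  assumes "finite A" "Poly_Mapping.keys p \<subseteq> A"
  shows "msubst g p = (\<Sum>e\<in>A. Const (Poly_Mapping.lookup p e) * mon_subst g e)"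
  unfolding msubst_def by (rule sum.mono_neutral_left) (use assms in \<open>auto simp: in_keys_iff\<close>)

lemma msubst_single: "msubst g (Poly_Mapping.single e c) = Const c * mon_subst g e"
  by (subst msubst_superset[of "{e}"]) (auto split: if_splits)

lemma msubst_add: "msubst g (p + q) = msubst g p + msubst g q"
proof -
  let ?A = "Poly_Mapping.keys p \<union> Poly_Mapping.keys q"
  have "Poly_Mapping.keys (p + q) \<subseteq> ?A" by (rule keys_add)
  then show ?thesis
    by (simp add: msubst_superset[of ?A] lookup_add Const_add distrib_right sum.distrib)
qed

lemma msubst_0 [simp]: "msubst g 0 = 0"
  by (simp add: msubst_def)

lemma msubst_1 [simp]: "msubst g 1 = 1"
  using msubst_single[of g 0 1] by simp

lemma msubst_sum: "msubst g (sum f A) = (\<Sum>x\<in>A. msubst g (f x))"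
  by (induction A rule: infinite_finite_induct) (simp_all add: msubst_add)

lemma msubst_mult: "msubst g (p * q) = msubst g p * msubst g q"
proof -
  let ?s = "\<lambda>p e. Poly_Mapping.single e (Poly_Mapping.lookup p e)"
  have "p * q = (\<Sum>a\<in>Poly_Mapping.keys p. ?s p a) * (\<Sum>b\<in>Poly_Mapping.keys q. ?s q b)"
    using mpol_eq_sum[of p] mpol_eq_sum[of q] by simp
  also have "\<dots> = (\<Sum>a\<in>Poly_Mapping.keys p. \<Sum>b\<in>Poly_Mapping.keys q.
      Poly_Mapping.single (a + b) (Poly_Mapping.lookup p a * Poly_Mapping.lookup q b))"
    by (simp add: sum_product mult_single)
  finally show ?thesis
    by (simp add: msubst_sum msubst_single Const_mult mon_subst_add)
      (simp add: msubst_def sum_product mult_ac)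
qed

lemma msubst_Const [simp]: "msubst g (Const c) = Const c"
  using msubst_single[of g 0 c] by (simp add: Const_def)

lemma msubst_Var [simp]: "msubst g (Var v) = g v"
  by (simp add: Var_def msubst_single mon_subst_single)

lemma comm_ring_hom_msubst: "comm_ring_hom (msubst g)"
  by unfold_locales (auto simp: msubst_add msubst_mult)

lemma wfilt_prod:
  fixes f :: "'i \<Rightarrow> ('x, 'k::comm_ring_1) mpol"
  shows "(\<And>i. i \<in> A \<Longrightarrow> f i \<in> wfilt w (t i)) \<Longrightarrow> (\<Prod>i\<in>A. f i) \<in> wfilt w (\<Sum>i\<in>A. t i)"
  by (induction A rule: infinite_finite_induct) (auto intro: wfilt_mult)

lemma mon_subst_in_wfilt:
  assumes "\<And>v. g v \<in> wfilt \<omega> 1"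
  shows "mon_subst g e \<in> wfilt \<omega> (\<Sum>v\<in>UNIV. Poly_Mapping.lookup e v)"
  unfolding mon_subst_def
  using wfilt_power[OF assms] by (intro wfilt_prod) simp

text \<open>The subalgebra generated by the image of \<open>msubst g\<close> and the
  \<open>h l\<close>. Since the last rule multiplies by a single \<open>h l\<close>, induction shows
  at once that each element is an image plus a combination of the \<open>h l\<close>; closure under
  products is derived.\<close>

inductive_set adjoin_ring :: "('n::finite \<Rightarrow> ('y, 'k::comm_ring_1) mpol) \<Rightarrow> ('l \<Rightarrow> ('y, 'k) mpol) \<Rightarrow>
    'l set \<Rightarrow> ('y, 'k) mpol set" for g h \<Lambda> where
  base: "msubst g a \<in> adjoin_ring g h \<Lambda>"
| add: "r \<in> adjoin_ring g h \<Lambda> \<Longrightarrow> s \<in> adjoin_ring g h \<Lambda> \<Longrightarrow> r + s \<in> adjoin_ring g h \<Lambda>"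
| step: "l \<in> \<Lambda> \<Longrightarrow> r \<in> adjoin_ring g h \<Lambda> \<Longrightarrow> h l * r \<in> adjoin_ring g h \<Lambda>"

lemma adjoin_ring_mult:
  assumes "r \<in> adjoin_ring g h \<Lambda>" "s \<in> adjoin_ring g h \<Lambda>"
  shows "r * s \<in> adjoin_ring g h \<Lambda>"
  using assms(1)
proof induction
  case (base a)
  show ?case using assms(2)
  proof induction
    case (base b)
    then show ?case by (metis adjoin_ring.base msubst_mult)
  next
    case (step l r)
    then show ?case using adjoin_ring.step[of l \<Lambda> "msubst g a * r"] by (simp add: mult.left_commute)
  qed (simp add: distrib_left adjoin_ring.add)
next
  case (step l r)
  then show ?case using adjoin_ring.step[of l \<Lambda> "r * s"] by (simp add: mult.assoc)
qed (simp add: distrib_right adjoin_ring.add)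

lemma adjoin_ring_0: "0 \<in> adjoin_ring g h \<Lambda>" and adjoin_ring_1: "1 \<in> adjoin_ring g h \<Lambda>"
  and adjoin_ring_Const: "Const c \<in> adjoin_ring g h \<Lambda>"
  using adjoin_ring.base[of g 0] adjoin_ring.base[of g 1] adjoin_ring.base[of g "Const c"] by auto

lemma adjoin_ring_gen: "l \<in> \<Lambda> \<Longrightarrow> h l \<in> adjoin_ring g h \<Lambda>"
  using adjoin_ring.step[OF _ adjoin_ring_1] by fastforce

lemma adjoin_ring_prod: "(\<And>x. x \<in> A \<Longrightarrow> f x \<in> adjoin_ring g h \<Lambda>) \<Longrightarrow> prod f A \<in> adjoin_ring g h \<Lambda>"
  by (induction A rule: infinite_finite_induct) (auto simp: adjoin_ring_1 adjoin_ring_mult)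

lemma adjoin_ring_power: "r \<in> adjoin_ring g h \<Lambda> \<Longrightarrow> r ^ k \<in> adjoin_ring g h \<Lambda>"
  by (induction k) (auto simp: adjoin_ring_1 adjoin_ring_mult)

text \<open>The ideal generated inside the subalgebra, not in the ambient polynomial ring: the
  coefficients \<open>r l\<close> are restricted because growth is measured in the
  subalgebra.\<close>

definition gen_ideal :: "('n::finite \<Rightarrow> ('y, 'k::comm_ring_1) mpol) \<Rightarrow> ('l \<Rightarrow> ('y, 'k) mpol) \<Rightarrow>
    'l set \<Rightarrow> ('y, 'k) mpol set" where
  "gen_ideal g h \<Lambda> = {\<Sum>l\<in>\<Lambda>. h l * r l | r. \<forall>l\<in>\<Lambda>. r l \<in> adjoin_ring g h \<Lambda>}"

lemma gen_idealI: "(\<And>l. l \<in> \<Lambda> \<Longrightarrow> r l \<in> adjoin_ring g h \<Lambda>) \<Longrightarrow> (\<Sum>l\<in>\<Lambda>. h l * r l) \<in> gen_ideal g h \<Lambda>"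
  by (auto simp: gen_ideal_def)

lemma gen_ideal_add:
  assumes "x \<in> gen_ideal g h \<Lambda>" "y \<in> gen_ideal g h \<Lambda>"
  shows "x + y \<in> gen_ideal g h \<Lambda>"
proof -
  obtain r s where r: "x = (\<Sum>l\<in>\<Lambda>. h l * r l)" "\<forall>l\<in>\<Lambda>. r l \<in> adjoin_ring g h \<Lambda>"
    and s: "y = (\<Sum>l\<in>\<Lambda>. h l * s l)" "\<forall>l\<in>\<Lambda>. s l \<in> adjoin_ring g h \<Lambda>"
    using assms by (auto simp: gen_ideal_def)
  then have "x + y = (\<Sum>l\<in>\<Lambda>. h l * (r l + s l))" by (simp add: distrib_left sum.distrib)
  then show ?thesis using r(2) s(2) by (simp add: gen_idealI adjoin_ring.add)
qed

lemma gen_ideal_mult: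
  assumes "x \<in> gen_ideal g h \<Lambda>" "a \<in> adjoin_ring g h \<Lambda>"
  shows "a * x \<in> gen_ideal g h \<Lambda>"
proof -
  obtain r where r: "x = (\<Sum>l\<in>\<Lambda>. h l * r l)" "\<forall>l\<in>\<Lambda>. r l \<in> adjoin_ring g h \<Lambda>"
    using assms by (auto simp: gen_ideal_def)
  then have "a * x = (\<Sum>l\<in>\<Lambda>. h l * (a * r l))" by (simp add: sum_distrib_left mult.left_commute)
  then show ?thesis using r(2) assms(2) by (simp add: gen_idealI adjoin_ring_mult)
qed

lemma gen_ideal_gen:
  assumes "l \<in> \<Lambda>" "finite \<Lambda>" "r \<in> adjoin_ring g h \<Lambda>"
  shows "h l * r \<in> gen_ideal g h \<Lambda>"
proof -
  have "(\<Sum>l'\<in>\<Lambda>. h l' * (if l' = l then r else 0)) = (\<Sum>l'\<in>\<Lambda>. if l' = l then h l * r else 0)"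
    by (intro sum.cong) auto
  also have "\<dots> = h l * r" using assms by simp
  finally show ?thesis
    using gen_idealI[of \<Lambda> "\<lambda>l'. if l' = l then r else 0" g h] assms(3) by (simp add: adjoin_ring_0)
qed

lemma gen_ideal_0: "0 \<in> gen_ideal g h \<Lambda>"
  using gen_idealI[of \<Lambda> "\<lambda>_. 0" g h] by (simp add: adjoin_ring_0)

lemma is_ideal_vimage_gen_ideal: "is_ideal {a. msubst g a \<in> gen_ideal g h \<Lambda>}"
  by (auto simp: is_ideal_def gen_ideal_0 msubst_add msubst_mult gen_ideal_add gen_ideal_mult adjoin_ring.base)

lemma span_mult_image:
  fixes a :: "('y, 'k::field) mpol"
  assumes "x \<in> mp.span (V \<union> J)" "\<And>j. j \<in> J \<Longrightarrow> a * j \<in> J"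
  shows "a * x \<in> mp.span ((*) a ` V \<union> J)"
  using assms(1)
proof (induction rule: mp.span_induct_alt)
  case base
  then show ?case by (simp add: mp.span_zero)
next
  case (step c x y)
  have "a * x \<in> mp.span ((*) a ` V \<union> J)" using step(1) assms(2) by (intro mp.span_base) auto
  then have "Const c * (a * x) + a * y \<in> mp.span ((*) a ` V \<union> J)"
    by (intro mp.span_add mp.span_scale step(2))
  then show ?case by (simp add: algebra_simps)
qed

lemma span_msubst_image:
  fixes g :: "'n::finite \<Rightarrow> ('y, 'k::field) mpol"
  assumes "x \<in> mp.span V"
  shows "msubst g x \<in> mp.span (msubst g ` V)"
  using assms
proof (induction rule: mp.span_induct_alt)
  case base
  then show ?case by (simp add: mp.span_zero)
next
  case (step c x y)
  then have "Const c * msubst g x + msubst g y \<in> mp.span (msubst g ` V)"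
    by (intro mp.span_add mp.span_scale) (auto intro: mp.span_base)
  then show ?case by (simp add: msubst_add msubst_mult)
qed

text \<open>Iterating \<open>R \<subseteq> span V + a R + J\<close> replaces \<open>a R\<close> by \<open>a ^ t R \<subseteq> J\<close> and multiplies the number of
  generators by \<open>t\<close>.\<close>

lemma span_mod_nilpotent:
  fixes R J :: "('y, 'k::field) mpol set" and a :: "('y, 'k) mpol"
  assumes "finite V" and J: "\<And>j. j \<in> J \<Longrightarrow> a * j \<in> J" and nil: "\<And>r. r \<in> R \<Longrightarrow> a ^ t * r \<in> J"
    and R: "\<And>r. r \<in> R \<Longrightarrow> \<exists>r'\<in>R. r - a * r' \<in> mp.span (V \<union> J)"
  shows "\<exists>V'. finite V' \<and> card V' \<le> t * card V \<and> (\<forall>r\<in>R. r \<in> mp.span (V' \<union> J))"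
proof -
  define W where "W i = (\<Union>j<i. (*) (a ^ j) ` V)" for i
  have Jpow: "a ^ i * j \<in> J" if "j \<in> J" for i j
    using that by (induction i) (auto simp: mult.assoc J)
  have iter: "\<exists>r'\<in>R. r - a ^ i * r' \<in> mp.span (W i \<union> J)" if "r \<in> R" for r i
  proof (induction i)
    case 0
    then show ?case using that by (intro bexI[of _ r]) (auto simp: mp.span_zero)
  next
    case (Suc i)
    then obtain r' where r': "r' \<in> R" "r - a ^ i * r' \<in> mp.span (W i \<union> J)" by blast
    obtain r'' where r'': "r'' \<in> R" "r' - a * r'' \<in> mp.span (V \<union> J)" using R r'(1) by blast
    have "W (Suc i) = W i \<union> (*) (a ^ i) ` V" by (auto simp: W_def lessThan_Suc)
    then have "mp.span (W i \<union> J) \<subseteq> mp.span (W (Suc i) \<union> J)"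
      "mp.span ((*) (a ^ i) ` V \<union> J) \<subseteq> mp.span (W (Suc i) \<union> J)"
      by (auto intro!: mp.span_mono)
    moreover have "a ^ i * (r' - a * r'') \<in> mp.span ((*) (a ^ i) ` V \<union> J)"
      by (rule span_mult_image[OF r''(2)]) (rule Jpow)
    ultimately have "(r - a ^ i * r') + a ^ i * (r' - a * r'') \<in> mp.span (W (Suc i) \<union> J)"
      using r'(2) by (intro mp.span_add) (blast+)
    moreover have "(r - a ^ i * r') + a ^ i * (r' - a * r'') = r - a ^ Suc i * r''"
      by (simp add: algebra_simps)
    ultimately show ?case using r''(1) by metis
  qed
  have "r \<in> mp.span (W t \<union> J)" if r: "r \<in> R" for r
  proof -
    obtain r' where r': "r' \<in> R" "r - a ^ t * r' \<in> mp.span (W t \<union> J)" using iter[OF r] by blast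
    have "a ^ t * r' \<in> mp.span (W t \<union> J)" using nil[OF r'(1)] by (intro mp.span_base) auto
    from mp.span_add[OF r'(2) this] show ?thesis by simp
  qed
  moreover have "finite (W t)" using assms(1) by (auto simp: W_def)
  moreover have "card (W t) \<le> t * card V"
  proof -
    have "card (W t) \<le> (\<Sum>j<t. card ((*) (a ^ j) ` V))"
      unfolding W_def by (rule card_UN_le) auto
    also have "\<dots> \<le> (\<Sum>j<t. card V)" using assms(1) by (intro sum_mono card_image_le)
    finally show ?thesis by simp
  qed
  ultimately show ?thesis by blast
qed

text \<open>The hypothesis spans the subalgebra modulo weight \<open>t\<close> and the
  \<open>h l\<close> with \<open>l \<in> L\<close>, the conclusion modulo weight \<open>t\<close>
  alone. Each \<open>h l\<close> is removed at the cost of a factor \<open>t\<close>, because its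
  positive weight puts \<open>h l ^ t\<close> into \<open>wfilt \<omega> t\<close>.\<close>

lemma adjoin_ring_span:
  fixes g :: "'n::finite \<Rightarrow> ('y, 'k::field) mpol"
  assumes "finite L" "L \<subseteq> \<Lambda>" "finite V"
    and h: "\<And>l. l \<in> \<Lambda> \<Longrightarrow> h l \<in> wfilt \<omega> 1"
    and R: "\<And>r. r \<in> adjoin_ring g h \<Lambda> \<Longrightarrow> \<exists>q. (\<forall>l\<in>L. q l \<in> adjoin_ring g h \<Lambda>) \<and>
              r - (\<Sum>l\<in>L. h l * q l) \<in> mp.span (V \<union> wfilt \<omega> t)"
  shows "\<exists>V'. finite V' \<and> card V' \<le> t ^ card L * card V \<and>
           (\<forall>r\<in>adjoin_ring g h \<Lambda>. r \<in> mp.span (V' \<union> wfilt \<omega> t))"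
  using assms(1,2,3,5)
proof (induction L arbitrary: V rule: finite_induct)
  case empty
  then show ?case by auto
next
  case (insert l L)
  let ?R = "adjoin_ring g h \<Lambda>"
  \<comment> \<open>Modulo this \<open>J\<close> only multiples of the new \<open>h l\<close> remain
    to be removed; the generators indexed by \<open>L\<close> are left to the induction
    hypothesis.\<close>
  define J where "J = {x + (\<Sum>l\<in>L. h l * q l) | x q. x \<in> wfilt \<omega> t \<and> (\<forall>l\<in>L. q l \<in> ?R)}"
  have l: "l \<in> \<Lambda>" "L \<subseteq> \<Lambda>" using insert.prems by auto
  have wJ: "wfilt \<omega> t \<subseteq> J"
  proof
    fix x :: "('y, 'k) mpol" assume "x \<in> wfilt \<omega> t"
    then show "x \<in> J" unfolding J_def
      by (intro CollectI exI[of _ x] exI[of _ "\<lambda>_. 0"]) (auto simp: adjoin_ring_0)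
  qed
  have qJ: "(\<Sum>l\<in>L. h l * q l) \<in> J" if "\<forall>l\<in>L. q l \<in> ?R" for q
    unfolding J_def using that by (intro CollectI exI[of _ 0] exI[of _ q]) auto
  have J1: "h l * j \<in> J" if j: "j \<in> J" for j
  proof -
    obtain x q where xq: "j = x + (\<Sum>l\<in>L. h l * q l)" "x \<in> wfilt \<omega> t" "\<forall>l\<in>L. q l \<in> ?R"
      using j by (auto simp: J_def)
    then have "h l * j = h l * x + (\<Sum>l'\<in>L. h l' * (h l * q l'))"
      by (simp add: distrib_left sum_distrib_left mult.left_commute)
    moreover have "\<forall>l'\<in>L. h l * q l' \<in> ?R" using xq(3) by (blast intro: adjoin_ring.step[OF l(1)])
    moreover have "h l * x \<in> wfilt \<omega> t" using xq(2) by (rule wfilt_mult_left)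
    ultimately show ?thesis unfolding J_def
      by (intro CollectI exI[of _ "h l * x"] exI[of _ "\<lambda>l'. h l * q l'"]) auto
  qed
  have nil: "h l ^ t * r \<in> J" for r
  proof -
    have "h l ^ t \<in> wfilt \<omega> t" using wfilt_power[OF h[OF l(1)], of t] by simp
    then have "h l ^ t * r \<in> wfilt \<omega> t" using wfilt_mult_left[of "h l ^ t" \<omega> t r] by (simp add: mult.commute)
    then show ?thesis using wJ by blast
  qed
  have "\<exists>r'\<in>?R. r - h l * r' \<in> mp.span (V \<union> J)" if r: "r \<in> ?R" for r
  proof -
    obtain q where q: "\<forall>l\<in>insert l L. q l \<in> ?R"
      "r - (\<Sum>l\<in>insert l L. h l * q l) \<in> mp.span (V \<union> wfilt \<omega> t)"
      using insert.prems(3)[OF r] by blast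
    have "mp.span (V \<union> wfilt \<omega> t) \<subseteq> mp.span (V \<union> J)" using wJ by (intro mp.span_mono) auto
    moreover have "(\<Sum>l\<in>L. h l * q l) \<in> mp.span (V \<union> J)" using qJ q(1) by (intro mp.span_base) auto
    ultimately have "(r - (\<Sum>l\<in>insert l L. h l * q l)) + (\<Sum>l\<in>L. h l * q l) \<in> mp.span (V \<union> J)"
      using q(2) by (intro mp.span_add) auto
    moreover have "(r - (\<Sum>l\<in>insert l L. h l * q l)) + (\<Sum>l\<in>L. h l * q l) = r - h l * q l"
      using insert.hyps by simp
    ultimately show ?thesis using q(1) by auto
  qed
  then obtain V1 where V1: "finite V1" "card V1 \<le> t * card V" "\<forall>r\<in>?R. r \<in> mp.span (V1 \<union> J)"
    using span_mod_nilpotent[of V J "h l" ?R t] insert.prems(2) J1 nil by auto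
  have "\<exists>q. (\<forall>l\<in>L. q l \<in> ?R) \<and> r - (\<Sum>l\<in>L. h l * q l) \<in> mp.span (V1 \<union> wfilt \<omega> t)" if "r \<in> ?R" for r
  proof -
    have "r \<in> mp.span (V1 \<union> J)" using V1(3) that by blast
    then show ?thesis
    proof (induction rule: mp.span_induct_alt)
      case base
      show ?case by (intro exI[of _ "\<lambda>_. 0"]) (auto simp: adjoin_ring_0 mp.span_zero)
    next
      case (step c x y)
      then obtain q where q: "\<forall>l\<in>L. q l \<in> ?R" "y - (\<Sum>l\<in>L. h l * q l) \<in> mp.span (V1 \<union> wfilt \<omega> t)" by blast
      have "\<exists>p. (\<forall>l\<in>L. p l \<in> ?R) \<and> x - (\<Sum>l\<in>L. h l * p l) \<in> mp.span (V1 \<union> wfilt \<omega> t)"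
      proof (cases "x \<in> V1")
        case True
        then show ?thesis by (intro exI[of _ "\<lambda>_. 0"]) (auto simp: adjoin_ring_0 mp.span_base)
      next
        case False
        then have "x \<in> J" using step(1) by blast
        then obtain z p where "x = z + (\<Sum>l\<in>L. h l * p l)" "z \<in> wfilt \<omega> t" "\<forall>l\<in>L. p l \<in> ?R"
          by (auto simp: J_def)
        then show ?thesis by (intro exI[of _ p]) (auto simp: mp.span_base)
      qed
      then obtain p where p: "\<forall>l\<in>L. p l \<in> ?R" "x - (\<Sum>l\<in>L. h l * p l) \<in> mp.span (V1 \<union> wfilt \<omega> t)" by blast
      have "Const c * (x - (\<Sum>l\<in>L. h l * p l)) + (y - (\<Sum>l\<in>L. h l * q l)) \<in> mp.span (V1 \<union> wfilt \<omega> t)"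
        by (intro mp.span_add mp.span_scale p(2) q(2))
      moreover have "Const c * (x - (\<Sum>l\<in>L. h l * p l)) + (y - (\<Sum>l\<in>L. h l * q l)) =
          (Const c * x + y) - (\<Sum>l\<in>L. h l * (Const c * p l + q l))"
        by (simp add: algebra_simps sum.distrib sum_distrib_left)
      ultimately have "(Const c * x + y) - (\<Sum>l\<in>L. h l * (Const c * p l + q l)) \<in> mp.span (V1 \<union> wfilt \<omega> t)" by simp
      moreover have "\<forall>l\<in>L. Const c * p l + q l \<in> ?R"
        using p(1) q(1) by (auto intro!: adjoin_ring.add adjoin_ring_mult adjoin_ring_Const)
      ultimately show ?case by (intro exI[of _ "\<lambda>l. Const c * p l + q l"]) blast
    qed
  qed
  from insert.IH[OF l(2) V1(1) this] obtain V' where V': "finite V'" "card V' \<le> t ^ card L * card V1"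
    "\<forall>r\<in>?R. r \<in> mp.span (V' \<union> wfilt \<omega> t)" by blast
  note V'(2)
  also have "t ^ card L * card V1 \<le> t ^ card L * (t * card V)" using V1(2) by (intro mult_left_mono) auto
  also have "\<dots> = t ^ card (insert l L) * card V" using insert.hyps by simp
  finally show ?case using V'(1,3) by blast
qed

text \<open>Among the summands with nonzero coefficient take \<open>z\<close> with lowest monomial
  of least weight. No other summand contains that monomial, so it survives in the sum, with weight
  below \<open>t\<close>.\<close>

lemma lowest_terms_independent:
  fixes b :: "'i \<Rightarrow> ('y, 'k::field) mpol"
  assumes "finite E" and low: "\<And>e. e \<in> E \<Longrightarrow> has_lowest \<omega> (M e) (b e)" and "inj_on M E"
    and "\<And>e. e \<in> E \<Longrightarrow> wt \<omega> (M e) < t"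
    and "(\<Sum>e\<in>E. Const (c e) * b e) \<in> wfilt \<omega> t" "e \<in> E"
  shows "c e = 0"
proof (rule ccontr)
  assume "c e \<noteq> 0"
  define Z where "Z = {e\<in>E. c e \<noteq> 0}"
  have Z: "finite Z" "Z \<noteq> {}" using \<open>c e \<noteq> 0\<close> assms(1,6) by (auto simp: Z_def)
  define z where "z = arg_min_on (\<lambda>e. wt \<omega> (M e)) Z"
  have z: "z \<in> Z" "\<And>e. e \<in> Z \<Longrightarrow> wt \<omega> (M z) \<le> wt \<omega> (M e)"
    using arg_min_if_finite[OF Z, of "\<lambda>e. wt \<omega> (M e)"] unfolding z_def by (auto simp: not_less)
  have zE: "z \<in> E" "c z \<noteq> 0" using z(1) by (auto simp: Z_def)
  have "Poly_Mapping.lookup (\<Sum>e\<in>E. Const (c e) * b e) (M z) = (\<Sum>e\<in>E. c e * Poly_Mapping.lookup (b e) (M z))"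
    by (simp add: lookup_sum lookup_Const_mult)
  also have "\<dots> = (\<Sum>e\<in>E. if e = z then c z * Poly_Mapping.lookup (b z) (M z) else 0)"
  proof (intro sum.cong refl)
    fix e assume e: "e \<in> E"
    have "c e * Poly_Mapping.lookup (b e) (M z) = 0" if "e \<noteq> z"
    proof (cases "c e = 0")
      case False
      then have "wt \<omega> (M z) \<le> wt \<omega> (M e)" using z(2) e by (auto simp: Z_def)
      moreover have "M z \<noteq> M e" using that e zE(1) assms(3) by (auto dest: inj_onD)
      ultimately show ?thesis using has_lowest_lookup(2)[OF low[OF e]] by simp
    qed simp
    then show "c e * Poly_Mapping.lookup (b e) (M z) = (if e = z then c z * Poly_Mapping.lookup (b z) (M z) else 0)"
      by auto
  qed
  also have "\<dots> = c z * Poly_Mapping.lookup (b z) (M z)" using zE(1) assms(1) by simp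
  also have "\<dots> \<noteq> 0" using zE has_lowest_lookup(1)[OF low[OF zE(1)]] by simp
  finally have "M z \<in> Poly_Mapping.keys (\<Sum>e\<in>E. Const (c e) * b e)" by (simp add: in_keys_iff)
  then have "t \<le> wt \<omega> (M z)" using assms(5) by (auto simp: wfilt_def)
  then show False using assms(4)[OF zE(1)] by simp
qed

lemma wt_sum_replicate: "wt w (\<Sum>\<alpha>\<in>\<Delta>. \<Sum>i<e \<alpha>. \<mu> \<alpha>) = (\<Sum>\<alpha>\<in>\<Delta>. e \<alpha> * wt w (\<mu> \<alpha>))"
  by (simp add: wt_sum)

lemma lookup_sum_replicate:
  "Poly_Mapping.lookup (\<Sum>\<alpha>\<in>\<Delta>. \<Sum>i<e \<alpha>. \<mu> \<alpha>) v = (\<Sum>\<alpha>\<in>\<Delta>. e \<alpha> * Poly_Mapping.lookup (\<mu> \<alpha>) v)"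
  for \<mu> :: "'a \<Rightarrow> 'x \<Rightarrow>\<^sub>0 nat"
  by (simp add: lookup_sum)

lemma weight_le_degree:
  fixes w :: "'n::finite \<Rightarrow> nat"
  shows "wt w e \<le> (\<Sum>v\<in>UNIV. w v) * (\<Sum>v\<in>UNIV. Poly_Mapping.lookup e v)"
proof -
  have "wt w e = (\<Sum>v\<in>UNIV. w v * Poly_Mapping.lookup e v)" by (rule wt_superset) auto
  also have "\<dots> \<le> (\<Sum>v\<in>UNIV. (\<Sum>v\<in>UNIV. w v) * Poly_Mapping.lookup e v)"
    by (intro sum_mono mult_right_mono member_le_sum) auto
  finally show ?thesis by (simp add: sum_distrib_left)
qed

text \<open>Two filtrations meet here. A monomial of degree at least \<open>t\<close> has an image
  of \<open>\<omega>\<close>-weight at least \<open>t\<close>; one of smaller degree has bounded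
  \<open>w\<close>-weight and is covered by \<open>V\<close> modulo \<open>I\<close>.\<close>

lemma msubst_span:
  fixes g :: "'n::finite \<Rightarrow> ('y, 'k::field) mpol"
  assumes g: "\<And>v. g v \<in> wfilt \<omega> 1"
    and V: "\<And>p. p \<in> weight_le w ((\<Sum>v\<in>UNIV. w v) * t) \<Longrightarrow> p \<in> mp.span (V \<union> I)"
  shows "msubst g a \<in> mp.span (msubst g ` V \<union> (msubst g ` I \<union> wfilt \<omega> t))"
proof -
  let ?deg = "\<lambda>e. \<Sum>v\<in>UNIV. Poly_Mapping.lookup e v"
  let ?K = "Poly_Mapping.keys a"
  let ?m = "\<lambda>e. Poly_Mapping.single e (Poly_Mapping.lookup a e)"
  have "msubst g (?m e) \<in> mp.span (msubst g ` V \<union> (msubst g ` I \<union> wfilt \<omega> t))" for e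
  proof (cases "t \<le> ?deg e")
    case True
    then have "mon_subst g e \<in> wfilt \<omega> t"
      using mon_subst_in_wfilt[OF g, where e = e] wfilt_antimono[OF True, where w = \<omega>] by auto
    then have "msubst g (?m e) \<in> wfilt \<omega> t" by (simp add: msubst_single wfilt_mult_left)
    then show ?thesis by (intro mp.span_base) auto
  next
    case False
    then have "wt w e \<le> (\<Sum>v\<in>UNIV. w v) * t"
      using weight_le_degree[of w e] mult_left_mono[of "?deg e" t "\<Sum>v\<in>UNIV. w v"] by linarith
    then have "?m e \<in> mp.span (V \<union> I)" by (intro V) (simp add: weight_le_def)
    from span_msubst_image[OF this, of g] show ?thesis
      using mp.span_mono[of "msubst g ` (V \<union> I)" "msubst g ` V \<union> (msubst g ` I \<union> wfilt \<omega> t)"] by blast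
  qed
  then have "(\<Sum>e\<in>?K. msubst g (?m e)) \<in> mp.span (msubst g ` V \<union> (msubst g ` I \<union> wfilt \<omega> t))"
    by (intro mp.span_sum)
  then show ?thesis by (simp flip: msubst_sum mpol_eq_sum)
qed

text \<open>The starting point of \<open>adjoin_ring_span\<close>: modulo the ideal every element of
  the subalgebra is an image of \<open>msubst g\<close>, so whatever spans the images spans
  everything.\<close>

lemma adjoin_ring_span_base:
  fixes g :: "'n::finite \<Rightarrow> ('y, 'k::field) mpol"
  assumes \<Lambda>: "finite \<Lambda>"
    and base: "\<And>a. msubst g a \<in> mp.span (V \<union> (gen_ideal g h \<Lambda> \<union> wfilt \<omega> t))"
    and r: "r \<in> adjoin_ring g h \<Lambda>"
  shows "\<exists>q. (\<forall>l\<in>\<Lambda>. q l \<in> adjoin_ring g h \<Lambda>) \<and> r - (\<Sum>l\<in>\<Lambda>. h l * q l) \<in> mp.span (V \<union> wfilt \<omega> t)"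
proof -
  let ?S = "mp.span (V \<union> wfilt \<omega> t)"
  let ?T = "{x. \<exists>y\<in>gen_ideal g h \<Lambda>. x - y \<in> ?S}"
  have "mp.subspace ?T"
    unfolding mp.subspace_def
  proof (intro conjI ballI allI)
    show "0 \<in> ?T" using gen_ideal_0 mp.span_zero by force
  next
    fix x x' assume "x \<in> ?T" "x' \<in> ?T"
    then obtain y y' where y: "y \<in> gen_ideal g h \<Lambda>" "x - y \<in> ?S" "y' \<in> gen_ideal g h \<Lambda>" "x' - y' \<in> ?S" by blast
    have "(x - y) + (x' - y') \<in> ?S" using y by (intro mp.span_add)
    moreover have "(x - y) + (x' - y') = (x + x') - (y + y')" by simp
    ultimately show "x + x' \<in> ?T" using gen_ideal_add[OF y(1,3)] by force
  next
    fix c x assume "x \<in> ?T"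
    then obtain y where y: "y \<in> gen_ideal g h \<Lambda>" "x - y \<in> ?S" by blast
    have "Const c * (x - y) \<in> ?S" using y by (intro mp.span_scale)
    moreover have "Const c * (x - y) = Const c * x - Const c * y" by (simp add: algebra_simps)
    ultimately show "Const c * x \<in> ?T" using gen_ideal_mult[OF y(1) adjoin_ring_Const[of c]] by force
  qed
  moreover have "V \<union> (gen_ideal g h \<Lambda> \<union> wfilt \<omega> t) \<subseteq> ?T"
  proof
    fix x assume x: "x \<in> V \<union> (gen_ideal g h \<Lambda> \<union> wfilt \<omega> t)"
    show "x \<in> ?T"
    proof (cases "x \<in> gen_ideal g h \<Lambda>")
      case True
      then show ?thesis using mp.span_zero by force
    next
      case False
      then have "x - 0 \<in> ?S" using x by (auto intro: mp.span_base)
      then show ?thesis using gen_ideal_0 by blast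
    qed
  qed
  ultimately have sub: "mp.span (V \<union> (gen_ideal g h \<Lambda> \<union> wfilt \<omega> t)) \<subseteq> ?T" by (intro mp.span_minimal)
  have "r \<in> mp.span (V \<union> (gen_ideal g h \<Lambda> \<union> wfilt \<omega> t))"
    using r
  proof induction
    case (step l r)
    then show ?case using gen_ideal_gen[OF step(1) \<Lambda> step(2)] by (intro mp.span_base) auto
  qed (auto intro: base mp.span_add)
  then obtain y where "y \<in> gen_ideal g h \<Lambda>" "r - y \<in> ?S" using sub by blast
  then show ?thesis by (auto simp: gen_ideal_def)
qed

text \<open>The ring \<open>adjoin_ring g h \<Lambda>\<close> has at least \<open>card \<Delta>\<close> algebraically independent elements, and
  dividing by the \<open>card \<Lambda>\<close> elements \<open>h l\<close> of positive weight lowers the growth of its dimension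
  filtration by at most \<open>card \<Lambda>\<close>.\<close>

theorem exists_prime_height_le:
  fixes g :: "'n::finite \<Rightarrow> ('y, 'k::field) mpol"
  assumes "finite \<Lambda>" "finite \<Delta>"
    and g: "\<And>v. g v \<in> wfilt \<omega> 1" and h: "\<And>l. l \<in> \<Lambda> \<Longrightarrow> h l \<in> wfilt \<omega> 1"
    and G: "\<And>\<alpha>. \<alpha> \<in> \<Delta> \<Longrightarrow> G \<alpha> \<in> adjoin_ring g h \<Lambda>"
    and low: "\<And>\<alpha>. \<alpha> \<in> \<Delta> \<Longrightarrow> has_lowest \<omega> (\<mu> \<alpha>) (G \<alpha>)"
    and indep: "\<And>e e' \<alpha>. (\<And>v. (\<Sum>\<alpha>\<in>\<Delta>. e \<alpha> * Poly_Mapping.lookup (\<mu> \<alpha>) v) =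
        (\<Sum>\<alpha>\<in>\<Delta>. e' \<alpha> * Poly_Mapping.lookup (\<mu> \<alpha>) v)) \<Longrightarrow> \<alpha> \<in> \<Delta> \<Longrightarrow> e \<alpha> = (e' \<alpha> :: nat)"
    and card: "card \<Delta> + c = card (UNIV :: 'n set) + card \<Lambda>"
  shows "\<exists>P\<in>prime_spectrum. {a. msubst g a \<in> gen_ideal g h \<Lambda>} \<subseteq> P \<and> height P \<le> enat c"
proof (rule ccontr)
  define I where "I = {a. msubst g a \<in> gen_ideal g h \<Lambda>}"
  \<comment> \<open>\<open>s = 0\<close> when \<open>c\<close> is at least the number of variables;
    \<open>meet\<close> then says that \<open>I\<close> contains a nonzero constant.\<close>
  define s where "s = card (UNIV :: 'n set) - c"
  have I: "is_ideal I" unfolding I_def by (rule is_ideal_vimage_gen_ideal)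
  assume neg: "\<not> (\<exists>P\<in>prime_spectrum. {a. msubst g a \<in> gen_ideal g h \<Lambda>} \<subseteq> P \<and> height P \<le> enat c)"
  have meet: "\<forall>S. card S = s \<longrightarrow> I \<inter> polys_in S \<noteq> {0}"
  proof (intro allI impI notI)
    fix S :: "'n set" assume S: "card S = s" "I \<inter> polys_in S = {0}"
    then obtain P where P: "P \<in> prime_spectrum" "I \<subseteq> P" "P \<inter> polys_in S = {0}"
      using prime_disjoint_polys_in[OF I] by blast
    have "height P \<le> enat (card (UNIV :: 'n set) - card S)" using P(3) by (rule height_le)
    also have "\<dots> \<le> enat c" using S(1) by (simp add: s_def)
    finally show False using neg P by (auto simp: I_def)
  qed
  obtain w C where w: "\<forall>v. w v > 0" and V: "\<forall>t. \<exists>V. finite V \<and> card V * (t + 1) \<le> C * (t + 1) ^ s \<and>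
           (\<forall>p. (\<forall>e\<in>Poly_Mapping.keys p. wt w e \<le> t) \<longrightarrow> p \<in> mp.span (V \<union> I))"
    using ideal_colength_bound[OF I meet] by (elim exE conjE) (rule that)
  \<comment> \<open>Products of the \<open>G \<alpha>\<close> with exponents below
    \<open>\<tau>\<close> have lowest weight below \<open>t = \<kappa> * \<tau>\<close>. There are
    \<open>\<tau> ^ D\<close> of them, against a spanning set of size at most
    \<open>K * \<tau> ^ (q + (s - 1))\<close> if \<open>s > 0\<close>. Hence \<open>\<tau>\<close>
    is taken larger than \<open>K\<close>, and larger than \<open>C\<close> for the case
    \<open>s = 0\<close>.\<close>
  define q where "q = card \<Lambda>"
  define D where "D = card \<Delta>"
  define \<kappa> where "\<kappa> = Suc (\<Sum>\<alpha>\<in>\<Delta>. wt \<omega> (\<mu> \<alpha>))"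
  define W where "W = (\<Sum>v\<in>UNIV. w v)"
  define K where "K = \<kappa> ^ q * C * (W * \<kappa> + 1) ^ (s - 1)"
  define \<tau> where "\<tau> = Suc (C + K)"
  define t where "t = \<kappa> * \<tau>"
  obtain V where V: "finite V" "card V * (W * t + 1) \<le> C * (W * t + 1) ^ s"
     "\<And>p. p \<in> weight_le w (W * t) \<Longrightarrow> p \<in> mp.span (V \<union> I)"
    using spec[OF V, of "W * t"] by (auto simp: weight_le_def)
  have "msubst g a \<in> mp.span (msubst g ` V \<union> (gen_ideal g h \<Lambda> \<union> wfilt \<omega> t))" for a
  proof -
    have "msubst g a \<in> mp.span (msubst g ` V \<union> (msubst g ` I \<union> wfilt \<omega> t))"
      using msubst_span[OF g V(3)[unfolded W_def]] .
    moreover have "msubst g ` I \<subseteq> gen_ideal g h \<Lambda>" by (auto simp: I_def)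
    ultimately show ?thesis
      using mp.span_mono[of "msubst g ` V \<union> (msubst g ` I \<union> wfilt \<omega> t)"
          "msubst g ` V \<union> (gen_ideal g h \<Lambda> \<union> wfilt \<omega> t)"] by blast
  qed
  note base = adjoin_ring_span_base[OF assms(1) this]
  have "\<exists>V'. finite V' \<and> card V' \<le> t ^ card \<Lambda> * card (msubst g ` V) \<and>
      (\<forall>r\<in>adjoin_ring g h \<Lambda>. r \<in> mp.span (V' \<union> wfilt \<omega> t))"
    by (rule adjoin_ring_span[OF assms(1) order_refl _ h base]) (use V(1) in auto)
  then obtain V' where V': "finite V'" "card V' \<le> t ^ card \<Lambda> * card (msubst g ` V)"
    "\<forall>r\<in>adjoin_ring g h \<Lambda>. r \<in> mp.span (V' \<union> wfilt \<omega> t)" by (elim exE conjE) (rule that)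
  have cV': "card V' \<le> t ^ q * card V"
    using V'(2) card_image_le[OF V(1), of "msubst g"] unfolding q_def
    by (meson le_trans mult_le_mono2)
  define E where "E = PiE \<Delta> (\<lambda>_. {..<\<tau>})"
  define M where "M e = (\<Sum>\<alpha>\<in>\<Delta>. \<Sum>i<(e \<alpha> :: nat). \<mu> \<alpha>)" for e
  define b where "b e = (\<Prod>\<alpha>\<in>\<Delta>. G \<alpha> ^ e \<alpha>)" for e
  have finE: "finite E" unfolding E_def using assms(2) by (intro finite_PiE) auto
  have cE: "card E = \<tau> ^ D" using assms(2) by (simp add: E_def D_def card_PiE)
  have lowE: "has_lowest \<omega> (M e) (b e)" for e
    unfolding M_def b_def by (intro has_lowest_prod has_lowest_power low)
  have injM: "inj_on M E"
  proof (rule inj_onI)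
    fix e e' assume e: "e \<in> E" "e' \<in> E" "M e = M e'"
    have "(\<Sum>\<alpha>\<in>\<Delta>. e \<alpha> * Poly_Mapping.lookup (\<mu> \<alpha>) v) =
        (\<Sum>\<alpha>\<in>\<Delta>. e' \<alpha> * Poly_Mapping.lookup (\<mu> \<alpha>) v)" for v
      using arg_cong[OF e(3), of "\<lambda>m. Poly_Mapping.lookup m v"]
      unfolding M_def lookup_sum_replicate .
    then have "e \<alpha> = e' \<alpha>" if "\<alpha> \<in> \<Delta>" for \<alpha>
      using indep that by blast
    then show "e = e'" using e(1,2) unfolding E_def by (meson PiE_ext)
  qed
  have wtM: "wt \<omega> (M e) < t" if e: "e \<in> E" for e
  proof -
    have "wt \<omega> (M e) = (\<Sum>\<alpha>\<in>\<Delta>. e \<alpha> * wt \<omega> (\<mu> \<alpha>))" unfolding M_def by (rule wt_sum_replicate)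
    also have "\<dots> \<le> (\<Sum>\<alpha>\<in>\<Delta>. \<tau> * wt \<omega> (\<mu> \<alpha>))"
      using e by (intro sum_mono mult_right_mono) (auto simp: E_def intro!: less_imp_le)
    also have "\<dots> = \<tau> * (\<Sum>\<alpha>\<in>\<Delta>. wt \<omega> (\<mu> \<alpha>))" by (rule sum_distrib_left[symmetric])
    also have "\<dots> < t" by (simp add: t_def \<kappa>_def \<tau>_def)
    finally show ?thesis .
  qed
  have "\<not> card V' < card E"
  proof
    assume "card V' < card E"
    have "\<exists>c. (\<exists>e\<in>E. c e \<noteq> 0) \<and> (\<Sum>e\<in>E. Const (c e) * b e) \<in> wfilt \<omega> t"
    proof (rule nontrivial_relation[OF V'(1) finE \<open>card V' < card E\<close> subspace_wfilt])
      fix e assume "e \<in> E"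
      have "b e \<in> adjoin_ring g h \<Lambda>"
        unfolding b_def by (intro adjoin_ring_prod adjoin_ring_power G)
      then show "b e \<in> mp.span (V' \<union> wfilt \<omega> t)" using V'(3) by blast
    qed
    then obtain c where c: "\<exists>e\<in>E. c e \<noteq> 0" "(\<Sum>e\<in>E. Const (c e) * b e) \<in> wfilt \<omega> t"
      by (elim exE conjE) (rule that)
    then show False using lowest_terms_independent[OF finE lowE injM wtM c(2)] by blast
  qed
  then have main: "\<tau> ^ D \<le> t ^ q * card V" using cV' by (simp add: cE)
  have "W > 0" unfolding W_def using w by (intro sum_pos) auto
  then have Wt: "C < W * t"
  proof -
    have "C < \<tau>" by (simp add: \<tau>_def)
    also have "\<tau> \<le> t" by (simp add: t_def \<kappa>_def)
    also have "t \<le> W * t" using \<open>W > 0\<close> by simp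
    finally show ?thesis .
  qed
  show False
  \<comment> \<open>For \<open>s = 0\<close> the set \<open>V\<close> is empty, which contradicts
    \<open>\<tau> ^ D > 0\<close>; for \<open>s > 0\<close> the exponents satisfy
    \<open>D = q + s\<close>, one more than the spanning set allows.\<close>
  proof (cases "s = 0")
    case True
    then have "card V * (W * t + 1) \<le> C" using V(2) by simp
    then have "card V = 0" using Wt by (cases "card V") auto
    then show False using main by (simp add: \<tau>_def)
  next
    case False
    then have D: "D = Suc (q + (s - 1))" using card by (auto simp: D_def q_def s_def)
    have "card V * (W * t + 1) \<le> (C * (W * t + 1) ^ (s - 1)) * (W * t + 1)"
      using V(2) False by (cases s) (auto simp: mult_ac)
    then have "card V \<le> C * (W * t + 1) ^ (s - 1)" by (metis Suc_eq_plus1 mult_le_cancel2 zero_less_Suc)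
    also have "\<dots> \<le> C * ((W * \<kappa> + 1) * \<tau>) ^ (s - 1)"
      by (intro mult_left_mono power_mono) (auto simp: t_def \<tau>_def algebra_simps)
    finally have "\<tau> ^ D \<le> (\<kappa> * \<tau>) ^ q * (C * ((W * \<kappa> + 1) * \<tau>) ^ (s - 1))"
      using main mult_le_mono2 unfolding t_def by (meson le_trans)
    also have "\<dots> = K * \<tau> ^ (q + (s - 1))"
      unfolding K_def power_mult_distrib power_add by (simp only: mult_ac)
    also have "\<dots> < \<tau> * \<tau> ^ (q + (s - 1))"
      by (intro mult_strict_right_mono) (auto simp: \<tau>_def)
    also have "\<dots> = \<tau> ^ D" by (simp add: D)
    finally show False by simp
  qed
qed

section \<open>Derivatives and congruences of determinants\<close>

lemma partial_deriv_superset: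
  assumes "finite A" "Poly_Mapping.keys f \<subseteq> A"
  shows "partial_deriv v f = (\<Sum>e\<in>A. Poly_Mapping.single (e - Poly_Mapping.single v 1)
          (of_nat (Poly_Mapping.lookup e v) * Poly_Mapping.lookup f e))"
  unfolding partial_deriv_def
  by (rule sum.mono_neutral_left) (use assms in \<open>auto simp: in_keys_iff\<close>)

lemma partial_deriv_single:
  "partial_deriv v (Poly_Mapping.single e c) =
     Poly_Mapping.single (e - Poly_Mapping.single v 1) (of_nat (Poly_Mapping.lookup e v) * c)"
  by (subst partial_deriv_superset[of "{e}"]) (auto split: if_splits)

lemma partial_deriv_add: "partial_deriv v (p + q) = partial_deriv v p + partial_deriv v q"
proof -
  let ?A = "Poly_Mapping.keys p \<union> Poly_Mapping.keys q"
  have "Poly_Mapping.keys (p + q) \<subseteq> ?A" by (rule keys_add)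
  then show ?thesis
    by (simp add: partial_deriv_superset[of ?A] lookup_add distrib_left single_add sum.distrib)
qed

lemma partial_deriv_0 [simp]: "partial_deriv v 0 = 0"
  by (simp add: partial_deriv_def)

lemma partial_deriv_sum: "partial_deriv v (sum f A) = (\<Sum>x\<in>A. partial_deriv v (f x))"
  by (induction A rule: infinite_finite_induct) (simp_all add: partial_deriv_add)

lemma partial_deriv_Const [simp]: "partial_deriv v (Const c) = 0"
  by (simp add: Const_def partial_deriv_single)

lemma partial_deriv_1 [simp]: "partial_deriv v 1 = 0"
  using partial_deriv_Const[of v 1] by simp

lemma partial_deriv_Var: "partial_deriv v (Var u) = (if u = v then 1 else 0)"
  by (simp add: Var_def partial_deriv_single lookup_single)

text \<open>By bilinearity it is enough to treat monomials. Where the exponent subtraction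
  truncates, the coefficient is 0, so the exponents agree whenever they matter.\<close>

lemma partial_deriv_mult:
  "partial_deriv v (p * q) = partial_deriv v p * q + p * partial_deriv v q"
proof -
  let ?s = "\<lambda>p e. Poly_Mapping.single e (Poly_Mapping.lookup p e)"
  have mono: "partial_deriv v (Poly_Mapping.single a c * Poly_Mapping.single b d) =
      partial_deriv v (Poly_Mapping.single a c) * Poly_Mapping.single b d +
      Poly_Mapping.single a c * partial_deriv v (Poly_Mapping.single b d)"
    for a b :: "'a \<Rightarrow>\<^sub>0 nat" and c d :: 'b
  proof -
    let ?v = "Poly_Mapping.single v (1 :: nat)"
    have 1: "Poly_Mapping.single (a - ?v + b) (of_nat (Poly_Mapping.lookup a v) * c * d) =
        Poly_Mapping.single (a + b - ?v) (of_nat (Poly_Mapping.lookup a v) * c * d)"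
      if "Poly_Mapping.lookup a v > 0" for a b :: "'a \<Rightarrow>\<^sub>0 nat" and c d :: 'b
    proof -
      have "a - ?v + b = a + b - ?v"
        using that by (intro poly_mapping_eqI) (auto simp: lookup_add lookup_minus lookup_single when_def)
      then show ?thesis by simp
    qed
    have 2: "Poly_Mapping.single (a - ?v + b) (of_nat (Poly_Mapping.lookup a v) * c * d) =
        Poly_Mapping.single (a + b - ?v) (of_nat (Poly_Mapping.lookup a v) * c * d)"
      for a b :: "'a \<Rightarrow>\<^sub>0 nat" and c d :: 'b
      using 1[of a] by (cases "Poly_Mapping.lookup a v = 0") auto
    show ?thesis
      using 2[of a b c d] 2[of b a d c]
      by (simp add: mult_single partial_deriv_single lookup_add algebra_simps flip: single_add)
  qed
  have "p * q = (\<Sum>a\<in>Poly_Mapping.keys p. ?s p a) * (\<Sum>b\<in>Poly_Mapping.keys q. ?s q b)"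
    using mpol_eq_sum[of p] mpol_eq_sum[of q] by simp
  then have "partial_deriv v (p * q) = (\<Sum>a\<in>Poly_Mapping.keys p. \<Sum>b\<in>Poly_Mapping.keys q.
       partial_deriv v (?s p a) * ?s q b + ?s p a * partial_deriv v (?s q b))"
    by (simp only: sum_product partial_deriv_sum mono)
  also have "\<dots> = partial_deriv v (\<Sum>a\<in>Poly_Mapping.keys p. ?s p a) * (\<Sum>b\<in>Poly_Mapping.keys q. ?s q b) +
      (\<Sum>a\<in>Poly_Mapping.keys p. ?s p a) * partial_deriv v (\<Sum>b\<in>Poly_Mapping.keys q. ?s q b)"
    by (simp only: sum.distrib sum_product partial_deriv_sum)
  finally show ?thesis by (simp flip: mpol_eq_sum)
qed

lemma partial_deriv_prod:
  assumes "finite A"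
  shows "partial_deriv v (\<Prod>i\<in>A. f i) = (\<Sum>i\<in>A. partial_deriv v (f i) * (\<Prod>j\<in>A - {i}. f j))"
  using assms
proof (induction A rule: finite_induct)
  case (insert x A)
  have "(\<Sum>i\<in>A. partial_deriv v (f i) * (\<Prod>j\<in>insert x A - {i}. f j)) =
      (\<Sum>i\<in>A. f x * (partial_deriv v (f i) * (\<Prod>j\<in>A - {i}. f j)))"
  proof (intro sum.cong refl)
    fix i assume "i \<in> A"
    then have "insert x A - {i} = insert x (A - {i})" using insert.hyps by auto
    then show "partial_deriv v (f i) * (\<Prod>j\<in>insert x A - {i}. f j) =
        f x * (partial_deriv v (f i) * (\<Prod>j\<in>A - {i}. f j))"
      using insert.hyps by (simp add: mult.left_commute)
  qed
  moreover have "insert x A - {x} = A" using insert.hyps by auto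
  ultimately show ?case
    using insert by (simp add: partial_deriv_mult sum_distrib_left)
qed simp

lemma partial_deriv_uminus: "partial_deriv v (- p) = - partial_deriv v p"
  using partial_deriv_add[of v p "- p"] by (simp add: eq_neg_iff_add_eq_0 add.commute)

text \<open>Jacobi's formula: the product rule differentiates one row at a time, and
  \<open>N i\<close>, with row \<open>i\<close> differentiated, is expanded along that row, where
  its cofactors are those of \<open>M\<close>.\<close>

lemma partial_deriv_det:
  fixes M :: "('x, 'k::comm_ring_1) mpol mat"
  assumes M: "M \<in> carrier_mat n n"
  shows "partial_deriv v (det M) = (\<Sum>i<n. \<Sum>j<n. partial_deriv v (M $$ (i, j)) * cofactor M i j)"
proof -
  let ?P = "{p. p permutes {0..<n}}"
  define N where "N i = mat n n (\<lambda>(a, b). if a = i then partial_deriv v (M $$ (a, b)) else M $$ (a, b))" for i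
  have N: "N i \<in> carrier_mat n n" for i by (simp add: N_def)
  have sgn: "partial_deriv v (signof p * x) = signof p * partial_deriv v x" for p and x :: "('x, 'k) mpol"
    by (auto simp: sign_def partial_deriv_uminus)
  have "partial_deriv v (det M) = (\<Sum>p\<in>?P. signof p * partial_deriv v (\<Prod>i = 0..<n. M $$ (i, p i)))"
    by (simp add: det_def'[OF M] partial_deriv_sum sgn)
  also have "\<dots> = (\<Sum>p\<in>?P. \<Sum>i = 0..<n. signof p * (\<Prod>a = 0..<n. N i $$ (a, p a)))"
  proof (intro sum.cong refl)
    fix p assume p: "p \<in> ?P"
    have "partial_deriv v (M $$ (i, p i)) * (\<Prod>j\<in>{0..<n} - {i}. M $$ (j, p j)) = (\<Prod>a = 0..<n. N i $$ (a, p a))"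
      if i: "i \<in> {0..<n}" for i
    proof -
      have pn: "p a < n" if "a < n" for a using p that by (auto dest: permutes_in_image)
      have "(\<Prod>a = 0..<n. N i $$ (a, p a)) = N i $$ (i, p i) * (\<Prod>a\<in>{0..<n} - {i}. N i $$ (a, p a))"
        using i by (intro prod.remove) auto
      also have "(\<Prod>a\<in>{0..<n} - {i}. N i $$ (a, p a)) = (\<Prod>j\<in>{0..<n} - {i}. M $$ (j, p j))"
        using pn by (intro prod.cong) (auto simp: N_def)
      finally show ?thesis using i pn by (simp add: N_def)
    qed
    then show "signof p * partial_deriv v (\<Prod>i = 0..<n. M $$ (i, p i)) =
        (\<Sum>i = 0..<n. signof p * (\<Prod>a = 0..<n. N i $$ (a, p a)))"
      by (simp add: partial_deriv_prod flip: sum_distrib_left)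
  qed
  also have "\<dots> = (\<Sum>i = 0..<n. det (N i))"
    by (subst sum.swap) (simp add: det_def'[OF N])
  also have "\<dots> = (\<Sum>i = 0..<n. \<Sum>j<n. partial_deriv v (M $$ (i, j)) * cofactor M i j)"
  proof (intro sum.cong refl)
    fix i assume i: "i \<in> {0..<n}"
    have "mat_delete (N i) i j = mat_delete M i j" for j
      using M i by (intro eq_matI) (auto simp: mat_delete_def N_def)
    then have "cofactor (N i) i j = cofactor M i j" for j by (simp add: cofactor_def)
    then show "det (N i) = (\<Sum>j<n. partial_deriv v (M $$ (i, j)) * cofactor M i j)"
      using i laplace_expansion_row[OF N, of i i] by (simp add: N_def)
  qed
  finally show ?thesis by (simp add: lessThan_atLeast0)
qed

lemma affine_matrix_carrier [simp]: "affine_matrix m A B \<in> carrier_mat m m"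
  by (simp add: affine_matrix_def)

lemma affine_matrix_index:
  "i < m \<Longrightarrow> j < m \<Longrightarrow> affine_matrix m A B $$ (i, j) =
     Const (A $$ (i, j)) + (\<Sum>v\<in>UNIV. Const (B v $$ (i, j)) * Var v)"
  by (simp add: affine_matrix_def)

lemma partial_deriv_affine_matrix:
  "i < m \<Longrightarrow> j < m \<Longrightarrow> partial_deriv v (affine_matrix m A B $$ (i, j)) = Const (B v $$ (i, j))"
proof -
  assume "i < m" "j < m"
  then have "partial_deriv v (affine_matrix m A B $$ (i, j)) = (\<Sum>u\<in>UNIV. Const (B u $$ (i, j)) * (if u = v then 1 else 0))"
    by (simp add: affine_matrix_index partial_deriv_add partial_deriv_sum partial_deriv_mult partial_deriv_Var)
  also have "\<dots> = (\<Sum>u\<in>UNIV. if u = v then Const (B u $$ (i, j)) else 0)"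
    by (intro sum.cong) auto
  finally show ?thesis by simp
qed

text \<open>Row expansion and Jacobi's formula write the determinant and its derivatives as
  combinations of cofactors. An entry that is identically zero contributes nothing, which leaves its
  cofactor free; the corner entry in corank one is of this kind.\<close>

lemma det_affine_singular:
  fixes A :: "'k::comm_ring_1 mat" and B :: "'n::finite \<Rightarrow> 'k mat"
  assumes I: "is_ideal I" and m: "m > 0"
    and cof: "\<And>i j. i < m \<Longrightarrow> j < m \<Longrightarrow> cofactor (affine_matrix m A B) i j \<in> I \<or>
       A $$ (i, j) = 0 \<and> (\<forall>v. B v $$ (i, j) = 0)"
  shows "det (affine_matrix m A B) \<in> I" "partial_deriv v (det (affine_matrix m A B)) \<in> I"
proof -
  let ?M = "affine_matrix m A B"
  have "?M $$ (0, j) * cofactor ?M 0 j \<in> I" if "j < m" for j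
    using cof[OF m that] is_idealD(1,3)[OF I] by (auto simp: affine_matrix_index m that)
  then show "det ?M \<in> I"
    unfolding laplace_expansion_row[OF affine_matrix_carrier m] by (intro is_ideal_sum[OF I]) auto
  have "partial_deriv v (?M $$ (i, j)) * cofactor ?M i j \<in> I" if "i < m" "j < m" for i j
    using cof[OF that] is_idealD(1,3)[OF I] by (auto simp: partial_deriv_affine_matrix that)
  then show "partial_deriv v (det ?M) \<in> I"
    unfolding partial_deriv_det[OF affine_matrix_carrier] by (intro is_ideal_sum[OF I]) auto
qed

lemma codim_Sing_le:
  assumes "P \<in> prime_spectrum" "f \<in> P" "\<And>v. partial_deriv v f \<in> P" "height P \<le> enat c"
  shows "codim (Sing f) \<le> enat c"
proof -
  have "P \<in> Sing f" using assms by (simp add: Sing_def)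
  then have "codim (Sing f) \<le> height P" unfolding codim_def by (rule INF_lower)
  then show ?thesis using assms(4) by (rule order_trans)
qed

section \<open>Vanishing minors and congruent determinants\<close>

lemma det_zero_column:
  assumes "A \<in> carrier_mat n n" "j < n" "\<And>i. i < n \<Longrightarrow> A $$ (i, j) = 0"
  shows "det A = 0"
  unfolding laplace_expansion_column[OF assms(1,2)] using assms(3) by simp

text \<open>Dropping the zero column 0 of \<open>U\<close> together with row 0 of \<open>V\<close>
  does not change the product. A minor of \<open>U * V\<close> thus factors through a square matrix
  whose first column, the former column 1 of \<open>U\<close>, is still zero.\<close>

lemma cofactor_mult_zero_columns:
  fixes U V :: "'a::comm_ring_1 mat"
  assumes U: "U \<in> carrier_mat n n" and V: "V \<in> carrier_mat n n" and n: "2 \<le> n"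
    and zero: "\<And>i j. i < n \<Longrightarrow> j < 2 \<Longrightarrow> U $$ (i, j) = 0"
    and ij: "i < n" "j < n"
  shows "cofactor (U * V) i j = 0"
proof -
  have "mat_delete (U * V) i j = mat_delete U i 0 * mat_delete V 0 j"
  proof (rule eq_matI)
    fix a b assume "a < dim_row (mat_delete U i 0 * mat_delete V 0 j)"
      "b < dim_col (mat_delete U i 0 * mat_delete V 0 j)"
    then have ab: "a < n - 1" "b < n - 1" using U V by auto
    define a' b' where "a' = (if a < i then a else Suc a)" and "b' = (if b < j then b else Suc b)"
    have ab': "a' < n" "b' < n" using ab by (auto simp: a'_def b'_def)
    have "mat_delete (U * V) i j $$ (a, b) = (\<Sum>k = 0..<n. U $$ (a', k) * V $$ (k, b'))"
      using U V ab ab' by (simp add: mat_delete_def a'_def b'_def scalar_prod_def)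
    also have "\<dots> = (\<Sum>k = 0..<Suc (n - 1). U $$ (a', k) * V $$ (k, b'))" using n by simp
    also have "\<dots> = U $$ (a', 0) * V $$ (0, b') + (\<Sum>k = 0..<n - 1. U $$ (a', Suc k) * V $$ (Suc k, b'))"
      by (rule sum.atLeast0_lessThan_Suc_shift[unfolded comp_def])
    also have "U $$ (a', 0) = 0" using zero[OF ab'(1), of 0] by simp
    also have "0 * V $$ (0, b') + (\<Sum>k = 0..<n - 1. U $$ (a', Suc k) * V $$ (Suc k, b')) =
        (mat_delete U i 0 * mat_delete V 0 j) $$ (a, b)"
      using U V ab ab' by (auto simp: mat_delete_def a'_def b'_def scalar_prod_def intro!: sum.cong)
    finally show "mat_delete (U * V) i j $$ (a, b) = (mat_delete U i 0 * mat_delete V 0 j) $$ (a, b)" .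
  qed (use U V in auto)
  moreover have "det (mat_delete U i 0) = 0"
    using U n zero ij(1) by (intro det_zero_column[of _ "n - 1" 0]) (auto simp: mat_delete_def)
  moreover have "det (mat_delete U i 0 * mat_delete V 0 j) = det (mat_delete U i 0) * det (mat_delete V 0 j)"
    using mat_delete_carrier[OF U] mat_delete_carrier[OF V] by (rule det_mult)
  ultimately show ?thesis by (simp add: cofactor_def)
qed

text \<open>\<open>J\<close> is only required to absorb products with elements of \<open>R\<close>,
  so that ideals of a subalgebra are covered; \<open>R = UNIV\<close> gives the case of ordinary
  ideals.\<close>

lemma det_congruent:
  fixes R J :: "'a::comm_ring_1 set"
  assumes M: "M \<in> carrier_mat n n" "N \<in> carrier_mat n n"
    and R: "1 \<in> R" "\<And>a b. a \<in> R \<Longrightarrow> b \<in> R \<Longrightarrow> a * b \<in> R"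
    and J: "0 \<in> J" "\<And>a b. a \<in> J \<Longrightarrow> b \<in> J \<Longrightarrow> a + b \<in> J" "\<And>a. a \<in> J \<Longrightarrow> - a \<in> J"
       "\<And>a b. a \<in> R \<Longrightarrow> b \<in> J \<Longrightarrow> a * b \<in> J"
    and MR: "\<And>i j. i < n \<Longrightarrow> j < n \<Longrightarrow> M $$ (i, j) \<in> R \<and> N $$ (i, j) \<in> R \<and> M $$ (i, j) - N $$ (i, j) \<in> J"
  shows "det M - det N \<in> J"
proof -
  have prod: "(\<Prod>x\<in>A. f x) \<in> R \<and> (\<Prod>x\<in>A. f x) - (\<Prod>x\<in>A. g x) \<in> J"
    if "finite A" "\<And>x. x \<in> A \<Longrightarrow> f x \<in> R \<and> g x \<in> R \<and> f x - g x \<in> J" for A and f g :: "nat \<Rightarrow> 'a"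
    using that
  proof (induction A rule: finite_induct)
    case empty
    then show ?case using R(1) J(1) by simp
  next
    case (insert x A)
    have "(\<Prod>x\<in>insert x A. f x) - (\<Prod>x\<in>insert x A. g x) =
        (\<Prod>x\<in>A. f x) * (f x - g x) + g x * ((\<Prod>x\<in>A. f x) - (\<Prod>x\<in>A. g x))"
      using insert.hyps by (simp add: algebra_simps)
    moreover have "(\<Prod>x\<in>A. f x) * (f x - g x) + g x * ((\<Prod>x\<in>A. f x) - (\<Prod>x\<in>A. g x)) \<in> J"
      using insert by (intro J(2) J(4)) auto
    moreover have "(\<Prod>x\<in>insert x A. f x) \<in> R" using insert R(2) by simp
    ultimately show ?case by simp
  qed
  have sum: "sum f A \<in> J" if "\<And>p. p \<in> A \<Longrightarrow> f p \<in> J" for A and f :: "(nat \<Rightarrow> nat) \<Rightarrow> 'a"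
    using that by (induction A rule: infinite_finite_induct) (auto simp: J)
  let ?P = "{p. p permutes {0..<n}}"
  let ?d = "\<lambda>p. (\<Prod>i = 0..<n. M $$ (i, p i)) - (\<Prod>i = 0..<n. N $$ (i, p i))"
  have "det M - det N = (\<Sum>p\<in>?P. signof p * ?d p)"
    by (simp add: det_def'[OF M(1)] det_def'[OF M(2)] right_diff_distrib flip: sum_subtractf)
  also have "\<dots> \<in> J"
  proof (rule sum)
    fix p assume p: "p \<in> ?P"
    have "?d p \<in> J"
      using p MR by (intro conjunct2[OF prod]) (auto dest: permutes_in_image)
    then show "signof p * ?d p \<in> J" using J(3)[of "?d p"] by (auto simp: sign_def)
  qed
  finally show ?thesis .
qed

section \<open>Corank at least two\<close>

text \<open>The exponent matrix is unitriangular in two blocks: among the given monomials a variable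
  in \<open>\<Delta>\<^sub>0\<close> occurs only in its own, which settles the exponents there, and
  the remaining ones follow.\<close>

lemma triangular_independent:
  fixes \<mu> :: "'x \<Rightarrow> 'x \<Rightarrow>\<^sub>0 nat" and e e' :: "'x \<Rightarrow> nat"
  assumes "finite \<Delta>" and diag: "\<And>\<alpha>. \<alpha> \<in> \<Delta> \<Longrightarrow> Poly_Mapping.lookup (\<mu> \<alpha>) \<alpha> = 1"
    and off: "\<And>\<alpha> v. \<alpha> \<in> \<Delta> \<Longrightarrow> v \<in> \<Delta> \<Longrightarrow> \<alpha> \<noteq> v \<Longrightarrow> Poly_Mapping.lookup (\<mu> \<alpha>) v \<noteq> 0 \<Longrightarrow> \<alpha> \<in> \<Delta>\<^sub>0 \<and> v \<notin> \<Delta>\<^sub>0"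
    and eq: "\<And>v. (\<Sum>\<alpha>\<in>\<Delta>. e \<alpha> * Poly_Mapping.lookup (\<mu> \<alpha>) v) = (\<Sum>\<alpha>\<in>\<Delta>. e' \<alpha> * Poly_Mapping.lookup (\<mu> \<alpha>) v)"
    and "\<alpha> \<in> \<Delta>"
  shows "e \<alpha> = e' \<alpha>"
proof -
  have split: "(\<Sum>\<alpha>\<in>\<Delta>. f \<alpha> * Poly_Mapping.lookup (\<mu> \<alpha>) v) =
      f v + (\<Sum>\<alpha>\<in>\<Delta> - {v}. f \<alpha> * Poly_Mapping.lookup (\<mu> \<alpha>) v)" if "v \<in> \<Delta>" for f v
    using assms(1) that diag by (simp add: sum.remove)
  have 0: "e v = e' v" if v: "v \<in> \<Delta>" "v \<in> \<Delta>\<^sub>0" for v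
  proof -
    have "(\<Sum>\<alpha>\<in>\<Delta> - {v}. f \<alpha> * Poly_Mapping.lookup (\<mu> \<alpha>) v) = 0" for f :: "'x \<Rightarrow> nat"
      using off v by (intro sum.neutral) fastforce
    then show ?thesis using eq[of v] split[OF v(1), of e] split[OF v(1), of e'] by simp
  qed
  have "(\<Sum>\<beta>\<in>\<Delta> - {\<alpha>}. e \<beta> * Poly_Mapping.lookup (\<mu> \<beta>) \<alpha>) = (\<Sum>\<beta>\<in>\<Delta> - {\<alpha>}. e' \<beta> * Poly_Mapping.lookup (\<mu> \<beta>) \<alpha>)"
  proof (intro sum.cong refl)
    fix \<beta> assume "\<beta> \<in> \<Delta> - {\<alpha>}"
    then show "e \<beta> * Poly_Mapping.lookup (\<mu> \<beta>) \<alpha> = e' \<beta> * Poly_Mapping.lookup (\<mu> \<beta>) \<alpha>"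
      using off[of \<beta> \<alpha>] 0[of \<beta>] assms(5) by (cases "Poly_Mapping.lookup (\<mu> \<beta>) \<alpha> = 0") auto
  qed
  then show ?thesis using eq[of \<alpha>] split[OF assms(5), of e] split[OF assms(5), of e'] by simp
qed

lemma gen_ideal_uminus: "x \<in> gen_ideal g h \<Lambda> \<Longrightarrow> - x \<in> gen_ideal g h \<Lambda>"
  using gen_ideal_mult[OF _ adjoin_ring_Const[of "-1"]] by (fastforce simp: Const_uminus)

lemma Var_in_wfilt: "t \<le> w v \<Longrightarrow> Var v \<in> wfilt w t"
  by (simp add: Var_def single_in_wfilt)

lemma has_lowest_Var: "has_lowest w (Poly_Mapping.single v 1) (Var v)"
  by (rule has_lowestI[of 1]) (auto simp: Var_def)

lemma sum_index_if_eq: "(\<Sum>k = 0..<m. f k * (if k = j then 1 else 0)) = f j" if "j < m"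
  for f :: "nat \<Rightarrow> 'a::comm_ring_1"
proof -
  have "(\<Sum>k = 0..<m. f k * (if k = j then 1 else 0)) = (\<Sum>k = 0..<m. if k = j then f k else 0)"
    by (intro sum.cong) auto
  then show ?thesis using that by simp
qed

text \<open>Matrices of rank at most \<open>m - 2\<close> near a diagonal matrix with entries \<open>d i\<close>, \<open>d 0 = d 1 = 0\<close>,
  are parametrised by their last \<open>m - 2\<close> columns and by the coefficients that express the first
  two columns in terms of these; the variable at position \<open>(i, j)\<close> is \<open>Inr (i, j)\<close>.\<close>

definition low_rank_left :: "nat \<Rightarrow> (nat \<Rightarrow> 'k) \<Rightarrow> ('n + nat \<times> nat, 'k::comm_ring_1) mpol mat" where
  "low_rank_left m d = mat m m (\<lambda>(i, j). if j < 2 then 0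
     else (if i = j then Const (d i) else 0) + Var (Inr (i, j)))"

definition low_rank_right :: "nat \<Rightarrow> ('n + nat \<times> nat, 'k::comm_ring_1) mpol mat" where
  "low_rank_right m = mat m m (\<lambda>(i, j). if j < 2 then Var (Inr (i, j)) else if i = j then 1 else 0)"

definition low_rank :: "nat \<Rightarrow> (nat \<Rightarrow> 'k) \<Rightarrow> ('n + nat \<times> nat, 'k::comm_ring_1) mpol mat" where
  "low_rank m d = low_rank_left m d * low_rank_right m"

lemma low_rank_carrier [simp]: "low_rank m d \<in> carrier_mat m m"
  by (simp add: low_rank_def low_rank_left_def low_rank_right_def times_mat_def)

lemma low_rank_index_ge:
  assumes "i < m" "j < m" "2 \<le> j"
  shows "low_rank m d $$ (i, j) = (if i = j then Const (d i) else 0) + Var (Inr (i, j))"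
proof -
  have "low_rank m d $$ (i, j) = (\<Sum>k = 0..<m. low_rank_left m d $$ (i, k) * (if k = j then 1 else 0))"
    using assms by (simp add: low_rank_def low_rank_left_def low_rank_right_def scalar_prod_def)
  also have "\<dots> = low_rank_left m d $$ (i, j)" using assms(2) by (rule sum_index_if_eq)
  finally show ?thesis using assms by (simp add: low_rank_left_def)
qed

lemma low_rank_index_less:
  fixes d :: "nat \<Rightarrow> 'k::comm_ring_1"
  assumes "i < m" "j < 2" "2 \<le> m" and d: "d 0 = 0" "d 1 = 0"
  shows "low_rank m d $$ (i, j) = Const (d i) * Var (Inr (i, j)) +
    (\<Sum>k = 2..<m. Var (Inr (i, k)) * Var (Inr (k, j)))"
proof -
  let ?D = "\<lambda>k. if k < 2 \<or> i \<noteq> k then 0 else Const (d i)"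
  let ?Z = "\<lambda>k. if k < 2 then 0 else Var (Inr (i, k)) * Var (Inr (k, j))"
  have "low_rank m d $$ (i, j) = (\<Sum>k = 0..<m. ?D k * Var (Inr (k, j)) + ?Z k)"
    using assms(1-3) by (auto simp: low_rank_def low_rank_left_def low_rank_right_def scalar_prod_def
        distrib_right intro!: sum.cong)
  also have "\<dots> = (\<Sum>k = 0..<m. ?D k * Var (Inr (k, j))) + (\<Sum>k = 0..<m. ?Z k)"
    by (rule sum.distrib)
  also have "(\<Sum>k = 0..<m. ?Z k) = (\<Sum>k = 2..<m. Var (Inr (i, k)) * Var (Inr (k, j)))"
    by (rule sum.mono_neutral_cong_right) auto
  also have "(\<Sum>k = 0..<m. ?D k * Var (Inr (k, j))) = (\<Sum>k = 0..<m. if k = i then ?D i * Var (Inr (i, j)) else 0)"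
    by (intro sum.cong) auto
  also have "\<dots> = ?D i * Var (Inr (i, j))" using assms(1) by simp
  also have "?D i = Const (d i)" using d by (cases "i = 0"; cases "i = 1") auto
  finally show ?thesis .
qed

lemma cofactor_low_rank:
  assumes "2 \<le> m" "i < m" "j < m"
  shows "cofactor (low_rank m d) i j = 0"
  unfolding low_rank_def
  by (rule cofactor_mult_zero_columns[OF _ _ assms(1) _ assms(2,3)])
    (use assms(1) in \<open>auto simp: low_rank_left_def low_rank_right_def\<close>)

text \<open>The weights are chosen so that every entry of \<open>low_rank m d\<close> outside the upper left
  \<open>2 \<times> 2\<close> block, with its constant term removed, has a single term of least weight.\<close>

definition rank_weight :: "(nat \<Rightarrow> 'k::zero) \<Rightarrow> 'n + nat \<times> nat \<Rightarrow> nat" where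
  "rank_weight d y = (case y of Inl v \<Rightarrow> 1 | Inr (i, j) \<Rightarrow>
     if j < 2 then (if d i = 0 then 0 else 1) else if i = j \<or> i < 2 then 1 else 2)"

text \<open>The lowest monomial of \<open>rank_generator\<close>. In the first two columns the
  linear term is missing when \<open>d i = 0\<close>, and the quadratic term with middle index
  \<open>i\<close> takes its place.\<close>

definition rank_monomial :: "(nat \<Rightarrow> 'k::zero) \<Rightarrow> 'n + nat \<times> nat \<Rightarrow> 'n + nat \<times> nat \<Rightarrow>\<^sub>0 nat" where
  "rank_monomial d y = (case y of Inl v \<Rightarrow> Poly_Mapping.single y 1 | Inr (i, j) \<Rightarrow>
     if j < 2 \<and> d i = 0 then Poly_Mapping.single (Inr (i, i)) 1 + Poly_Mapping.single y 1
     else Poly_Mapping.single y 1)"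

text \<open>Elements that lie in the subalgebra generated by the entries of
  \<open>low_rank m d\<close>, up to constants. The coefficient variables of the first two columns
  need not lie in it, so the entries themselves are taken there.\<close>

definition rank_generator :: "nat \<Rightarrow> (nat \<Rightarrow> 'k) \<Rightarrow> 'n + nat \<times> nat \<Rightarrow> ('n + nat \<times> nat, 'k::comm_ring_1) mpol" where
  "rank_generator m d y = (case y of Inl v \<Rightarrow> Var y | Inr (i, j) \<Rightarrow>
     if j < 2 then low_rank m d $$ (i, j) else Var y)"

lemma rank_monomial_cases:
  assumes "y \<in> range Inl \<union> Inr ` ({..<m} \<times> {..<m} - {..<2} \<times> {..<2})"
  shows "rank_monomial d y = Poly_Mapping.single y 1 \<or>
    (\<exists>i j. y = Inr (i, j) \<and> j < 2 \<and> \<not> i < 2 \<and>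
      rank_monomial d y = Poly_Mapping.single (Inr (i, i)) 1 + Poly_Mapping.single y 1)"
proof (cases "\<exists>i j. y = Inr (i, j) \<and> j < 2 \<and> d i = 0")
  case True
  then obtain i j where ij: "y = Inr (i, j)" "j < 2" "d i = 0" by blast
  then have "\<not> i < 2" using assms by auto
  then show ?thesis using ij by (simp add: rank_monomial_def)
next
  case False
  then show ?thesis by (auto simp: rank_monomial_def split: sum.splits)
qed

text \<open>For \<open>j < 2\<close> the entry is \<open>d i * z i j + z i i * z i j\<close> plus
  products \<open>z i k * z k j\<close> with \<open>k \<noteq> i\<close>, which have weight at least
  2 because of \<open>z i k\<close>. The first summand is lowest if \<open>d i \<noteq> 0\<close>,
  the second otherwise, with weight 1 in either case.\<close>

lemma has_lowest_rank_generator: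
  fixes d :: "nat \<Rightarrow> 'k::field"
  assumes d: "d 0 = 0" "d 1 = 0"
    and y: "y \<in> range Inl \<union> Inr ` ({..<m} \<times> {..<m} - {..<2} \<times> {..<2})"
  shows "has_lowest (rank_weight d) (rank_monomial d y) (rank_generator m d y :: ('n + nat \<times> nat, 'k) mpol)"
proof (cases "\<exists>i j. y = Inr (i, j) \<and> j < 2")
  case False
  then have "rank_generator m d y = Var y" "rank_monomial d y = Poly_Mapping.single y 1"
    by (auto simp: rank_generator_def rank_monomial_def split: sum.splits)
  then show ?thesis using has_lowest_Var by simp
next
  case True
  let ?w = "rank_weight d :: 'n + nat \<times> nat \<Rightarrow> nat"
  obtain i j where y_eq: "y = Inr (i, j)" "j < 2" using True by blast
  then have "i < m" "\<not> i < 2" using y by auto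
  then have ij: "y = Inr (i, j)" "j < 2" "2 \<le> i" "i < m" using y_eq by auto
  let ?z = "\<lambda>i j. Var (Inr (i, j)) :: ('n + nat \<times> nat, 'k) mpol"
  have gen: "rank_generator m d y = Const (d i) * ?z i j + (\<Sum>k = 2..<m. ?z i k * ?z k j)"
    using ij d low_rank_index_less[of i m j d] by (simp add: rank_generator_def)
  have far: "?z i k * ?z k j \<in> wfilt ?w 2" if "2 \<le> k" "k \<noteq> i" for k
  proof -
    have "?z i k \<in> wfilt ?w 2" using that ij by (intro Var_in_wfilt) (simp add: rank_weight_def)
    then show ?thesis using wfilt_mult_left[of "?z i k" ?w 2 "?z k j"] by (simp add: mult.commute)
  qed
  have "(\<Sum>k\<in>{2..<m} - {i}. ?z i k * ?z k j) \<in> wfilt ?w 2"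
    using far by (intro wfilt_sum) auto
  moreover have "rank_generator m d y = Const (d i) * ?z i j + ?z i i * ?z i j + (\<Sum>k\<in>{2..<m} - {i}. ?z i k * ?z k j)"
    unfolding gen using ij by (subst sum.remove[of _ i]) (auto simp: add.assoc)
  moreover obtain r where r: "r = (\<Sum>k\<in>{2..<m} - {i}. ?z i k * ?z k j)" by blast
  ultimately have r: "r \<in> wfilt ?w 2" "rank_generator m d y = Const (d i) * ?z i j + ?z i i * ?z i j + r" by auto
  show ?thesis
  proof (cases "d i = 0")
    case True
    then have mon: "rank_monomial d y = Poly_Mapping.single (Inr (i, i)) 1 + Poly_Mapping.single y 1"
      using ij by (simp add: rank_monomial_def)
    have "wt ?w (rank_monomial d y) = 1"
      unfolding mon using ij True by (simp add: wt_add rank_weight_def)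
    moreover have "rank_generator m d y - Poly_Mapping.single (rank_monomial d y) 1 = r"
      unfolding r(2) mon using True by (simp add: ij(1) Var_def mult_single)
    ultimately show ?thesis using r(1) by (intro has_lowestI[of 1]) (auto simp: numeral_2_eq_2)
  next
    case False
    then have mon: "rank_monomial d y = Poly_Mapping.single y 1"
      using ij by (simp add: rank_monomial_def)
    have "wt ?w (rank_monomial d y) = 1"
      unfolding mon using ij False by (simp add: rank_weight_def)
    moreover have "rank_generator m d y - Poly_Mapping.single (rank_monomial d y) (d i) = ?z i i * ?z i j + r"
      unfolding r(2) mon by (simp add: ij(1) Var_def Const_def mult_single)
    moreover have "?z i i * ?z i j \<in> wfilt ?w (1 + 1)"
      using ij False by (intro wfilt_mult Var_in_wfilt) (auto simp: rank_weight_def)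
    ultimately show ?thesis using r(1) False
      by (intro has_lowestI[of "d i"]) (auto simp: numeral_2_eq_2 intro: wfilt_add)
  qed
qed

lemma codim_Sing_le_4:
  fixes A :: "'k::field mat" and B :: "'n::finite \<Rightarrow> 'k mat"
  assumes m: "2 \<le> m" and A: "A = mat m m (\<lambda>(i, j). if i = j then d i else 0)"
    and d: "d 0 = 0" "d 1 = 0"
  shows "codim (Sing (det (affine_matrix m A B))) \<le> 4"
proof -
  let ?L = "affine_matrix m A B"
  let ?w = "rank_weight d :: 'n + nat \<times> nat \<Rightarrow> nat"
  define g :: "'n \<Rightarrow> ('n + nat \<times> nat, 'k) mpol" where "g v = Var (Inl v)" for v
  define N where "N = map_mat (msubst g) ?L"
  define T :: "('n + nat \<times> nat, 'k) mpol mat" where "T = low_rank m d"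
  define h where "h = (\<lambda>(i, j). T $$ (i, j) - N $$ (i, j))"
  define \<Lambda> where "\<Lambda> = {..<m} \<times> {..<m}"
  \<comment> \<open>Leaving out the upper left block, whose entries depend on the others, gives
    \<open>m * m - 4\<close> independent elements besides the coordinates \<open>Inl v\<close>.
    Against \<open>m * m\<close> equations the deficit is the codimension 4.\<close>
  define \<Delta> :: "('n + nat \<times> nat) set" where
    "\<Delta> = range Inl \<union> Inr ` ({..<m} \<times> {..<m} - {..<2} \<times> {..<2})"
  let ?R = "adjoin_ring g h \<Lambda>" and ?J = "gen_ideal g h \<Lambda>"
  define I where "I = {a. msubst g a \<in> ?J}"
  have I: "is_ideal I" unfolding I_def by (rule is_ideal_vimage_gen_ideal)
  have g1: "g v \<in> wfilt ?w 1" for v unfolding g_def by (intro Var_in_wfilt) (simp add: rank_weight_def)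
  have N: "N $$ (i, j) = Const (A $$ (i, j)) + (\<Sum>v\<in>UNIV. Const (B v $$ (i, j)) * g v)"
    if "i < m" "j < m" for i j
    using that unfolding N_def
    by (subst index_map_mat)
      (auto simp: affine_matrix_def msubst_add msubst_sum msubst_mult)
  \<comment> \<open>\<open>N\<close> and \<open>T\<close> both reduce to \<open>A\<close> modulo
    positive weight, so the equations \<open>h\<close> have positive weight. For \<open>T\<close>
    this uses that the first two columns of \<open>A\<close> vanish.\<close>
  have N1: "Const (A $$ (i, j)) - N $$ (i, j) \<in> wfilt ?w 1" if "i < m" "j < m" for i j
  proof -
    have "(\<Sum>v\<in>UNIV. Const (B v $$ (i, j)) * g v) \<in> wfilt ?w 1"
      by (intro wfilt_sum wfilt_mult_left g1)
    then show ?thesis by (simp add: N[OF that])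
  qed
  have T1: "T $$ (i, j) - Const (A $$ (i, j)) \<in> wfilt ?w 1" if ij: "i < m" "j < m" for i j
  proof (cases "j < 2")
    case True
    have "A $$ (i, j) = 0" using ij True d by (cases "j = 0") (auto simp: A less_2_cases_iff)
    moreover have "Const (d i) * Var (Inr (i, j)) \<in> wfilt ?w 1"
    proof (cases "d i = 0")
      case False
      then show ?thesis using True by (intro wfilt_mult_left Var_in_wfilt) (simp add: rank_weight_def)
    qed simp
    moreover have "Var (Inr (i, k)) * Var (Inr (k, j)) \<in> (wfilt ?w 1 :: ('n + nat \<times> nat, 'k) mpol set)"
      if "2 \<le> k" for k
    proof -
      have "Var (Inr (k, j)) * Var (Inr (i, k)) \<in> (wfilt ?w 1 :: ('n + nat \<times> nat, 'k) mpol set)"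
        using that by (intro wfilt_mult_left Var_in_wfilt) (simp add: rank_weight_def)
      then show ?thesis by (simp add: mult.commute)
    qed
    ultimately show ?thesis
      unfolding T_def low_rank_index_less[of i m j d, OF ij(1) True m d]
      by (auto intro!: wfilt_add wfilt_sum)
  next
    case False
    then have "T $$ (i, j) - Const (A $$ (i, j)) = Var (Inr (i, j))"
      using ij by (simp add: T_def low_rank_index_ge A)
    then show ?thesis using False by (simp add: Var_in_wfilt rank_weight_def)
  qed
  have h1: "h l \<in> wfilt ?w 1" if l: "l \<in> \<Lambda>" for l
  proof -
    obtain i j where ij: "l = (i, j)" "i < m" "j < m" using l by (auto simp: \<Lambda>_def)
    have "(T $$ (i, j) - Const (A $$ (i, j))) + (Const (A $$ (i, j)) - N $$ (i, j)) \<in> wfilt ?w 1"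
      by (intro wfilt_add T1 N1 ij)
    then show ?thesis by (simp add: h_def ij(1))
  qed
  have NR: "N $$ (i, j) \<in> ?R" if "i < m" "j < m" for i j
    using that adjoin_ring.base[of g "?L $$ (i, j)"] by (simp add: N_def affine_matrix_def)
  have hJ: "T $$ (i, j) - N $$ (i, j) \<in> ?J" and TR: "T $$ (i, j) \<in> ?R" if ij: "i < m" "j < m" for i j
  proof -
    have l: "(i, j) \<in> \<Lambda>" using ij by (simp add: \<Lambda>_def)
    show "T $$ (i, j) - N $$ (i, j) \<in> ?J"
      using gen_ideal_gen[OF l _ adjoin_ring_1, where g = g and h = h] by (simp add: h_def \<Lambda>_def)
    have "h (i, j) + N $$ (i, j) \<in> ?R" by (intro adjoin_ring.add adjoin_ring_gen l NR ij)
    then show "T $$ (i, j) \<in> ?R" by (simp add: h_def)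
  qed
  have GR: "rank_generator m d y \<in> ?R" if y: "y \<in> \<Delta>" for y
  proof (cases y)
    case (Inl v)
    then show ?thesis using adjoin_ring.base[of g "Var v"] by (simp add: rank_generator_def g_def)
  next
    case (Inr p)
    then obtain i j where ij: "y = Inr (i, j)" "i < m" "j < m" using y by (cases p) (auto simp: \<Delta>_def)
    show ?thesis
    proof (cases "j < 2")
      case True
      then show ?thesis using TR[of i j] ij by (simp add: rank_generator_def T_def)
    next
      case False
      have "T $$ (i, j) + Const (- (if i = j then d i else 0)) \<in> ?R"
        by (intro adjoin_ring.add TR adjoin_ring_Const ij)
      moreover have "T $$ (i, j) + Const (- (if i = j then d i else 0)) = Var y"
        using False ij by (simp add: T_def low_rank_index_ge Const_uminus)
      ultimately show ?thesis using False ij by (simp add: rank_generator_def)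
    qed
  qed
  have card: "card \<Delta> + 4 = card (UNIV :: 'n set) + card \<Lambda>"
  proof -
    have sub: "{..<2} \<times> {..<2} \<subseteq> {..<m} \<times> {..<m}" using m by auto
    have "card \<Delta> = card (range Inl :: ('n + nat \<times> nat) set) + card (Inr ` ({..<m} \<times> {..<m} - {..<2} \<times> {..<2}) :: ('n + nat \<times> nat) set)"
      unfolding \<Delta>_def by (rule card_Un_disjoint) auto
    also have "\<dots> = card (UNIV :: 'n set) + card ({..<m} \<times> {..<m} - {..<2} \<times> {..<2 :: nat})"
      by (simp add: card_image)
    also have "card ({..<m} \<times> {..<m} - {..<2} \<times> {..<2}) = m * m - 4"
      by (subst card_Diff_subset[OF _ sub]) (auto simp: card_cartesian_product)
    finally show ?thesis using mult_le_mono[OF m m] by (simp add: \<Lambda>_def card_cartesian_product)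
  qed
  have "finite \<Lambda>" "finite \<Delta>" by (auto simp: \<Lambda>_def \<Delta>_def)
  have "\<exists>P\<in>prime_spectrum. {a. msubst g a \<in> ?J} \<subseteq> P \<and> height P \<le> enat 4"
  proof (rule exists_prime_height_le[OF \<open>finite \<Lambda>\<close> \<open>finite \<Delta>\<close> g1 h1 GR _ _ card])
    show "has_lowest ?w (rank_monomial d y) (rank_generator m d y)" if "y \<in> \<Delta>" for y
      using that unfolding \<Delta>_def by (intro has_lowest_rank_generator d)
  next
    fix e e' :: "'n + nat \<times> nat \<Rightarrow> nat" and y
    assume eq: "\<And>v. (\<Sum>\<alpha>\<in>\<Delta>. e \<alpha> * Poly_Mapping.lookup (rank_monomial d \<alpha>) v) =
        (\<Sum>\<alpha>\<in>\<Delta>. e' \<alpha> * Poly_Mapping.lookup (rank_monomial d \<alpha>) v)" and y: "y \<in> \<Delta>"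
    show "e y = e' y"
    proof (rule triangular_independent[OF \<open>finite \<Delta>\<close> _ _ eq y])
      show "Poly_Mapping.lookup (rank_monomial d \<alpha>) \<alpha> = 1" if "\<alpha> \<in> \<Delta>" for \<alpha>
        using rank_monomial_cases[OF that[unfolded \<Delta>_def], of d] by (auto simp: lookup_add lookup_single)
      show "\<alpha> \<in> {Inr (i, j) | i j. j < 2} \<and> v \<notin> {Inr (i, j) | i j. j < 2}"
        if "\<alpha> \<in> \<Delta>" "v \<in> \<Delta>" "\<alpha> \<noteq> v" "Poly_Mapping.lookup (rank_monomial d \<alpha>) v \<noteq> 0" for \<alpha> v
        using rank_monomial_cases[OF that(1)[unfolded \<Delta>_def], of d] that(3,4)
        by (auto simp: lookup_add lookup_single when_def split: if_splits)
    qed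
  qed
  then obtain P where P: "P \<in> prime_spectrum" "I \<subseteq> P" "height P \<le> enat 4" by (auto simp: I_def)
  \<comment> \<open>\<open>N\<close> and \<open>T\<close> agree modulo \<open>?J\<close>, hence so
    do their minors, and those of \<open>T\<close> are 0. Pulling back along \<open>msubst g\<close>
    puts the minors of the affine matrix into \<open>I\<close>.\<close>
  have cof: "cofactor ?L i j \<in> I" if ij: "i < m" "j < m" for i j
  proof -
    have "msubst g (det (mat_delete ?L i j)) = det (map_mat (msubst g) (mat_delete ?L i j))"
      by (rule comm_ring_hom.hom_det[OF comm_ring_hom_msubst, symmetric])
    also have "map_mat (msubst g) (mat_delete ?L i j) = mat_delete N i j"
      using ij by (intro eq_matI) (auto simp: mat_delete_def N_def affine_matrix_def)
    finally have N': "msubst g (det (mat_delete ?L i j)) = det (mat_delete N i j)" .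
    have "det (mat_delete N i j) - det (mat_delete T i j) \<in> ?J"
    proof (rule det_congruent[of _ "m - 1" _ ?R])
      show "mat_delete N i j \<in> carrier_mat (m - 1) (m - 1)" "mat_delete T i j \<in> carrier_mat (m - 1) (m - 1)"
        by (intro mat_delete_carrier; simp add: N_def T_def)+
      fix a b assume ab: "a < m - 1" "b < m - 1"
      define a' b' where "a' = (if a < i then a else Suc a)" and "b' = (if b < j then b else Suc b)"
      have ab': "a' < m" "b' < m" using ab by (auto simp: a'_def b'_def)
      have "mat_delete N i j $$ (a, b) = N $$ (a', b')" "mat_delete T i j $$ (a, b) = T $$ (a', b')"
        using ab by (auto simp: mat_delete_def a'_def b'_def N_def affine_matrix_def T_def
            carrier_matD[OF low_rank_carrier])
      moreover have "N $$ (a', b') - T $$ (a', b') \<in> ?J"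
        using gen_ideal_uminus[OF hJ[OF ab']] by simp
      ultimately show "mat_delete N i j $$ (a, b) \<in> ?R \<and> mat_delete T i j $$ (a, b) \<in> ?R \<and>
          mat_delete N i j $$ (a, b) - mat_delete T i j $$ (a, b) \<in> ?J"
        using NR[OF ab'] TR[OF ab'] by simp
    qed (auto simp: adjoin_ring_1 adjoin_ring_mult gen_ideal_0 gen_ideal_add gen_ideal_uminus gen_ideal_mult)
    moreover have "det (mat_delete T i j) = 0"
    proof -
      have "(- 1) ^ (i + j) * cofactor T i j = det (mat_delete T i j)"
        by (simp add: cofactor_def flip: mult.assoc power_mult_distrib)
      moreover have "cofactor T i j = 0" unfolding T_def by (rule cofactor_low_rank[OF m ij])
      ultimately show ?thesis by simp
    qed
    ultimately have "det (mat_delete ?L i j) \<in> I" by (simp add: I_def N')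
    then show ?thesis unfolding cofactor_def by (rule is_idealD(3)[OF I])
  qed
  have "codim (Sing (det ?L)) \<le> enat 4"
    using cof m P(2) by (intro codim_Sing_le[OF P(1) _ _ P(3)] subsetD[OF P(2)] det_affine_singular[OF I]) auto
  then show ?thesis by (simp add: numeral_eq_enat)
qed

section \<open>Corank one\<close>

text \<open>A maximal independent subfamily \<open>V\<close> is built one index at a time together
  with dual vectors \<open>\<xi>\<close>. The dual vectors record independence in a form that can be
  paired with relations.\<close>

lemma dual_family:
  fixes w :: "'i \<Rightarrow> 'e \<Rightarrow> 'k::field"
  assumes E: "finite E" and "finite S"
  shows "\<exists>V\<subseteq>S. \<exists>\<xi>. (\<forall>u\<in>V. \<forall>v\<in>V. (\<Sum>e\<in>E. w u e * \<xi> v e) = (if u = v then 1 else 0)) \<and>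
     (\<forall>v\<in>S. \<exists>\<gamma>. \<forall>e\<in>E. w v e = (\<Sum>u\<in>V. \<gamma> u * w u e))"
  using assms(2)
proof (induction S rule: finite_induct)
  case empty
  then show ?case by auto
next
  case (insert z S)
  then obtain V \<xi> where V: "V \<subseteq> S"
    and dual': "\<forall>u\<in>V. \<forall>v\<in>V. (\<Sum>e\<in>E. w u e * \<xi> v e) = (if u = v then 1 else 0)"
    and span': "\<forall>v\<in>S. \<exists>\<gamma>. \<forall>e\<in>E. w v e = (\<Sum>u\<in>V. \<gamma> u * w u e)"
    by (elim exE conjE) (rule that)
  note dual = dual'[rule_format] and span = span'[rule_format]
  have finV: "finite V" using V insert.hyps(1) finite_subset by blast
  \<comment> \<open>If \<open>w z\<close> is a combination of the \<open>w u\<close> with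
    \<open>u \<in> V\<close>, pairing with \<open>\<xi> u\<close> shows that its coefficients are
    these.\<close>
  define c where "c u = (\<Sum>e\<in>E. w z e * \<xi> u e)" for u
  show ?case
  proof (cases "\<forall>e\<in>E. w z e = (\<Sum>u\<in>V. c u * w u e)")
    case True
    have "\<forall>v\<in>insert z S. \<exists>\<gamma>. \<forall>e\<in>E. w v e = (\<Sum>u\<in>V. \<gamma> u * w u e)"
      using True span by blast
    moreover have "V \<subseteq> insert z S" using V by blast
    ultimately show ?thesis using dual by (intro exI[of _ V] conjI exI[of _ \<xi>]) auto
  next
    case False
    then obtain e0 where e0: "e0 \<in> E" "w z e0 \<noteq> (\<Sum>u\<in>V. c u * w u e0)" by blast
    define \<rho> where "\<rho> = w z e0 - (\<Sum>u\<in>V. c u * w u e0)"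
    have \<rho>: "\<rho> \<noteq> 0" using e0 by (simp add: \<rho>_def)
    \<comment> \<open>The coordinate functional at \<open>e0\<close>, corrected by the old dual
      vectors so that it kills the \<open>w u\<close> with \<open>u \<in> V\<close>; division by the
      residue \<open>\<rho>\<close> makes its pairing with \<open>w z\<close> equal to 1.\<close>
    define \<mu> where "\<mu> e = ((if e = e0 then 1 else 0) - (\<Sum>u\<in>V. w u e0 * \<xi> u e)) / \<rho>" for e
    have pair: "(\<Sum>e\<in>E. x e * \<mu> e) = (x e0 - (\<Sum>u\<in>V. w u e0 * (\<Sum>e\<in>E. x e * \<xi> u e))) / \<rho>" for x
    proof -
      have "(\<Sum>e\<in>E. x e * \<mu> e) = (\<Sum>e\<in>E. x e * (if e = e0 then 1 else 0) - x e * (\<Sum>u\<in>V. w u e0 * \<xi> u e)) / \<rho>"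
        by (simp add: \<mu>_def sum_divide_distrib right_diff_distrib)
      also have "(\<Sum>e\<in>E. x e * (if e = e0 then 1 else 0) - x e * (\<Sum>u\<in>V. w u e0 * \<xi> u e)) =
          (\<Sum>e\<in>E. if e = e0 then x e else 0) - (\<Sum>e\<in>E. \<Sum>u\<in>V. w u e0 * (x e * \<xi> u e))"
        unfolding sum_subtractf by (intro arg_cong2[of _ _ _ _ "(-)"] sum.cong) (auto simp: sum_distrib_left mult_ac)
      also have "(\<Sum>e\<in>E. \<Sum>u\<in>V. w u e0 * (x e * \<xi> u e)) = (\<Sum>u\<in>V. w u e0 * (\<Sum>e\<in>E. x e * \<xi> u e))"
        by (subst sum.swap) (simp add: sum_distrib_left)
      finally show ?thesis using e0(1) E by simp
    qed
    have \<mu>V: "(\<Sum>e\<in>E. w u e * \<mu> e) = 0" if u: "u \<in> V" for u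
    proof -
      have "(\<Sum>v\<in>V. w v e0 * (\<Sum>e\<in>E. w u e * \<xi> v e)) = (\<Sum>v\<in>V. if v = u then w v e0 else 0)"
        using dual[OF u] by (intro sum.cong) auto
      then show ?thesis using u finV by (simp add: pair)
    qed
    have \<mu>z: "(\<Sum>e\<in>E. w z e * \<mu> e) = 1"
      unfolding pair using \<rho> by (simp add: \<rho>_def c_def mult.commute)
    \<comment> \<open>The old dual vectors are corrected by multiples of \<open>\<mu>\<close> so
      that they pair to 0 with \<open>w z\<close>.\<close>
    define \<xi>' where "\<xi>' v e = (if v = z then \<mu> e else \<xi> v e - c v * \<mu> e)" for v e
    have zV: "z \<notin> V" using V insert.hyps by blast
    have pair': "(\<Sum>e\<in>E. x e * \<xi>' v e) = (\<Sum>e\<in>E. x e * \<xi> v e) - c v * (\<Sum>e\<in>E. x e * \<mu> e)" if "v \<in> V" for x v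
    proof -
      have "v \<noteq> z" using that zV by blast
      then show ?thesis by (simp add: \<xi>'_def right_diff_distrib sum_subtractf sum_distrib_left mult_ac)
    qed
    have pairz: "(\<Sum>e\<in>E. x e * \<xi>' z e) = (\<Sum>e\<in>E. x e * \<mu> e)" for x
      by (simp add: \<xi>'_def)
    have "(\<Sum>e\<in>E. w u e * \<xi>' v e) = (if u = v then 1 else 0)"
      if "u \<in> insert z V" "v \<in> insert z V" for u v
    proof (cases "v = z")
      case True
      then show ?thesis using that(1) \<mu>V \<mu>z pairz by auto
    next
      case False
      then have v: "v \<in> V" using that by blast
      show ?thesis
      proof (cases "u = z")
        case True
        then show ?thesis using False \<mu>z pair'[OF v, of "w z"] by (simp add: c_def)
      next
        case u: False
        then show ?thesis using that(1) v dual[of u v] \<mu>V[of u] pair'[OF v, of "w u"] by simp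
      qed
    qed
    moreover have "\<exists>\<gamma>. \<forall>e\<in>E. w v e = (\<Sum>u\<in>insert z V. \<gamma> u * w u e)" if v: "v \<in> insert z S" for v
    proof (cases "v = z")
      case True
      have "(\<Sum>u\<in>insert z V. (if u = z then 1 else 0) * w u e) = w z e" for e
        using finV zV by (simp add: sum.neutral)
      then show ?thesis using True by (intro exI[of _ "\<lambda>u. if u = z then 1 else 0"]) simp
    next
      case False
      then obtain \<gamma> where \<gamma>: "\<forall>e\<in>E. w v e = (\<Sum>u\<in>V. \<gamma> u * w u e)" using span v by blast
      have "(\<Sum>u\<in>insert z V. (if u = z then 0 else \<gamma> u) * w u e) = (\<Sum>u\<in>V. \<gamma> u * w u e)" for e
        using finV zV by (auto intro!: sum.cong)
      then show ?thesis using \<gamma> by (intro exI[of _ "\<lambda>u. if u = z then 0 else \<gamma> u"]) simp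
    qed
    moreover have "insert z V \<subseteq> insert z S" using V by blast
    ultimately show ?thesis by (intro exI[of _ "insert z V"] conjI exI[of _ \<xi>']) blast+
  qed
qed

text \<open>Vectors encoded as polynomials, so that \<open>nontrivial_relation\<close> also yields
  linear relations between vectors.\<close>

definition linear_form :: "'e set \<Rightarrow> ('e \<Rightarrow> 'k) \<Rightarrow> ('e, 'k::comm_ring_1) mpol" where
  "linear_form E f = (\<Sum>e\<in>E. Const (f e) * Var e)"

lemma lookup_linear_form:
  assumes "finite E" "e \<in> E"
  shows "Poly_Mapping.lookup (linear_form E f) (Poly_Mapping.single e 1) = f e"
proof -
  have single_eq: "Poly_Mapping.single e' (1 :: nat) = Poly_Mapping.single e 1 \<longleftrightarrow> e' = e" for e'
    by (metis lookup_single_eq lookup_single_not_eq zero_neq_one)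
  have "Poly_Mapping.lookup (linear_form E f) (Poly_Mapping.single e 1) = (\<Sum>e'\<in>E. if e' = e then f e' else 0)"
    unfolding linear_form_def lookup_sum lookup_Const_mult Var_def
    by (intro sum.cong) (auto simp: lookup_single when_def single_eq[unfolded One_nat_def])
  then show ?thesis using assms by simp
qed

lemma linear_relation:
  fixes x :: "'i \<Rightarrow> 'e \<Rightarrow> 'k::field"
  assumes "finite E" "finite Y" "card E < card Y"
  shows "\<exists>c. (\<exists>i\<in>Y. c i \<noteq> 0) \<and> (\<forall>e\<in>E. (\<Sum>i\<in>Y. c i * x i e) = 0)"
proof -
  have "card (Var ` E :: ('e, 'k) mpol set) < card Y" using assms card_image_le[of E Var] by (meson le_less_trans)
  then have "\<exists>c. (\<exists>i\<in>Y. c i \<noteq> 0) \<and> (\<Sum>i\<in>Y. Const (c i) * linear_form E (x i)) \<in> {0}"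
    using assms
    by (intro nontrivial_relation[of "Var ` E"] mp.subspace_0)
      (auto simp: linear_form_def intro!: mp.span_sum mp.span_scale intro: mp.span_base)
  then obtain c where c: "\<exists>i\<in>Y. c i \<noteq> 0" "(\<Sum>i\<in>Y. Const (c i) * linear_form E (x i)) = 0" by blast
  have "(\<Sum>i\<in>Y. c i * x i e) = 0" if "e \<in> E" for e
    using arg_cong[OF c(2), of "\<lambda>p. Poly_Mapping.lookup p (Poly_Mapping.single e 1)"] that assms(1)
    by (simp add: lookup_sum lookup_Const_mult lookup_linear_form[unfolded One_nat_def])
  then show ?thesis using c(1) by blast
qed

text \<open>The vectors \<open>w v\<close> with their two halves swapped and the dual vectors
  \<open>\<xi> v\<close> are jointly independent in dimension \<open>2 * card K\<close>. Pairing a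
  relation with \<open>w u\<close> kills the swapped vectors by isotropy and isolates the
  coefficient of \<open>\<xi> u\<close>; pairing what remains, unswapped, with
  \<open>\<xi> u\<close> isolates the other coefficient.\<close>

lemma isotropic_dual_card:
  fixes w :: "'i \<Rightarrow> 'j \<times> bool \<Rightarrow> 'k::field"
  assumes "finite K" "finite V"
    and dual: "\<And>u v. u \<in> V \<Longrightarrow> v \<in> V \<Longrightarrow> (\<Sum>e\<in>K \<times> UNIV. w u e * \<xi> v e) = (if u = v then 1 else 0)"
    and iso: "\<And>u v. u \<in> V \<Longrightarrow> v \<in> V \<Longrightarrow> (\<Sum>(k, s)\<in>K \<times> UNIV. w u (k, s) * w v (k, \<not> s)) = 0"
  shows "card V \<le> card K"
proof (rule ccontr)
  assume "\<not> card V \<le> card K"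
  let ?E = "K \<times> (UNIV :: bool set)"
  let ?Y = "V \<times> (UNIV :: bool set)"
  define x where "x y e = (if snd y then w (fst y) (fst e, \<not> snd e) else \<xi> (fst y) e)" for y e
  have fin: "finite ?E" "finite ?Y" using assms(1,2) by auto
  have "card ?E < card ?Y" using \<open>\<not> card V \<le> card K\<close> by (simp add: card_cartesian_product)
  from linear_relation[OF fin this, of x] obtain c where c: "\<exists>y\<in>?Y. c y \<noteq> 0"
    "\<forall>e\<in>?E. (\<Sum>y\<in>?Y. c y * x y e) = 0" by blast
  have rel: "(\<Sum>v\<in>V. c (v, True) * w v (fst e, \<not> snd e)) + (\<Sum>v\<in>V. c (v, False) * \<xi> v e) = 0"
    if "e \<in> ?E" for e
  proof -
    have "(\<Sum>y\<in>?Y. c y * x y e) = (\<Sum>v\<in>V. \<Sum>s\<in>UNIV. c (v, s) * x (v, s) e)"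
      by (simp add: sum.cartesian_product)
    also have "\<dots> = (\<Sum>v\<in>V. c (v, True) * w v (fst e, \<not> snd e) + c (v, False) * \<xi> v e)"
      by (intro sum.cong refl) (simp add: UNIV_bool x_def)
    finally show ?thesis using c(2) that by (simp add: sum.distrib)
  qed
  have F: "c (u, False) = 0" if u: "u \<in> V" for u
  proof -
    have "0 = (\<Sum>e\<in>?E. w u e * ((\<Sum>v\<in>V. c (v, True) * w v (fst e, \<not> snd e)) + (\<Sum>v\<in>V. c (v, False) * \<xi> v e)))"
      using rel by (intro sum.neutral[symmetric]) auto
    also have "\<dots> = (\<Sum>e\<in>?E. \<Sum>v\<in>V. c (v, True) * (w u e * w v (fst e, \<not> snd e))) +
        (\<Sum>e\<in>?E. \<Sum>v\<in>V. c (v, False) * (w u e * \<xi> v e))"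
      by (simp add: distrib_left sum.distrib sum_distrib_left mult_ac)
    also have "\<dots> = (\<Sum>v\<in>V. c (v, True) * (\<Sum>e\<in>?E. w u e * w v (fst e, \<not> snd e))) +
        (\<Sum>v\<in>V. c (v, False) * (\<Sum>e\<in>?E. w u e * \<xi> v e))"
      unfolding sum_distrib_left by (intro arg_cong2[of _ _ _ _ "(+)"] sum.swap)
    also have "(\<Sum>v\<in>V. c (v, True) * (\<Sum>e\<in>?E. w u e * w v (fst e, \<not> snd e))) = 0"
      using iso[OF u] by (intro sum.neutral) (auto simp: case_prod_unfold)
    also have "(\<Sum>v\<in>V. c (v, False) * (\<Sum>e\<in>?E. w u e * \<xi> v e)) = (\<Sum>v\<in>V. if v = u then c (u, False) else 0)"
      using dual[OF u] by (intro sum.cong) auto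
    finally show ?thesis using u assms(2) by simp
  qed
  have T: "c (u, True) = 0" if u: "u \<in> V" for u
  proof -
    have swap: "(\<Sum>v\<in>V. c (v, True) * w v e) = 0" if e: "e \<in> ?E" for e
      using rel[of "(fst e, \<not> snd e)"] e F by auto
    have "0 = (\<Sum>e\<in>?E. (\<Sum>v\<in>V. c (v, True) * w v e) * \<xi> u e)"
      using swap by (intro sum.neutral[symmetric]) auto
    also have "\<dots> = (\<Sum>v\<in>V. c (v, True) * (\<Sum>e\<in>?E. w v e * \<xi> u e))"
      unfolding sum_distrib_right sum_distrib_left mult.assoc by (rule sum.swap)
    also have "\<dots> = (\<Sum>v\<in>V. if v = u then c (u, True) else 0)"
      using dual[OF _ u] by (intro sum.cong) auto
    finally show ?thesis using u assms(2) by simp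
  qed
  obtain u s where "u \<in> V" "c (u, s) \<noteq> 0" using c(1) by auto
  then show False using F[of u] T[of u] by (cases s) auto
qed

text \<open>In the expansion along row 0 a summand with \<open>j > 0\<close> gains weight 1 from the
  row and weight \<open>k\<close> from the column left in its minor; the cofactor at the corner is 1
  up to positive weight. \<open>k = 1\<close> isolates the linear part, and \<open>k = 2\<close>,
  after column operations, the quadratic part.\<close>

lemma det_near_identity:
  fixes M :: "('x, 'k::comm_ring_1) mpol mat"
  assumes M: "M \<in> carrier_mat m m" "0 < m"
    and col: "\<And>i. i < m \<Longrightarrow> M $$ (i, 0) \<in> wfilt \<omega> k"
    and row: "\<And>j. 0 < j \<Longrightarrow> j < m \<Longrightarrow> M $$ (0, j) \<in> wfilt \<omega> 1"
    and rest: "\<And>i j. 0 < i \<Longrightarrow> i < m \<Longrightarrow> 0 < j \<Longrightarrow> j < m \<Longrightarrow>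
       M $$ (i, j) - (if i = j then 1 else 0) \<in> wfilt \<omega> 1"
  shows "det M - M $$ (0, 0) \<in> wfilt \<omega> (Suc k)"
proof -
  have "M $$ (0, j) * cofactor M 0 j \<in> wfilt \<omega> (1 + k)" if j: "j \<in> {..<m} - {0}" for j
  proof -
    have "mat_delete M 0 j $$ (i, 0) \<in> wfilt \<omega> k" if "i < m - 1" for i
      using that M col[of "Suc i"] j by (auto simp: mat_delete_def)
    moreover have "0 < m - 1" using j by auto
    ultimately have "det (mat_delete M 0 j) \<in> wfilt \<omega> k"
      unfolding laplace_expansion_column[OF mat_delete_carrier[OF M(1)] \<open>0 < m - 1\<close>]
      by (intro wfilt_sum) (simp add: wfilt_mult_left mult.commute)
    then have "cofactor M 0 j \<in> wfilt \<omega> k" unfolding cofactor_def by (rule wfilt_mult_left)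
    then show ?thesis using row[of j] j by (intro wfilt_mult) auto
  qed
  then have 1: "(\<Sum>j\<in>{..<m} - {0}. M $$ (0, j) * cofactor M 0 j) \<in> wfilt \<omega> (Suc k)"
    by (intro wfilt_sum) simp
  have "det (mat_delete M 0 0) - det (1\<^sub>m (m - 1)) \<in> wfilt \<omega> 1"
  proof (rule det_congruent[of _ "m - 1" _ UNIV])
    fix i j assume "i < m - 1" "j < m - 1"
    then show "mat_delete M 0 0 $$ (i, j) \<in> UNIV \<and> 1\<^sub>m (m - 1) $$ (i, j) \<in> UNIV \<and>
        mat_delete M 0 0 $$ (i, j) - 1\<^sub>m (m - 1) $$ (i, j) \<in> wfilt \<omega> 1"
      using rest[of "Suc i" "Suc j"] M by (simp add: mat_delete_def)
  qed (use mat_delete_carrier[OF M(1)] in \<open>auto intro: wfilt_add wfilt_mult_left\<close>)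
  then have "M $$ (0, 0) * (cofactor M 0 0 - 1) \<in> wfilt \<omega> (k + 1)"
    using col[OF M(2)] by (intro wfilt_mult) (auto simp: cofactor_def)
  moreover have "det M - M $$ (0, 0) = M $$ (0, 0) * (cofactor M 0 0 - 1) +
      (\<Sum>j\<in>{..<m} - {0}. M $$ (0, j) * cofactor M 0 j)"
    unfolding laplace_expansion_row[OF M] using M(2)
    by (subst sum.remove[of _ 0]) (auto simp: algebra_simps)
  ultimately show ?thesis using 1 by (simp add: wfilt_add)
qed

text \<open>Clearing the first column turns the upper left entry into minus the quadratic part of the
  determinant.\<close>

lemma det_quadratic_part:
  fixes M :: "('x, 'k::comm_ring_1) mpol mat"
  assumes M: "M \<in> carrier_mat m m" "0 < m" and M00: "M $$ (0, 0) = 0"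
    and col: "\<And>i. i < m \<Longrightarrow> M $$ (i, 0) \<in> wfilt \<omega> 1"
    and row: "\<And>j. j < m \<Longrightarrow> M $$ (0, j) \<in> wfilt \<omega> 1"
    and rest: "\<And>i j. 0 < i \<Longrightarrow> i < m \<Longrightarrow> 0 < j \<Longrightarrow> j < m \<Longrightarrow>
       M $$ (i, j) - (if i = j then 1 else 0) \<in> wfilt \<omega> 1"
  shows "det M + (\<Sum>k = 1..<m. M $$ (0, k) * M $$ (k, 0)) \<in> wfilt \<omega> 3"
proof -
  \<comment> \<open>\<open>C\<close> subtracts from column 0 the other columns with coefficients
    \<open>M $$ (i, 0)\<close>. Below row 0 these columns are unit vectors up to positive weight, so
    column 0 rises from weight 1 to weight 2 while the determinant is unchanged.\<close>
  define C where "C = mat m m (\<lambda>(i, j). if i = j then 1 else if j = 0 then - M $$ (i, 0) else 0)"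
  have C: "C \<in> carrier_mat m m" by (simp add: C_def)
  have "det C = prod_list (diag_mat C)"
    by (rule det_lower_triangular[OF _ C]) (auto simp: C_def)
  also have "diag_mat C = map (\<lambda>_. 1) [0..<m]"
    unfolding diag_mat_def by (auto simp: C_def)
  also have "prod_list (map (\<lambda>_. 1 :: ('x, 'k) mpol) [0..<m]) = 1" by (induction m) auto
  finally have det: "det (M * C) = det M" using det_mult[OF M(1) C] by simp
  have MC: "M * C \<in> carrier_mat m m" using M(1) C by auto
  have ge: "(M * C) $$ (i, j) = M $$ (i, j)" if "i < m" "0 < j" "j < m" for i j
  proof -
    have "(M * C) $$ (i, j) = (\<Sum>k = 0..<m. M $$ (i, k) * (if k = j then 1 else 0))"
      using M C that by (auto simp: C_def scalar_prod_def intro!: sum.cong)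
    then show ?thesis using that(3) by (simp only: sum_index_if_eq)
  qed
  have 0: "(M * C) $$ (i, 0) = M $$ (i, 0) - (\<Sum>k = 1..<m. M $$ (i, k) * M $$ (k, 0))" if "i < m" for i
  proof -
    have "(M * C) $$ (i, 0) = (\<Sum>k = 0..<m. M $$ (i, k) * (if k = 0 then 1 else - M $$ (k, 0)))"
      using M C that by (auto simp: C_def scalar_prod_def intro!: sum.cong)
    also have "\<dots> = M $$ (i, 0) + (\<Sum>k = 1..<m. M $$ (i, k) * (if k = 0 then 1 else - M $$ (k, 0)))"
      using M(2) by (subst sum.atLeast_Suc_lessThan) auto
    also have "(\<Sum>k = 1..<m. M $$ (i, k) * (if k = 0 then 1 else - M $$ (k, 0))) = - (\<Sum>k = 1..<m. M $$ (i, k) * M $$ (k, 0))"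
      unfolding sum_negf[symmetric] by (intro sum.cong) auto
    finally show ?thesis by simp
  qed
  have col2: "(M * C) $$ (i, 0) \<in> wfilt \<omega> 2" if i: "i < m" for i
  proof (cases "i = 0")
    case True
    have "M $$ (0, k) * M $$ (k, 0) \<in> wfilt \<omega> (1 + 1)" if "k < m" for k
      by (intro wfilt_mult row col that)
    then have "(\<Sum>k = 1..<m. M $$ (0, k) * M $$ (k, 0)) \<in> wfilt \<omega> 2"
      by (intro wfilt_sum) (simp add: numeral_2_eq_2)
    then show ?thesis using True 0[OF i] M00 by simp
  next
    case False
    let ?E = "\<lambda>k. M $$ (i, k) - (if i = k then 1 else 0)"
    have "?E k * M $$ (k, 0) \<in> wfilt \<omega> (1 + 1)" if "k \<in> {1..<m}" for k
      using that False i by (intro wfilt_mult rest col) auto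
    then have "(\<Sum>k = 1..<m. ?E k * M $$ (k, 0)) \<in> wfilt \<omega> 2"
      by (intro wfilt_sum) (simp add: numeral_2_eq_2)
    moreover have "(\<Sum>k = 1..<m. ?E k * M $$ (k, 0)) =
        (\<Sum>k = 1..<m. M $$ (i, k) * M $$ (k, 0)) - (\<Sum>k = 1..<m. if k = i then M $$ (i, 0) else 0)"
      unfolding sum_subtractf[symmetric] by (intro sum.cong) (auto simp: left_diff_distrib)
    moreover have "(\<Sum>k = 1..<m. if k = i then M $$ (i, 0) else 0) = M $$ (i, 0)"
      using False i by simp
    ultimately have "- (M * C) $$ (i, 0) \<in> wfilt \<omega> 2" by (simp add: 0[OF i])
    then show ?thesis by simp
  qed
  have "det (M * C) - (M * C) $$ (0, 0) \<in> wfilt \<omega> (Suc 2)"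
    using M(2) row rest by (intro det_near_identity[OF MC M(2) col2]) (auto simp: ge)
  then show ?thesis using M00 0[OF M(2)] by (simp add: det numeral_3_eq_3 numeral_2_eq_2)
qed

lemma wfilt_weight_le_zero:
  assumes "p \<in> wfilt w (Suc t)" "p \<in> weight_le w t"
  shows "p = 0"
proof -
  have "e \<notin> Poly_Mapping.keys p" for e
    using assms unfolding wfilt_def weight_le_def by (metis (mono_tags, lifting) mem_Collect_eq not_less_eq_eq)
  then show ?thesis by (metis ex_in_conv in_keys_iff lookup_zero poly_mapping_eqI)
qed

lemma weight_le_sum: "(\<And>x. x \<in> A \<Longrightarrow> f x \<in> weight_le w t) \<Longrightarrow> sum f A \<in> weight_le w t"
  using keys_mpol_sum[of f A] by (fastforce simp: weight_le_def)

lemma homogeneous_in_wfilt: "homogeneous_of_degree d f \<Longrightarrow> f \<in> wfilt (\<lambda>_. 1) d"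
  by (auto simp: homogeneous_of_degree_def wfilt_def wt_superset[of UNIV])

lemma Const_eq_0_iff: "Const c = 0 \<longleftrightarrow> c = 0"
  by (metis Const_0 Const_def lookup_single_eq lookup_zero)

lemma codim_Sing_le_corank_1:
  fixes B :: "'n::finite \<Rightarrow> 'k::field mat"
  assumes m: "0 < m" and A: "A = mat m m (\<lambda>(i, j). if i = j \<and> 0 < i then 1 else 0)"
    and hom: "homogeneous_of_degree d (det (affine_matrix m A B))" "2 < d"
  shows "codim (Sing (det (affine_matrix m A B))) \<le> enat (m - 1)"
proof -
  let ?M = "affine_matrix m A B"
  let ?w = "\<lambda>_ :: 'n. 1 :: nat"
  have M: "?M \<in> carrier_mat m m" by simp
  have lin: "?M $$ (i, j) - Const (A $$ (i, j)) \<in> wfilt ?w 1 \<inter> weight_le ?w 1" if "i < m" "j < m" for i j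
  proof -
    have "Const (B v $$ (i, j)) * Var v \<in> wfilt ?w 1" for v by (intro wfilt_mult_left Var_in_wfilt) simp
    moreover have "Const (B v $$ (i, j)) * Var v \<in> weight_le ?w (0 + 1)" for v
      by (intro weight_le_mult) (auto simp: weight_le_def Const_def Var_def)
    ultimately show ?thesis
      by (auto simp: affine_matrix_index[OF that] intro!: wfilt_sum weight_le_sum)
  qed
  have edge: "?M $$ (0, j) \<in> wfilt ?w 1 \<inter> weight_le ?w 1" "?M $$ (j, 0) \<in> wfilt ?w 1 \<inter> weight_le ?w 1"
    if "j < m" for j
  proof -
    have "A $$ (0, j) = 0" "A $$ (j, 0) = 0" using m that by (auto simp: A)
    then show "?M $$ (0, j) \<in> wfilt ?w 1 \<inter> weight_le ?w 1" "?M $$ (j, 0) \<in> wfilt ?w 1 \<inter> weight_le ?w 1"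
      using lin[OF m that] lin[OF that m] by simp_all
  qed
  have rest: "?M $$ (i, j) - (if i = j then 1 else 0) \<in> wfilt ?w 1" if "0 < i" "i < m" "0 < j" "j < m" for i j
    using lin[OF that(2,4)] that by (auto simp: A split: if_splits)
  have f3: "det ?M \<in> wfilt ?w 3"
    using homogeneous_in_wfilt[OF hom(1)] wfilt_antimono[of 3 d ?w] hom(2) by auto
  have "det ?M - ?M $$ (0, 0) \<in> wfilt ?w (Suc 1)"
    using edge rest by (intro det_near_identity[OF M m]) auto
  moreover have "det ?M \<in> wfilt ?w (Suc 1)" using f3 wfilt_antimono[of "Suc 1" 3 ?w] by auto
  ultimately have "?M $$ (0, 0) \<in> wfilt ?w (Suc 1)" using wfilt_diff by fastforce
  then have M00: "?M $$ (0, 0) = 0" using edge(1)[OF m] by (intro wfilt_weight_le_zero[of _ ?w 1]) auto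
  have B00: "B v $$ (0, 0) = 0" for v
  proof -
    have "Const (B v $$ (0, 0)) = (0 :: ('n, 'k) mpol)"
      using partial_deriv_affine_matrix[OF m m, of v A B] M00 by simp
    then show ?thesis by (simp only: Const_eq_0_iff)
  qed
  let ?q = "\<Sum>k = 1..<m. ?M $$ (0, k) * ?M $$ (k, 0)"
  have "det ?M + ?q \<in> wfilt ?w 3"
    using edge rest by (intro det_quadratic_part[OF M m M00]) auto
  then have "(det ?M + ?q) - det ?M \<in> wfilt ?w 3" using f3 by (rule wfilt_diff)
  moreover have "?M $$ (0, k) * ?M $$ (k, 0) \<in> weight_le ?w (1 + 1)" if "k < m" for k
    using edge[OF that] by (intro weight_le_mult) auto
  then have "?q \<in> weight_le ?w 2" by (intro weight_le_sum) (simp add: numeral_2_eq_2)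
  ultimately have q0: "?q = 0"
    by (intro wfilt_weight_le_zero[of _ ?w 2]) (simp_all add: numeral_3_eq_3 numeral_2_eq_2)
  let ?b = "\<lambda>v k. B v $$ (0, k)" and ?c = "\<lambda>v k. B v $$ (k, 0)"
  \<comment> \<open>Differentiating the quadratic relation twice polarises it, without a division by
    2, so the argument is valid in every characteristic.\<close>
  have iso: "(\<Sum>k = 1..<m. ?b u k * ?c v k + ?c u k * ?b v k) = 0" for u v
  proof -
    have "partial_deriv v (partial_deriv u ?q) = (\<Sum>k = 1..<m. Const (?b u k * ?c v k + ?c u k * ?b v k))"
      unfolding partial_deriv_sum
      by (intro sum.cong refl)
        (simp add: partial_deriv_mult partial_deriv_add partial_deriv_affine_matrix m Const_add Const_mult mult.commute)
    then have "Const (\<Sum>k = 1..<m. ?b u k * ?c v k + ?c u k * ?b v k) = (0 :: ('n, 'k) mpol)"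
      unfolding q0 by (simp add: Const_sum)
    then show ?thesis by (simp only: Const_eq_0_iff)
  qed
  \<comment> \<open>\<open>w v\<close> collects the coefficients of the variable \<open>v\<close> in
    row 0 (\<open>True\<close>) and column 0 (\<open>False\<close>); swapping the two halves gives
    the hyperbolic form.\<close>
  define w where "w v e = (if snd e then ?b v (fst e) else ?c v (fst e))" for v and e :: "nat \<times> bool"
  let ?E = "{1..<m} \<times> (UNIV :: bool set)"
  have "finite ?E" by simp
  from dual_family[OF this finite_UNIV, of w] obtain V \<xi> where
    dual: "\<forall>u\<in>V. \<forall>v\<in>V. (\<Sum>e\<in>?E. w u e * \<xi> v e) = (if u = v then 1 else 0)"
    and span: "\<forall>v. \<exists>\<gamma>. \<forall>e\<in>?E. w v e = (\<Sum>u\<in>V. \<gamma> u * w u e)" by auto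
  have "card V \<le> card {1..<m}"
  proof (rule isotropic_dual_card[of _ _ w \<xi>])
    show "(\<Sum>(k, s)\<in>?E. w u (k, s) * w v (k, \<not> s)) = 0" for u v
      using iso[of u v] by (simp add: w_def UNIV_bool add.commute flip: sum.cartesian_product)
  qed (use dual in auto)
  then have cV: "card V \<le> m - 1" by simp
  from span obtain \<gamma> where \<gamma>: "\<And>v e. e \<in> ?E \<Longrightarrow> w v e = (\<Sum>u\<in>V. \<gamma> v u * w u e)" by metis
  \<comment> \<open>Row rank equals column rank: the \<open>w u\<close> with
    \<open>u \<in> V\<close> span all coefficient vectors, so the \<open>card V\<close> forms
    \<open>y u\<close> generate every entry of row 0 and column 0 away from the corner.\<close>
  define y :: "'n \<Rightarrow> ('n, 'k) mpol" where "y u = (\<Sum>v\<in>UNIV. Const (\<gamma> v u) * Var v)" for u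
  have form: "(\<Sum>v\<in>UNIV. Const (w v e) * Var v) = (\<Sum>u\<in>V. y u * Const (w u e))" if "e \<in> ?E" for e
  proof -
    have "(\<Sum>v\<in>UNIV. Const (w v e) * Var v) = (\<Sum>v\<in>UNIV. Const (\<Sum>u\<in>V. \<gamma> v u * w u e) * Var v)"
      by (intro sum.cong refl arg_cong2[of _ _ _ _ "(*)"] arg_cong[of _ _ Const] \<gamma>[OF that])
    also have "\<dots> = (\<Sum>v\<in>UNIV. \<Sum>u\<in>V. Const (\<gamma> v u) * Var v * Const (w u e))"
      by (simp add: Const_sum Const_mult sum_distrib_left mult_ac)
    also have "\<dots> = (\<Sum>u\<in>V. y u * Const (w u e))"
      unfolding y_def sum_distrib_right by (rule sum.swap)
    finally show ?thesis .
  qed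
  \<comment> \<open>Here the substitution is the identity and all variables serve as independent
    elements, so the bound is the number \<open>card V\<close> of equations
    \<open>y u\<close>.\<close>
  have "\<exists>P\<in>prime_spectrum. {a. msubst Var a \<in> gen_ideal Var y V} \<subseteq> P \<and> height P \<le> enat (card V)"
  proof (rule exists_prime_height_le[of V "UNIV :: 'n set" Var ?w y Var "\<lambda>v. Poly_Mapping.single v 1"])
    show "y l \<in> wfilt ?w 1" for l
      unfolding y_def by (intro wfilt_sum wfilt_mult_left Var_in_wfilt) simp
    show "Var \<alpha> \<in> adjoin_ring Var y V" for \<alpha> using adjoin_ring.base[of Var "Var \<alpha>"] by simp
    fix e e' :: "'n \<Rightarrow> nat" and \<alpha>
    assume eq: "\<And>v. (\<Sum>\<alpha>\<in>UNIV. e \<alpha> * Poly_Mapping.lookup (Poly_Mapping.single \<alpha> 1) v) =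
        (\<Sum>\<alpha>\<in>UNIV. e' \<alpha> * Poly_Mapping.lookup (Poly_Mapping.single \<alpha> 1) v)"
    have "(\<Sum>\<alpha>\<in>UNIV. f \<alpha> * Poly_Mapping.lookup (Poly_Mapping.single \<alpha> 1) v) = f v" for f :: "'n \<Rightarrow> nat" and v
    proof -
      have "(\<Sum>\<alpha>\<in>UNIV. f \<alpha> * Poly_Mapping.lookup (Poly_Mapping.single \<alpha> 1) v) = (\<Sum>\<alpha>\<in>UNIV. if \<alpha> = v then f \<alpha> else 0)"
        by (intro sum.cong) (auto simp: lookup_single)
      then show ?thesis by simp
    qed
    then show "e \<alpha> = e' \<alpha>" using eq[of \<alpha>] by metis
  qed (auto simp: Var_in_wfilt intro: has_lowest_Var[unfolded One_nat_def])
  then obtain P where P: "P \<in> prime_spectrum" "{a. msubst Var a \<in> gen_ideal Var y V} \<subseteq> P"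
    "height P \<le> enat (card V)" by blast
  have PI: "is_ideal P" using P(1) by (simp add: prime_spectrum_iff)
  have formP: "(\<Sum>v\<in>UNIV. Const (w v e) * Var v) \<in> P" if "e \<in> ?E" for e
  proof (rule subsetD[OF P(2)], intro CollectI)
    have "msubst Var (\<Sum>v\<in>UNIV. Const (w v e) * Var v) = (\<Sum>v\<in>UNIV. Const (w v e) * Var v)"
      by (simp add: msubst_sum msubst_mult)
    then show "msubst Var (\<Sum>v\<in>UNIV. Const (w v e) * Var v) \<in> gen_ideal Var y V"
      unfolding form[OF that] by (simp add: gen_idealI adjoin_ring_Const)
  qed
  have edgeP: "?M $$ (0, k) \<in> P" "?M $$ (k, 0) \<in> P" if "k < m" for k
  proof -
    show "?M $$ (0, k) \<in> P"
      using formP[of "(k, True)"] that m M00 is_idealD(1)[OF PI]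
      by (cases "k = 0") (auto simp: affine_matrix_index A w_def)
    show "?M $$ (k, 0) \<in> P"
      using formP[of "(k, False)"] that m M00 is_idealD(1)[OF PI]
      by (cases "k = 0") (auto simp: affine_matrix_index A w_def)
  qed
  \<comment> \<open>A minor that keeps what is left of row 0 or of column 0 lies in
    \<open>P\<close>. The only other one belongs to the corner, where the entry is identically
    zero.\<close>
  have cof: "cofactor ?M i j \<in> P \<or> A $$ (i, j) = 0 \<and> (\<forall>v. B v $$ (i, j) = 0)" if ij: "i < m" "j < m" for i j
  proof -
    consider "i = 0" "j = 0" | "i \<noteq> 0" | "i = 0" "j \<noteq> 0" by blast
    then show ?thesis
    proof cases
      case 1
      then show ?thesis using m B00 by (simp add: A)
    next
      case 2
      then have m1: "0 < m - 1" using ij by simp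
      have "mat_delete ?M i j $$ (0, l) \<in> P" if "l < m - 1" for l
        using that 2 ij m1 edgeP(1) by (auto simp: mat_delete_def carrier_matD[OF M])
      then have "det (mat_delete ?M i j) \<in> P"
        unfolding laplace_expansion_row[OF mat_delete_carrier[OF M] m1]
        by (intro is_ideal_sum[OF PI] is_idealD(4)[OF PI]) auto
      then show ?thesis by (simp add: cofactor_def is_idealD(3)[OF PI])
    next
      case 3
      then have m1: "0 < m - 1" using ij by simp
      have "mat_delete ?M i j $$ (l, 0) \<in> P" if "l < m - 1" for l
        using that 3 ij m1 edgeP(2) by (auto simp: mat_delete_def carrier_matD[OF M])
      then have "det (mat_delete ?M i j) \<in> P"
        unfolding laplace_expansion_column[OF mat_delete_carrier[OF M] m1]
        by (intro is_ideal_sum[OF PI] is_idealD(4)[OF PI]) auto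
      then show ?thesis by (simp add: cofactor_def is_idealD(3)[OF PI])
    qed
  qed
  have "codim (Sing (det ?M)) \<le> enat (card V)"
    using det_affine_singular[OF PI m cof] by (intro codim_Sing_le[OF P(1) _ _ P(3)]) auto
  also have "\<dots> \<le> enat (m - 1)" using cV by simp
  finally show ?thesis .
qed

section \<open>Normal form of the constant part\<close>

definition mat_equivalent :: "nat \<Rightarrow> 'a::field mat \<Rightarrow> 'a mat \<Rightarrow> bool" where
  "mat_equivalent n A D \<longleftrightarrow> (\<exists>P Q. P \<in> carrier_mat n n \<and> Q \<in> carrier_mat n n \<and> det P \<noteq> 0 \<and> det Q \<noteq> 0 \<and>
     D = P * A * Q)"

lemma mat_equivalentI:
  "P \<in> carrier_mat n n \<Longrightarrow> Q \<in> carrier_mat n n \<Longrightarrow> det P \<noteq> 0 \<Longrightarrow> det Q \<noteq> 0 \<Longrightarrow> D = P * A * Q \<Longrightarrow>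
   mat_equivalent n A D"
  by (auto simp: mat_equivalent_def)

lemma mat_equivalent_refl: "A \<in> carrier_mat n n \<Longrightarrow> mat_equivalent n A A"
  by (rule mat_equivalentI[of "1\<^sub>m n" _ "1\<^sub>m n"]) auto

lemma mat_equivalent_trans:
  assumes A: "A \<in> carrier_mat n n" and "mat_equivalent n A C" "mat_equivalent n C D"
  shows "mat_equivalent n A D"
proof -
  obtain P Q where 1: "P \<in> carrier_mat n n" "Q \<in> carrier_mat n n" "det P \<noteq> 0" "det Q \<noteq> 0" "C = P * A * Q"
    using assms(2) by (auto simp: mat_equivalent_def)
  obtain P' Q' where 2: "P' \<in> carrier_mat n n" "Q' \<in> carrier_mat n n" "det P' \<noteq> 0" "det Q' \<noteq> 0" "D = P' * C * Q'"
    using assms(3) by (auto simp: mat_equivalent_def)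
  have "P' * (P * A * Q) = P' * P * A * Q"
    using A 1(1,2) 2(1) assoc_mult_mat[of P' n n "P * A" n Q n] assoc_mult_mat[of P' n n P n A n] by simp
  then have "D = P' * P * A * Q * Q'" using 1(5) 2(5) by simp
  also have "\<dots> = P' * P * A * (Q * Q')"
    using A 1(1,2) 2(1,2) by (intro assoc_mult_mat[of _ n n _ n _ n]) auto
  finally show ?thesis
    using 1 2 by (intro mat_equivalentI[of "P' * P" _ "Q * Q'"]) (auto simp: det_mult[of _ n])
qed

lemma mat_equivalent_swaprows:
  assumes A: "A \<in> carrier_mat n n" and "k < n" "l < n"
  shows "mat_equivalent n A (swaprows k l A)"
proof (cases "k = l")
  case True
  then have "swaprows k l A = A" by (intro eq_matI) auto
  then show ?thesis using mat_equivalent_refl[OF A] by simp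
next
  case False
  then show ?thesis using assms swaprows_mat[OF assms] det_swaprows_mat[of k n l, where 'a = 'a]
    by (intro mat_equivalentI[of "swaprows_mat n k l" _ "1\<^sub>m n"]) auto
qed

lemma mat_equivalent_swapcols:
  assumes A: "A \<in> carrier_mat n n" and "k < n" "l < n"
  shows "mat_equivalent n A (swapcols k l A)"
proof (cases "k = l")
  case True
  then have "swapcols k l A = A" by (intro eq_matI) auto
  then show ?thesis using mat_equivalent_refl[OF A] by simp
next
  case False
  then show ?thesis using assms swapcols_mat[OF assms] det_swaprows_mat[of k n l, where 'a = 'a]
    by (intro mat_equivalentI[of "1\<^sub>m n" _ "swaprows_mat n k l"]) auto
qed

abbreviation border :: "'a::field mat \<Rightarrow> nat \<Rightarrow> 'a mat" where
  "border A n \<equiv> four_block_mat A (0\<^sub>m n 1) (0\<^sub>m 1 n) (1\<^sub>m 1)"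

lemma border_mult:
  assumes "A \<in> carrier_mat n n" "C \<in> carrier_mat n n"
  shows "border A n * border C n = border (A * C) n"
proof -
  have "border A n * border C n = four_block_mat (A * C + 0\<^sub>m n 1 * 0\<^sub>m 1 n) (A * 0\<^sub>m n 1 + 0\<^sub>m n 1 * 1\<^sub>m 1)
      (0\<^sub>m 1 n * C + 1\<^sub>m 1 * 0\<^sub>m 1 n) (0\<^sub>m 1 n * 0\<^sub>m n 1 + 1\<^sub>m 1 * 1\<^sub>m 1)"
    using assms by (intro mult_four_block_mat[of _ n n _ 1 _ 1]) auto
  also have "A * C + 0\<^sub>m n 1 * 0\<^sub>m 1 n = A * C" using assms by (simp add: left_mult_zero_mat[of _ 1 n])
  also have "A * 0\<^sub>m n 1 + 0\<^sub>m n 1 * 1\<^sub>m 1 = 0\<^sub>m n 1"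
    using assms by (simp add: right_mult_zero_mat[of _ n n])
  also have "0\<^sub>m 1 n * C + 1\<^sub>m 1 * 0\<^sub>m 1 n = 0\<^sub>m 1 n"
    using assms by (simp add: left_mult_zero_mat[of _ n n])
  also have "0\<^sub>m 1 n * 0\<^sub>m n 1 + 1\<^sub>m 1 * 1\<^sub>m 1 = (1\<^sub>m 1 :: 'a mat)"
    by (simp add: left_mult_zero_mat[of _ n 1])
  finally show ?thesis .
qed

lemma mat_equivalent_border:
  assumes A: "A \<in> carrier_mat n n" and "mat_equivalent n A D"
  shows "mat_equivalent (Suc n) (border A n) (border D n)"
proof -
  obtain P Q where PQ: "P \<in> carrier_mat n n" "Q \<in> carrier_mat n n" "det P \<noteq> 0" "det Q \<noteq> 0" "D = P * A * Q"
    using assms(2) by (auto simp: mat_equivalent_def)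
  have det: "det (border M n) = det M" if "M \<in> carrier_mat n n" for M :: "'a mat"
    using that by (subst det_four_block_mat_lower_left_zero[of _ n _ 1]) auto
  have "P * A \<in> carrier_mat n n" using A PQ(1) by simp
  then have "border P n * border A n * border Q n = border D n"
    by (simp only: border_mult[OF PQ(1) A] border_mult[OF _ PQ(2)] PQ(5))
  then show ?thesis
    using PQ det by (intro mat_equivalentI[of "border P n" _ "border Q n"]) auto
qed

text \<open>Block elimination with the invertible corner \<open>a\<close>: \<open>P\<close> clears
  the last column, \<open>Q\<close> clears the last row and scales the corner to 1, and
  \<open>A'\<close> is the Schur complement.\<close>

lemma mat_equivalent_clear_border:
  fixes a :: "'a::field"
  assumes A: "A \<in> carrier_mat n n" and b: "b \<in> carrier_mat n 1" and c: "c \<in> carrier_mat 1 n" and a: "a \<noteq> 0"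
  shows "\<exists>A'\<in>carrier_mat n n. mat_equivalent (Suc n) (four_block_mat A b c (mat 1 1 (\<lambda>_. a))) (border A' n)"
proof -
  let ?a = "mat 1 1 (\<lambda>_. a)" and ?i = "mat 1 1 (\<lambda>_. 1 / a)"
  let ?b = "(- 1 / a) \<cdot>\<^sub>m b" and ?c = "(- 1 / a) \<cdot>\<^sub>m c"
  define P where "P = four_block_mat (1\<^sub>m n) ?b (0\<^sub>m 1 n) (1\<^sub>m 1)"
  define Q where "Q = four_block_mat (1\<^sub>m n) (0\<^sub>m n 1) ?c ?i"
  define A' where "A' = A + ?b * c"
  have A': "A' \<in> carrier_mat n n"
    unfolding A'_def by (intro add_carrier_mat mult_carrier_mat[OF _ c] smult_carrier_mat b)
  have "P * four_block_mat A b c ?a = four_block_mat (1\<^sub>m n * A + ?b * c) (1\<^sub>m n * b + ?b * ?a)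
      (0\<^sub>m 1 n * A + 1\<^sub>m 1 * c) (0\<^sub>m 1 n * b + 1\<^sub>m 1 * ?a)"
    unfolding P_def using A b c by (intro mult_four_block_mat[of _ n n _ 1 _ 1]) auto
  also have "1\<^sub>m n * A + ?b * c = A'" using A by (simp add: A'_def)
  also have "1\<^sub>m n * b + ?b * ?a = 0\<^sub>m n 1"
    using b a by (intro eq_matI) (auto simp: scalar_prod_def)
  also have "0\<^sub>m 1 n * A + 1\<^sub>m 1 * c = c" using A c by (simp add: left_mult_zero_mat[of _ n n])
  also have "0\<^sub>m 1 n * b + 1\<^sub>m 1 * ?a = ?a" using b by (simp add: left_mult_zero_mat[of _ n 1])
  finally have "P * four_block_mat A b c ?a * Q = four_block_mat A' (0\<^sub>m n 1) c ?a * Q" by simp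
  also have "\<dots> = four_block_mat (A' * 1\<^sub>m n + 0\<^sub>m n 1 * ?c) (A' * 0\<^sub>m n 1 + 0\<^sub>m n 1 * ?i)
      (c * 1\<^sub>m n + ?a * ?c) (c * 0\<^sub>m n 1 + ?a * ?i)"
    unfolding Q_def using A' c by (intro mult_four_block_mat[of _ n n _ 1 _ 1]) auto
  also have "A' * 1\<^sub>m n + 0\<^sub>m n 1 * ?c = A'" using A' c by (simp add: left_mult_zero_mat[of _ 1 n])
  also have "A' * 0\<^sub>m n 1 + 0\<^sub>m n 1 * ?i = 0\<^sub>m n 1"
    using A' by (simp add: left_mult_zero_mat[of _ 1 1] right_mult_zero_mat[of _ n n])
  also have "c * 1\<^sub>m n + ?a * ?c = 0\<^sub>m 1 n"
    using c a by (intro eq_matI) (auto simp: scalar_prod_def)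
  also have "c * 0\<^sub>m n 1 + ?a * ?i = 1\<^sub>m 1"
    using c a by (intro eq_matI) (auto simp: scalar_prod_def)
  finally have "border A' n = P * four_block_mat A b c ?a * Q" by simp
  moreover have "det P = 1"
    unfolding P_def using b by (subst det_four_block_mat_lower_left_zero[of _ n _ 1]) auto
  moreover have "det Q = 1 / a"
    unfolding Q_def using c by (subst det_four_block_mat_upper_right_zero[of _ n _ 1]) (auto simp: det_single)
  moreover have "P \<in> carrier_mat (Suc n) (Suc n)" "Q \<in> carrier_mat (Suc n) (Suc n)"
    by (auto intro!: carrier_matI simp: P_def Q_def)
  ultimately show ?thesis using A' a by (intro bexI[of _ A'] mat_equivalentI[of P _ Q]) auto
qed

text \<open>The zeros come first, so that for \<open>r \<le> n\<close> the number \<open>r\<close>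
  is the corank and the corank arguments find their zeros at the positions 0 and 1.\<close>

definition partial_identity :: "nat \<Rightarrow> nat \<Rightarrow> 'a::field mat" where
  "partial_identity n r = mat n n (\<lambda>(i, j). if i = j \<and> r \<le> i then 1 else 0)"

text \<open>A nonzero entry is moved to the last position, so that the induction peels off the last
  row and column and the ones collect at the end of the diagonal.\<close>

lemma mat_equivalent_partial_identity:
  fixes A :: "'a::field mat"
  shows "A \<in> carrier_mat n n \<Longrightarrow> \<exists>r\<le>n. mat_equivalent n A (partial_identity n r)"
proof (induction n arbitrary: A)
  case 0
  then have "partial_identity 0 0 = A" by (intro eq_matI) (auto simp: partial_identity_def)
  then show ?case using mat_equivalent_refl[OF 0] by auto
next
  case (Suc n)
  show ?case
  proof (cases "\<exists>p q. p \<le> n \<and> q \<le> n \<and> A $$ (p, q) \<noteq> 0")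
    case False
    then have "partial_identity (Suc n) (Suc n) = A"
      using Suc.prems by (intro eq_matI) (auto simp: partial_identity_def less_Suc_eq_le)
    then show ?thesis using mat_equivalent_refl[OF Suc.prems] by auto
  next
    case True
    then obtain p q where pq: "p \<le> n" "q \<le> n" "A $$ (p, q) \<noteq> 0" by blast
    define C where "C = swapcols q n (swaprows p n A)"
    have swr: "swaprows p n A \<in> carrier_mat (Suc n) (Suc n)" using Suc.prems by simp
    have C: "C \<in> carrier_mat (Suc n) (Suc n)"
      using Suc.prems by (intro carrier_matI) (simp_all add: C_def)
    have AC: "mat_equivalent (Suc n) A C"
      unfolding C_def using pq
      by (intro mat_equivalent_trans[OF Suc.prems mat_equivalent_swaprows[OF Suc.prems]
          mat_equivalent_swapcols[OF swr]]) auto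
    have a: "C $$ (n, n) \<noteq> 0" using pq Suc.prems by (auto simp: C_def)
    define A1 b c where "A1 = mat n n (\<lambda>ij. C $$ ij)" and "b = mat n 1 (\<lambda>(i, j). C $$ (i, n))"
      and "c = mat 1 n (\<lambda>(i, j). C $$ (n, j))"
    have block: "C = four_block_mat A1 b c (mat 1 1 (\<lambda>_. C $$ (n, n)))"
      using C by (intro eq_matI) (auto simp: A1_def b_def c_def less_Suc_eq)
    obtain A' where A': "A' \<in> carrier_mat n n" "mat_equivalent (Suc n) C (border A' n)"
      using mat_equivalent_clear_border[of A1 n b c, OF _ _ _ a] block
      by (auto simp: A1_def b_def c_def)
    obtain r where r: "r \<le> n" "mat_equivalent n A' (partial_identity n r)" using Suc.IH[OF A'(1)] by blast
    have "border (partial_identity n r :: 'a mat) n = partial_identity (Suc n) r"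
      using r(1) by (intro eq_matI) (auto simp: partial_identity_def less_Suc_eq)
    then have "mat_equivalent (Suc n) (border A' n) (partial_identity (Suc n) r)"
      using mat_equivalent_border[OF A'(1) r(2)] by simp
    from mat_equivalent_trans[OF Suc.prems AC mat_equivalent_trans[OF C A'(2) this]]
    show ?thesis using r(1) by (intro exI[of _ r]) auto
  qed
qed

section \<open>Normalising a determinantal expression\<close>

lemma det_affine_matrix_mult:
  fixes A P Q :: "'k::field mat" and B :: "'n::finite \<Rightarrow> 'k mat"
  assumes A: "A \<in> carrier_mat m m" and B: "\<And>v. B v \<in> carrier_mat m m"
    and P: "P \<in> carrier_mat m m" and Q: "Q \<in> carrier_mat m m"
  shows "det (affine_matrix m (P * A * Q) (\<lambda>v. P * B v * Q)) =
     Const (det P * det Q) * det (affine_matrix m A B)"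
proof -
  interpret c: comm_ring_hom "Const :: 'k \<Rightarrow> ('n, 'k) mpol"
    by unfold_locales (auto simp: Const_add Const_mult)
  have mult_index: "(C * D) $$ (i, j) = (\<Sum>k = 0..<m. C $$ (i, k) * D $$ (k, j))"
    if "C \<in> carrier_mat m m" "D \<in> carrier_mat m m" "i < m" "j < m" for C D :: "'k mat" and i j
    using that by (simp add: scalar_prod_def)
  have left: "affine_matrix m (P * A) (\<lambda>v. P * B v) = map_mat Const P * affine_matrix m A B"
    if A: "A \<in> carrier_mat m m" and B: "\<And>v. B v \<in> carrier_mat m m" for A and B :: "'n \<Rightarrow> 'k mat"
  proof (rule eq_matI)
    fix i j assume "i < dim_row (map_mat Const P * affine_matrix m A B)"
      "j < dim_col (map_mat Const P * affine_matrix m A B)"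
    then have ij: "i < m" "j < m" using P by (auto simp: affine_matrix_def)
    have "affine_matrix m (P * A) (\<lambda>v. P * B v) $$ (i, j) = (\<Sum>k = 0..<m. Const (P $$ (i, k)) * Const (A $$ (k, j))) +
        (\<Sum>v\<in>UNIV. \<Sum>k = 0..<m. Const (P $$ (i, k)) * (Const (B v $$ (k, j)) * Var v))"
      unfolding affine_matrix_index[OF ij] mult_index[OF P A ij] mult_index[OF P B ij]
      by (simp only: Const_sum Const_mult sum_distrib_right mult.assoc)
    also have "(\<Sum>v\<in>UNIV. \<Sum>k = 0..<m. Const (P $$ (i, k)) * (Const (B v $$ (k, j)) * Var v)) =
        (\<Sum>k = 0..<m. Const (P $$ (i, k)) * (\<Sum>v\<in>UNIV. Const (B v $$ (k, j)) * Var v))"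
      by (subst sum.swap) (simp add: sum_distrib_left)
    finally show "affine_matrix m (P * A) (\<lambda>v. P * B v) $$ (i, j) = (map_mat Const P * affine_matrix m A B) $$ (i, j)"
      using P ij by (simp add: affine_matrix_def scalar_prod_def distrib_left sum.distrib)
  qed (use P in \<open>auto simp: affine_matrix_def\<close>)
  have right: "affine_matrix m (A * Q) (\<lambda>v. B v * Q) = affine_matrix m A B * map_mat Const Q"
    if A: "A \<in> carrier_mat m m" and B: "\<And>v. B v \<in> carrier_mat m m" for A and B :: "'n \<Rightarrow> 'k mat"
  proof (rule eq_matI)
    fix i j assume "i < dim_row (affine_matrix m A B * map_mat Const Q)"
      "j < dim_col (affine_matrix m A B * map_mat Const Q)"
    then have ij: "i < m" "j < m" using Q by (auto simp: affine_matrix_def)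
    have "affine_matrix m (A * Q) (\<lambda>v. B v * Q) $$ (i, j) = (\<Sum>k = 0..<m. Const (A $$ (i, k)) * Const (Q $$ (k, j))) +
        (\<Sum>v\<in>UNIV. \<Sum>k = 0..<m. Const (B v $$ (i, k)) * Var v * Const (Q $$ (k, j)))"
      unfolding affine_matrix_index[OF ij] mult_index[OF A Q ij] mult_index[OF B Q ij]
      by (simp only: Const_sum Const_mult sum_distrib_right mult.assoc mult.commute[of "Const (Q $$ _)"])
    also have "(\<Sum>v\<in>UNIV. \<Sum>k = 0..<m. Const (B v $$ (i, k)) * Var v * Const (Q $$ (k, j))) =
        (\<Sum>k = 0..<m. (\<Sum>v\<in>UNIV. Const (B v $$ (i, k)) * Var v) * Const (Q $$ (k, j)))"
      by (subst sum.swap) (simp add: sum_distrib_right)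
    finally show "affine_matrix m (A * Q) (\<lambda>v. B v * Q) $$ (i, j) = (affine_matrix m A B * map_mat Const Q) $$ (i, j)"
      using Q ij by (simp add: affine_matrix_def scalar_prod_def distrib_right sum.distrib)
  qed (use Q in \<open>auto simp: affine_matrix_def\<close>)
  have "affine_matrix m (P * A * Q) (\<lambda>v. P * B v * Q) = map_mat Const P * affine_matrix m A B * map_mat Const Q"
    using A B P by (subst right) (auto simp: left)
  moreover have "det (map_mat Const P * affine_matrix m A B * map_mat Const Q) =
      det (map_mat Const P :: ('n, 'k) mpol mat) * det (affine_matrix m A B) * det (map_mat Const Q :: ('n, 'k) mpol mat)"
    using P Q by (simp add: det_mult[of _ m])
  ultimately show ?thesis by (simp only: c.hom_det Const_mult mult_ac)
qed

text \<open>The affine matrix is congruent to its constant part modulo positive weight, so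
  \<open>det A\<close> is a constant of positive order.\<close>

lemma det_constant_part:
  fixes A :: "'k::field mat" and B :: "'n::finite \<Rightarrow> 'k mat"
  assumes A: "A \<in> carrier_mat m m" and f: "det (affine_matrix m A B) \<in> wfilt (\<lambda>_. 1) 1"
  shows "det A = 0"
proof -
  interpret c: comm_ring_hom "Const :: 'k \<Rightarrow> ('n, 'k) mpol"
    by unfold_locales (auto simp: Const_add Const_mult)
  have "det (affine_matrix m A B) - det (map_mat Const A) \<in> wfilt (\<lambda>_ :: 'n. 1) 1"
  proof (rule det_congruent[of _ m _ UNIV])
    fix i j assume ij: "i < m" "j < m"
    have "(\<Sum>v\<in>UNIV. Const (B v $$ (i, j)) * Var v) \<in> wfilt (\<lambda>_ :: 'n. 1) 1"
      by (intro wfilt_sum wfilt_mult_left Var_in_wfilt) simp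
    then show "affine_matrix m A B $$ (i, j) \<in> UNIV \<and> map_mat Const A $$ (i, j) \<in> UNIV \<and>
        affine_matrix m A B $$ (i, j) - map_mat Const A $$ (i, j) \<in> wfilt (\<lambda>_. 1) 1"
      using A ij by (simp add: affine_matrix_index)
  qed (use A in \<open>auto intro: wfilt_add wfilt_mult_left\<close>)
  from wfilt_diff[OF f this] have "Const (det A) \<in> wfilt (\<lambda>_ :: 'n. 1) 1" by simp
  then show ?thesis by (auto simp: Const_def wfilt_def split: if_splits)
qed

lemma codim_Sing_less:
  fixes A :: "'k::field mat" and B :: "'n::finite \<Rightarrow> 'k mat"
  assumes m: "0 < m" and A: "A \<in> carrier_mat m m" and B: "\<And>v. B v \<in> carrier_mat m m"
    and f: "f = det (affine_matrix m A B)" and hom: "homogeneous_of_degree d f" "2 < d"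
    and codim: "codim (Sing f) > 4"
  shows "codim (Sing f) \<le> enat (m - 1)"
proof -
  have "f \<in> wfilt (\<lambda>_. 1) 1"
    using homogeneous_in_wfilt[OF hom(1)] wfilt_antimono[of 1 d "\<lambda>_. 1"] hom(2) by auto
  then have A0: "det A = 0" using det_constant_part[OF A] f by simp
  obtain r where r: "r \<le> m" "mat_equivalent m A (partial_identity m r)"
    using mat_equivalent_partial_identity[OF A] by blast
  then obtain P Q where PQ: "P \<in> carrier_mat m m" "Q \<in> carrier_mat m m" "det P \<noteq> 0" "det Q \<noteq> 0"
    "partial_identity m r = P * A * Q" by (auto simp: mat_equivalent_def)
  have "det (partial_identity m r :: 'k mat) = 0" using PQ A A0 by (simp add: det_mult[of _ m])
  moreover have "partial_identity m 0 = (1\<^sub>m m :: 'k mat)"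
    by (intro eq_matI) (auto simp: partial_identity_def)
  ultimately have "r \<noteq> 0" by (metis det_one zero_neq_one)
  \<comment> \<open>Compensates the factor \<open>det P * det Q\<close>, so that the new determinant
    is \<open>f\<close> itself. Scaling row 0 does not affect \<open>partial_identity m r\<close>,
    whose row 0 is zero because \<open>r \<noteq> 0\<close>.\<close>
  define S where "S = multrow_mat m 0 (1 / (det P * det Q))"
  have S: "S \<in> carrier_mat m m" "det S = 1 / (det P * det Q)"
    using m by (simp_all add: S_def det_multrow_mat)
  have "S * partial_identity m r = multrow 0 (1 / (det P * det Q)) (partial_identity m r)"
    unfolding S_def using m by (intro multrow_mat[symmetric]) (auto simp: partial_identity_def)
  also have "\<dots> = partial_identity m r"
    using \<open>r \<noteq> 0\<close> by (intro eq_matI) (auto simp: partial_identity_def)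
  finally have SD: "partial_identity m r = S * (P * A * Q)" using PQ(5) by simp
  also have "\<dots> = S * P * A * Q"
    using S(1) PQ(1,2) A assoc_mult_mat[of S m m "P * A" m Q m] assoc_mult_mat[of S m m P m A m] by simp
  finally have D: "partial_identity m r = S * P * A * Q" .
  define B' where "B' v = S * P * B v * Q" for v
  have "det (affine_matrix m (S * P * A * Q) B') = Const (det (S * P) * det Q) * f"
    unfolding f B'_def using S(1) PQ A B by (intro det_affine_matrix_mult) auto
  also have "det (S * P) * det Q = 1"
    using S PQ by (simp add: det_mult[of _ m])
  finally have f': "f = det (affine_matrix m (partial_identity m r) B')" using D by simp
  show ?thesis
  proof (cases "r = 1")
    case True
    have "partial_identity m r = mat m m (\<lambda>(i, j). if i = j \<and> 0 < i then 1 else 0)"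
      using True by (simp add: partial_identity_def Suc_le_eq)
    then show ?thesis
      unfolding f' using hom unfolding f' by (intro codim_Sing_le_corank_1[OF m])
  next
    case False
    then have "2 \<le> r" using \<open>r \<noteq> 0\<close> by simp
    have "partial_identity m r = mat m m (\<lambda>(i, j). if i = j then (if r \<le> i then 1 else 0) else 0)"
      unfolding partial_identity_def by (intro eq_matI) auto
    then have "codim (Sing (det (affine_matrix m (partial_identity m r) B'))) \<le> 4"
      by (rule codim_Sing_le_4[rotated]) (use \<open>2 \<le> r\<close> r(1) in auto)
    then have "codim (Sing f) \<le> 4" using f' by simp
    then show ?thesis using codim by simp
  qed
qed

theorem theorem1p2:
  fixes f :: "('n::finite, 'k::field) mpol" and d :: nat
  assumes "homogeneous_of_degree d f"
    and "d > 2"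
    and "codim (Sing f) > 4"
  shows "dc f \<ge> codim (Sing f) + 1"
  unfolding dc_def
proof (rule INF_greatest)
  fix m assume "m \<in> {m. m > 0 \<and> has_determinantal_expression m f}"
  then have m: "m > 0" and "has_determinantal_expression m f" by auto
  then obtain A B where "A \<in> carrier_mat m m" "\<forall>v. B v \<in> carrier_mat m m" "f = det (affine_matrix m A B)"
    by (auto simp: has_determinantal_expression_def)
  then have "codim (Sing f) \<le> enat (m - 1)" using codim_Sing_less[OF m _ _ _ assms] by blast
  \<comment> \<open>\<open>m > 0\<close> keeps the subtraction in \<open>m - 1\<close> from
    truncating, so adding 1 gives back \<open>m\<close>.\<close>
  then have "codim (Sing f) + 1 \<le> enat (m - 1) + 1" by (rule add_right_mono)
  also have "\<dots> = enat m" using m by (simp add: one_enat_def)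
  finally show "codim (Sing f) + 1 \<le> enat m" .
qed

end
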